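(* Gluing (taking the sum of) a modular connected system produces a modular, l.f.f.c. lattice, and dissecting a modular, l.f.f.c. lattice produces a modular connected system. These two mappings induce mutually inverse mappings between the isomorphism classes of modular connected systems and the isomorphism classes of modular, l.f.f.c. lattices; in particular both mappings are bijective on isomorphism classes. Moreover, the skeleton of a modular connected system has a minimum element if and only if the corresponding lattice has a minimum element.
   Context: A lattice is locally finite if every closed interval is finite; it has finite covers if every element has finitely many upper covers and finitely many lower covers; it is l.f.f.c. if both hold. $x\lessdot y$ means $y$ covers $x$. A tolerance on a lattice $S$ is a reflexive, symmetric relation $\gamma$ such that $a\,\gamma\,b$ and $c\,\gamma\,d$ imply $(a\vee c)\,\gamma\,(b\vee d)$ and $(a\wedge c)\,\gamma\,(b\wedge d)$; write $x\le_\gamma y$ for ($x\le y$ and $x\,\gamma\,y$). A modular connected system (m.c. system) $\mathcal C=(S,\gamma,(L_x)_{x\in S},(\varphi_x^y)_{x\le_\gamma y})$ consists of a lattice $S$ (skeleton), a tolerance $\gamma$ on $S$, lattices $L_x$ (blocks) and maps $\varphi_x^y$ (connections), such that: (MC1) $S$ is l.f.f.c.; (MC2) each $L_x$ is a finite modular complemented lattice; (MC3) each $\varphi_x^y$ is a lattice isomorphism from a (nonempty) lattice filter $F_x^y$ of $L_x$ onto a lattice ideal $I_x^y$ of $L_y$; (MC4) $F_x^x=I_x^x=L_x$ and $\varphi_x^x$ is the identity; (MC5) if $x\le_\gamma y\le_\gamma z$ and $I_x^y\cap F_y^z\ne\emptyset$ then $x\,\gamma\,z$; (MC6) if $x\le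 z\le y$ and $x\,\gamma\,y$ then $F_x^y=(\varphi_x^z)^{-1}(I_x^z\cap F_z^y)$, $I_x^y=\varphi_z^y(I_x^z\cap F_z^y)$ and $\varphi_x^y=\varphi_z^y\circ\varphi_x^z|_{F_x^y}$; (MC7) if $x\,\gamma\,y$ then $I_x^{x\vee y}\cap I_y^{x\vee y}\subseteq I_{x\wedge y}^{x\vee y}$ and $F_{x\wedge y}^x\cap F_{x\wedge y}^y\subseteq F_{x\wedge y}^{x\vee y}$; (MC8.1) if $x\lessdot y$ in $S$ then $x\,\gamma\,y$; (MC8.2) if $x\lessdot y$ in $S$ then $F_x^y\ne L_x$ and $I_x^y\ne L_y$. An isomorphism from $\mathcal C$ to another m.c. system $\mathcal C'=(S',\gamma',(L'_x),(\varphi'^y_x))$ is a lattice isomorphism $\chi_S:S\to S'$ together with lattice isomorphisms $\chi_x:L_x\to L'_{\chi_S(x)}$ ($x\in S$) such that $x\,\gamma\,y\iff\chi_S(x)\,\gamma'\,\chi_S(y)$, and for $x\le_\gamma y$: $F'^{\chi_S(y)}_{\chi_S(x)}=\chi_x(F_x^y)$, $I'^{\chi_S(y)}_{\chi_S(x)}=\chi_y(I_x^y)$, and $\chi_y(\varphi_x^y(a))=\varphi'^{\chi_S(y)}_{\chi_S(x)}(\chi_x(a))$ for all $a\in F_x^y$. Sum (gluing): let $M=\{(x,a):x\in S,a\in L_x\}$ and $(x,a)\sim(y,b)$ iff $x\,\gamma\,y$, $a\in F_x^{x\vee y}$, $b\in F_y^{x\vee y}$ and $\varphi_x^{x\vee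 y}(a)=\varphi_y^{x\vee y}(b)$; this is an equivalence relation. The sum is $L=M/{\sim}$; let $\pi_x(a)$ be the class of $(x,a)$ and $\Lambda_x=\pi_x(L_x)$ ($\pi_x$ is injective). For $v\in S$ and $a,b\in L$, write $a\le_v b$ iff $a,b\in\Lambda_v$ and $\pi_v^{-1}a\le\pi_v^{-1}b$ in $L_v$. Order $L$ by $a\le b$ iff there exist $n\ge0$, $x_1\le\dots\le x_n$ in $S$ and $a=a_0\le_{x_1}a_1\le_{x_2}\dots\le_{x_n}a_n=b$ in $L$. Dissection: for a modular l.f.f.c. lattice $L$ and $x\in L$, let $x^*=x$ if $x$ is the greatest element of $L$ and otherwise $x^*$ is the join of all upper covers of $x$; dually $x_*$. A block of $L$ is a maximal (under inclusion) complemented interval $B=[0_B,1_B]$ of $L$ (equivalently an interval $[x,y]$ with $x^*=y$, $y_*=x$). The set $S$ of blocks, ordered by $B\le C$ iff $0_B\le 0_C$ (equivalently $1_B\le 1_C$), is a lattice. The dissection of $L$ is the system with skeleton $S$, tolerance $B\,\gamma\,C$ iff $B\cap C\ne\emptyset$, block $L_B=B$ (ordered as in $L$), and for $B\le C$ with $B\cap C\ne\emptyset$, $F_B^C=I_B^C=B\cap C$ with $\varphi_B^C$ the identity map. *)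

theory Defs
  imports "HOL-Algebra.Lattice"
begin

text \<open>
  Lattices are those of HOL-Algebra: an explicit carrier inside an arbitrary type, with the
  empty carrier allowed.  A sublattice on a subset \<open>A\<close> is \<open>L\<lparr>carrier := A\<rparr>\<close>, so that its joins,
  meets and bounds are computed relative to \<open>A\<close>.
\<close>

section \<open>Lattices\<close>

definition covers :: "'a gorder \<Rightarrow> 'a \<Rightarrow> 'a \<Rightarrow> bool" where
  "covers L x y \<longleftrightarrow> x \<in> carrier L \<and> y \<in> carrier L \<and> x \<sqsubset>\<^bsub>L\<^esub> y \<and>
     \<not> (\<exists>z\<in>carrier L. x \<sqsubset>\<^bsub>L\<^esub> z \<and> z \<sqsubset>\<^bsub>L\<^esub> y)"

definition locally_finite :: "'a gorder \<Rightarrow> bool" where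
  "locally_finite L \<longleftrightarrow> (\<forall>x\<in>carrier L. \<forall>y\<in>carrier L. finite \<lbrace>x..y\<rbrace>\<^bsub>L\<^esub>)"

definition finite_covers :: "'a gorder \<Rightarrow> bool" where
  "finite_covers L \<longleftrightarrow>
     (\<forall>x\<in>carrier L. finite {y. covers L x y} \<and> finite {y. covers L y x})"

definition lffc_lattice :: "'a gorder \<Rightarrow> bool" where
  "lffc_lattice L \<longleftrightarrow> lattice L \<and> locally_finite L \<and> finite_covers L"

definition modular_lattice :: "'a gorder \<Rightarrow> bool" where
  "modular_lattice L \<longleftrightarrow> lattice L \<and>
     (\<forall>a\<in>carrier L. \<forall>b\<in>carrier L. \<forall>c\<in>carrier L.
        a \<sqsubseteq>\<^bsub>L\<^esub> c \<longrightarrow> a \<squnion>\<^bsub>L\<^esub> (b \<sqinter>\<^bsub>L\<^esub> c) = (a \<squnion>\<^bsub>L\<^esub> b) \<sqinter>\<^bsub>L\<^esub> c)"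

definition complemented_lattice :: "'a gorder \<Rightarrow> bool" where
  "complemented_lattice L \<longleftrightarrow> bounded_lattice L \<and>
     (\<forall>a\<in>carrier L. \<exists>b\<in>carrier L. a \<squnion>\<^bsub>L\<^esub> b = \<top>\<^bsub>L\<^esub> \<and> a \<sqinter>\<^bsub>L\<^esub> b = \<bottom>\<^bsub>L\<^esub>)"

definition modular_lffc_lattice :: "'a gorder \<Rightarrow> bool" where
  "modular_lffc_lattice L \<longleftrightarrow> modular_lattice L \<and> lffc_lattice L"

definition has_minimum :: "'a gorder \<Rightarrow> bool" where
  "has_minimum L \<longleftrightarrow> (\<exists>m. least L m (carrier L))"

definition lattice_filter :: "'a gorder \<Rightarrow> 'a set \<Rightarrow> bool" where
  "lattice_filter L F \<longleftrightarrow> F \<subseteq> carrier L \<and> F \<noteq> {} \<and>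
     (\<forall>a\<in>F. \<forall>b\<in>carrier L. a \<sqsubseteq>\<^bsub>L\<^esub> b \<longrightarrow> b \<in> F) \<and>
     (\<forall>a\<in>F. \<forall>b\<in>F. a \<sqinter>\<^bsub>L\<^esub> b \<in> F)"

definition lattice_ideal :: "'a gorder \<Rightarrow> 'a set \<Rightarrow> bool" where
  "lattice_ideal L I \<longleftrightarrow> I \<subseteq> carrier L \<and> I \<noteq> {} \<and>
     (\<forall>a\<in>I. \<forall>b\<in>carrier L. b \<sqsubseteq>\<^bsub>L\<^esub> a \<longrightarrow> b \<in> I) \<and>
     (\<forall>a\<in>I. \<forall>b\<in>I. a \<squnion>\<^bsub>L\<^esub> b \<in> I)"

definition lattice_iso :: "'a gorder \<Rightarrow> 'b gorder \<Rightarrow> ('a \<Rightarrow> 'b) \<Rightarrow> bool" where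
  "lattice_iso L M f \<longleftrightarrow>
     bij_betw f (carrier L) (carrier M) \<and> join_pres L M f \<and> meet_pres L M f"

definition lattice_isomorphic :: "'a gorder \<Rightarrow> 'b gorder \<Rightarrow> bool" (infix \<open>\<cong>\<^sub>L\<close> 50) where
  "L \<cong>\<^sub>L M \<longleftrightarrow> (\<exists>f. lattice_iso L M f)"

definition tolerance :: "'a gorder \<Rightarrow> ('a \<Rightarrow> 'a \<Rightarrow> bool) \<Rightarrow> bool" where
  "tolerance S \<gamma> \<longleftrightarrow>
     (\<forall>a\<in>carrier S. \<gamma> a a) \<and>
     (\<forall>a\<in>carrier S. \<forall>b\<in>carrier S. \<gamma> a b \<longrightarrow> \<gamma> b a) \<and>
     (\<forall>a\<in>carrier S. \<forall>b\<in>carrier S. \<forall>c\<in>carrier S. \<forall>d\<in>carrier S.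
        \<gamma> a b \<and> \<gamma> c d \<longrightarrow> \<gamma> (a \<squnion>\<^bsub>S\<^esub> c) (b \<squnion>\<^bsub>S\<^esub> d) \<and> \<gamma> (a \<sqinter>\<^bsub>S\<^esub> c) (b \<sqinter>\<^bsub>S\<^esub> d))"

section \<open>Modular connected systems\<close>

text \<open>
  A connection \<open>\<phi>\<^sub>x\<^sup>y\<close> is a partial map.  It is represented by a total function
  \<open>conn x y\<close> together with its domain \<open>fil x y\<close> (the filter \<open>F\<^sub>x\<^sup>y\<close>); the ideal \<open>I\<^sub>x\<^sup>y\<close> is
  its image.  All blocks live in one type, but need not be disjoint.  Values of the fields at
  arguments outside the skeleton, at pairs not related by \<open>x \<le>\<^sub>\<gamma> y\<close>, or outside \<open>F\<^sub>x\<^sup>y\<close>,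
  are irrelevant.
\<close>

record ('s, 'b) mc_data =
  skel :: "'s gorder"
  tol :: "'s \<Rightarrow> 's \<Rightarrow> bool"
  block :: "'s \<Rightarrow> 'b gorder"
  fil :: "'s \<Rightarrow> 's \<Rightarrow> 'b set"
  conn :: "'s \<Rightarrow> 's \<Rightarrow> 'b \<Rightarrow> 'b"

definition idl :: "('s, 'b) mc_data \<Rightarrow> 's \<Rightarrow> 's \<Rightarrow> 'b set" where
  "idl C x y = conn C x y ` fil C x y"

definition le_tol :: "('s, 'b) mc_data \<Rightarrow> 's \<Rightarrow> 's \<Rightarrow> bool" where
  "le_tol C x y \<longleftrightarrow>
     x \<in> carrier (skel C) \<and> y \<in> carrier (skel C) \<and> x \<sqsubseteq>\<^bsub>skel C\<^esub> y \<and> tol C x y"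

locale mc_system =
  fixes C :: "('s, 'b) mc_data"
  assumes MC1: "lffc_lattice (skel C)"
    and tolerance: "tolerance (skel C) (tol C)"
    and MC2: "x \<in> carrier (skel C) \<Longrightarrow>
      finite (carrier (block C x)) \<and> modular_lattice (block C x) \<and>
      complemented_lattice (block C x)"
    and MC3: "le_tol C x y \<Longrightarrow>
      lattice_filter (block C x) (fil C x y) \<and> lattice_ideal (block C y) (idl C x y) \<and>
      lattice_iso ((block C x)\<lparr>carrier := fil C x y\<rparr>) ((block C y)\<lparr>carrier := idl C x y\<rparr>)
        (conn C x y)"
    and MC4: "x \<in> carrier (skel C) \<Longrightarrow>
      fil C x x = carrier (block C x) \<and> idl C x x = carrier (block C x) \<and>
      (\<forall>a\<in>carrier (block C x). conn C x x a = a)"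
    and MC5: "\<lbrakk>le_tol C x y; le_tol C y z; idl C x y \<inter> fil C y z \<noteq> {}\<rbrakk> \<Longrightarrow> tol C x z"
    and MC6: "\<lbrakk>x \<in> carrier (skel C); y \<in> carrier (skel C); z \<in> carrier (skel C);
        x \<sqsubseteq>\<^bsub>skel C\<^esub> z; z \<sqsubseteq>\<^bsub>skel C\<^esub> y; tol C x y\<rbrakk> \<Longrightarrow>
      fil C x y = {a \<in> fil C x z. conn C x z a \<in> idl C x z \<inter> fil C z y} \<and>
      idl C x y = conn C z y ` (idl C x z \<inter> fil C z y) \<and>
      (\<forall>a\<in>fil C x y. conn C x y a = conn C z y (conn C x z a))"
    and MC7: "\<lbrakk>x \<in> carrier (skel C); y \<in> carrier (skel C); tol C x y\<rbrakk> \<Longrightarrow>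
      idl C x (x \<squnion>\<^bsub>skel C\<^esub> y) \<inter> idl C y (x \<squnion>\<^bsub>skel C\<^esub> y)
        \<subseteq> idl C (x \<sqinter>\<^bsub>skel C\<^esub> y) (x \<squnion>\<^bsub>skel C\<^esub> y) \<and>
      fil C (x \<sqinter>\<^bsub>skel C\<^esub> y) x \<inter> fil C (x \<sqinter>\<^bsub>skel C\<^esub> y) y
        \<subseteq> fil C (x \<sqinter>\<^bsub>skel C\<^esub> y) (x \<squnion>\<^bsub>skel C\<^esub> y)"
    and MC8_1: "covers (skel C) x y \<Longrightarrow> tol C x y"
    and MC8_2: "covers (skel C) x y \<Longrightarrow>
      fil C x y \<noteq> carrier (block C x) \<and> idl C x y \<noteq> carrier (block C y)"

definition mc_iso ::
  "('s, 'b) mc_data \<Rightarrow> ('t, 'c) mc_data \<Rightarrow> ('s \<Rightarrow> 't) \<Rightarrow> ('s \<Rightarrow> 'b \<Rightarrow> 'c) \<Rightarrow> bool" where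
  "mc_iso C C' \<chi>S \<chi> \<longleftrightarrow>
     lattice_iso (skel C) (skel C') \<chi>S \<and>
     (\<forall>x\<in>carrier (skel C). lattice_iso (block C x) (block C' (\<chi>S x)) (\<chi> x)) \<and>
     (\<forall>x\<in>carrier (skel C). \<forall>y\<in>carrier (skel C). tol C x y \<longleftrightarrow> tol C' (\<chi>S x) (\<chi>S y)) \<and>
     (\<forall>x y. le_tol C x y \<longrightarrow>
        fil C' (\<chi>S x) (\<chi>S y) = \<chi> x ` fil C x y \<and>
        idl C' (\<chi>S x) (\<chi>S y) = \<chi> y ` idl C x y \<and>
        (\<forall>a\<in>fil C x y. \<chi> y (conn C x y a) = conn C' (\<chi>S x) (\<chi>S y) (\<chi> x a)))"

definition mc_isomorphic :: "('s, 'b) mc_data \<Rightarrow> ('t, 'c) mc_data \<Rightarrow> bool"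
    (infix \<open>\<cong>\<^sub>M\<close> 50) where
  "C \<cong>\<^sub>M C' \<longleftrightarrow> (\<exists>\<chi>S \<chi>. mc_iso C C' \<chi>S \<chi>)"

section \<open>Gluing\<close>

definition mc_points :: "('s, 'b) mc_data \<Rightarrow> ('s \<times> 'b) set" where
  "mc_points C = (SIGMA x : carrier (skel C). carrier (block C x))"

definition glue_rel :: "('s, 'b) mc_data \<Rightarrow> (('s \<times> 'b) \<times> ('s \<times> 'b)) set" where
  "glue_rel C = {((x, a), (y, b)). (x, a) \<in> mc_points C \<and> (y, b) \<in> mc_points C \<and>
     tol C x y \<and>
     a \<in> fil C x (x \<squnion>\<^bsub>skel C\<^esub> y) \<and> b \<in> fil C y (x \<squnion>\<^bsub>skel C\<^esub> y) \<and>
     conn C x (x \<squnion>\<^bsub>skel C\<^esub> y) a = conn C y (x \<squnion>\<^bsub>skel C\<^esub> y) b}"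

definition proj :: "('s, 'b) mc_data \<Rightarrow> 's \<Rightarrow> 'b \<Rightarrow> ('s \<times> 'b) set" where
  "proj C x a = glue_rel C `` {(x, a)}"

definition sum_block :: "('s, 'b) mc_data \<Rightarrow> 's \<Rightarrow> ('s \<times> 'b) set set" where
  "sum_block C x = proj C x ` carrier (block C x)"

definition sum_le_at ::
  "('s, 'b) mc_data \<Rightarrow> 's \<Rightarrow> ('s \<times> 'b) set \<Rightarrow> ('s \<times> 'b) set \<Rightarrow> bool" where
  "sum_le_at C v a b \<longleftrightarrow> a \<in> sum_block C v \<and> b \<in> sum_block C v \<and>
     inv_into (carrier (block C v)) (proj C v) a
       \<sqsubseteq>\<^bsub>block C v\<^esub> inv_into (carrier (block C v)) (proj C v) b"

definition sum_le ::
  "('s, 'b) mc_data \<Rightarrow> ('s \<times> 'b) set \<Rightarrow> ('s \<times> 'b) set \<Rightarrow> bool" where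
  "sum_le C a b \<longleftrightarrow>
     (\<exists>(n :: nat) (p :: nat \<Rightarrow> ('s \<times> 'b) set) (x :: nat \<Rightarrow> 's).
        p 0 = a \<and> p n = b \<and>
        (\<forall>i\<in>{0..n}. p i \<in> mc_points C // glue_rel C) \<and>
        (\<forall>i\<in>{1..n}. x i \<in> carrier (skel C) \<and> sum_le_at C (x i) (p (i - 1)) (p i)) \<and>
        (\<forall>i\<in>{1..<n}. x i \<sqsubseteq>\<^bsub>skel C\<^esub> x (i + 1)))"

definition mc_sum :: "('s, 'b) mc_data \<Rightarrow> ('s \<times> 'b) set gorder" where
  "mc_sum C = \<lparr>carrier = mc_points C // glue_rel C, eq = (=), le = sum_le C\<rparr>"

section \<open>Dissection\<close>

definition complemented_interval :: "'a gorder \<Rightarrow> 'a set \<Rightarrow> bool" where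
  "complemented_interval L B \<longleftrightarrow>
     (\<exists>x\<in>carrier L. \<exists>y\<in>carrier L. x \<sqsubseteq>\<^bsub>L\<^esub> y \<and> B = \<lbrace>x..y\<rbrace>\<^bsub>L\<^esub>) \<and>
     complemented_lattice (L\<lparr>carrier := B\<rparr>)"

definition lattice_blocks :: "'a gorder \<Rightarrow> 'a set set" where
  "lattice_blocks L = {B. complemented_interval L B \<and>
     (\<forall>B'. complemented_interval L B' \<and> B \<subseteq> B' \<longrightarrow> B' = B)}"

definition dissection :: "'a gorder \<Rightarrow> ('a set, 'a) mc_data" where
  "dissection L =
     \<lparr>skel = \<lparr>carrier = lattice_blocks L, eq = (=),
              le = (\<lambda>B B'. \<bottom>\<^bsub>L\<lparr>carrier := B\<rparr>\<^esub> \<sqsubseteq>\<^bsub>L\<^esub> \<bottom>\<^bsub>L\<lparr>carrier := B'\<rparr>\<^esub>)\<rparr>,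
      tol = (\<lambda>B B'. B \<inter> B' \<noteq> {}),
      block = (\<lambda>B. L\<lparr>carrier := B\<rparr>),
      fil = (\<lambda>B B'. B \<inter> B'),
      conn = (\<lambda>B B' a. a)\<rparr>"

end

theory Submission
  imports Defs
begin

text \<open>
  Inside the sum, the blocks are subsets \<open>\<Lambda> x\<close> of one set, and what is needed of the
  connections becomes a self-dual list of properties of this family: \<open>{x. p \<in> \<Lambda> x}\<close> is a convex
  sublattice of the skeleton, and for \<open>x \<le> y\<close> the set \<open>\<Lambda> x \<inter> \<Lambda> y\<close> is an up-set of \<open>\<Lambda> x\<close> and
  a down-set of \<open>\<Lambda> y\<close>, proper on both sides for a cover.  If \<open>p \<le> q\<close> holds in \<open>\<Lambda> x\<close> and
  \<open>p \<in> \<Lambda> v\<close>, then \<open>p \<le> q\<close> holds in \<open>\<Lambda> (v \<squnion> x)\<close>; hence every chain of steps can be sorted and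
  the glued relation is a partial order in which blocks are convex.  Moving elements up along
  covers of the skeleton gives joins, duality gives meets.  All upper covers of an element lie in a
  common block, so both covering conditions hold and the sum is modular.  The greatest element of
  \<open>{x. u \<in> \<Lambda> x}\<close> names the block above \<open>u\<close>, which identifies the maximal complemented intervals
  with the \<open>\<Lambda> x\<close>.  Conversely, in a modular l.f.f.c. lattice the maps \<open>x \<mapsto> x\<^sup>*\<close> and
  \<open>y \<mapsto> y\<^sub>*\<close> form a Galois connection whose closed pairs are the blocks.
\<close>

section \<open>Lattices given by a carrier\<close>

text \<open>The hard point is the join. A join formed inside one block has to be compared with upper
  bounds lying in blocks far above it, and the skeleton may be infinite in both directions. The
  arguments therefore run by induction over the finite interval between two indices, and an element
  is raised along a cover by joining it with the bottom of the upper block. Modularity can be read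
  off from covers because the lattice is locally finite: a non-modular lattice contains a pentagon,
  one with the smallest surrounding interval exists, and an atom under its longer side would cut it
  into two smaller ones. Transitivity of the gluing relation is not formal, since a tolerance need
  not be transitive. MC5 supplies the instance that is missing, and MC7 produces the common points
  above and below. The isomorphisms connect structures over different types, so the bijection of
  isomorphism classes is expressed by two equivalences together with the two round trips.\<close>

locale gorder_lattice = lattice L for L :: "'a gorder" (structure)
begin

lemma join_eqI:
  assumes "x \<in> carrier L" "y \<in> carrier L" "z \<in> carrier L" "x \<sqsubseteq> z" "y \<sqsubseteq> z"
    and "\<And>u. u \<in> carrier L \<Longrightarrow> x \<sqsubseteq> u \<Longrightarrow> y \<sqsubseteq> u \<Longrightarrow> z \<sqsubseteq> u"
  shows "x \<squnion> y = z"
  by (meson assms join_closed join_le join_left join_right le_antisym)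

lemma meet_eqI:
  assumes "x \<in> carrier L" "y \<in> carrier L" "z \<in> carrier L" "z \<sqsubseteq> x" "z \<sqsubseteq> y"
    and "\<And>u. u \<in> carrier L \<Longrightarrow> u \<sqsubseteq> x \<Longrightarrow> u \<sqsubseteq> y \<Longrightarrow> u \<sqsubseteq> z"
  shows "x \<sqinter> y = z"
  by (meson assms meet_closed meet_le meet_left meet_right le_antisym)

lemma join_absorb1: "x \<sqsubseteq> y \<Longrightarrow> x \<in> carrier L \<Longrightarrow> y \<in> carrier L \<Longrightarrow> x \<squnion> y = y"
  \<comment> \<open>Despite its name, \<open>le_iff_meet\<close> characterises the order by joins,
    and \<open>le_iff_join\<close> by meets.\<close>
  by (simp add: le_iff_meet)

lemma join_absorb2: "y \<sqsubseteq> x \<Longrightarrow> x \<in> carrier L \<Longrightarrow> y \<in> carrier L \<Longrightarrow> x \<squnion> y = x"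
  using join_absorb1[of y x] join_comm[of L x y] by simp

lemma meet_absorb1: "x \<sqsubseteq> y \<Longrightarrow> x \<in> carrier L \<Longrightarrow> y \<in> carrier L \<Longrightarrow> x \<sqinter> y = x"
  using le_iff_join by metis

lemma meet_absorb2: "y \<sqsubseteq> x \<Longrightarrow> x \<in> carrier L \<Longrightarrow> y \<in> carrier L \<Longrightarrow> x \<sqinter> y = y"
  using meet_absorb1[of y x] meet_comm[of L x y] by simp

lemma covers_iff:
  "covers L x y \<longleftrightarrow> x \<in> carrier L \<and> y \<in> carrier L \<and> x \<sqsubseteq> y \<and> x \<noteq> y \<and>
     (\<forall>z\<in>carrier L. x \<sqsubseteq> z \<longrightarrow> z \<sqsubseteq> y \<longrightarrow> z = x \<or> z = y)"
  unfolding covers_def lless_eq by auto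

text \<open>Restricting the carrier recomputes joins, meets and bounds. On an interval nothing
  changes, because the operations of \<open>L\<close> do not lead out of it; this frees all later
  arguments from relative operations.\<close>

lemma interval_lattice:
  assumes xy: "x \<in> carrier L" "y \<in> carrier L" "x \<sqsubseteq> y"
  defines "I \<equiv> L\<lparr>carrier := \<lbrace>x..y\<rbrace>\<rparr>"
  shows "bounded_lattice I"
    and "a \<in> \<lbrace>x..y\<rbrace> \<Longrightarrow> b \<in> \<lbrace>x..y\<rbrace> \<Longrightarrow> a \<squnion>\<^bsub>I\<^esub> b = a \<squnion> b"
    and "a \<in> \<lbrace>x..y\<rbrace> \<Longrightarrow> b \<in> \<lbrace>x..y\<rbrace> \<Longrightarrow> a \<sqinter>\<^bsub>I\<^esub> b = a \<sqinter> b"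
    and "\<bottom>\<^bsub>I\<^esub> = x" and "\<top>\<^bsub>I\<^esub> = y"
proof -
  have sub: "\<lbrace>x..y\<rbrace> \<subseteq> carrier L" by (rule at_least_at_most_closed)
  have I_simps: "carrier I = \<lbrace>x..y\<rbrace>" "le I = le L" "eq I = eq L"
    by (simp_all add: I_def)
  interpret I: weak_partial_order I
    unfolding I_def using weak_partial_order_subset[OF weak_partial_order_axioms sub] .
  interpret I: partial_order I
    by standard (simp add: I_simps eq_is_equal)
  have mem: "a \<squnion> b \<in> \<lbrace>x..y\<rbrace> \<and> a \<sqinter> b \<in> \<lbrace>x..y\<rbrace>" if "a \<in> \<lbrace>x..y\<rbrace>" "b \<in> \<lbrace>x..y\<rbrace>" for a b
    using that xy unfolding at_least_at_most_def
    by (auto intro: join_le meet_le)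
      (meson join_closed join_left le_trans meet_closed meet_left)+
  have lub: "least I (a \<squnion> b) (Upper I {a, b})" if "a \<in> \<lbrace>x..y\<rbrace>" "b \<in> \<lbrace>x..y\<rbrace>" for a b
    using that mem[OF that] sub
    unfolding least_def Upper_def
    by (auto simp: I_simps subset_iff intro: join_left join_right join_le)
  have glb: "greatest I (a \<sqinter> b) (Lower I {a, b})" if "a \<in> \<lbrace>x..y\<rbrace>" "b \<in> \<lbrace>x..y\<rbrace>" for a b
    using that mem[OF that] sub
    unfolding greatest_def Lower_def
    by (auto simp: I_simps subset_iff intro: meet_left meet_right meet_le)
  interpret I: lattice I
    by standard (use lub glb in \<open>unfold I_simps, blast+\<close>)
  have bot: "least I x (carrier I)" and top: "greatest I y (carrier I)"
    using xy by (auto simp: I_simps least_def greatest_def at_least_at_most_def)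
  interpret I: bounded_lattice I
    by standard (use bot top in auto)
  show "bounded_lattice I" by unfold_locales
  show "\<bottom>\<^bsub>I\<^esub> = x" "\<top>\<^bsub>I\<^esub> = y"
    using bot top I.bottom_least I.top_greatest I.least_unique I.greatest_unique by blast+
  show "a \<squnion>\<^bsub>I\<^esub> b = a \<squnion> b" if "a \<in> \<lbrace>x..y\<rbrace>" "b \<in> \<lbrace>x..y\<rbrace>"
    using lub[OF that] I.sup_of_two_least[of a b] I.least_unique that I_simps
    unfolding join_def by blast
  show "a \<sqinter>\<^bsub>I\<^esub> b = a \<sqinter> b" if "a \<in> \<lbrace>x..y\<rbrace>" "b \<in> \<lbrace>x..y\<rbrace>"
    using glb[OF that] I.inf_of_two_greatest[of a b] I.greatest_unique that I_simps
    unfolding meet_def by blast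
qed

lemma interval_complemented_iff:
  assumes "x \<in> carrier L" "y \<in> carrier L" "x \<sqsubseteq> y"
  shows "complemented_lattice (L\<lparr>carrier := \<lbrace>x..y\<rbrace>\<rparr>) \<longleftrightarrow>
    (\<forall>a\<in>\<lbrace>x..y\<rbrace>. \<exists>b\<in>\<lbrace>x..y\<rbrace>. a \<squnion> b = y \<and> a \<sqinter> b = x)"
  unfolding complemented_lattice_def
  using interval_lattice[OF assms] by auto

lemma complemented_interval_iff:
  "complemented_interval L B \<longleftrightarrow> (\<exists>x\<in>carrier L. \<exists>y\<in>carrier L. x \<sqsubseteq> y \<and> B = \<lbrace>x..y\<rbrace> \<and>
     (\<forall>a\<in>\<lbrace>x..y\<rbrace>. \<exists>b\<in>\<lbrace>x..y\<rbrace>. a \<squnion> b = y \<and> a \<sqinter> b = x))"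
  unfolding complemented_interval_def using interval_complemented_iff by blast

lemma interval_subset_iff:
  assumes "x \<in> carrier L" "y \<in> carrier L" "x' \<in> carrier L" "y' \<in> carrier L" "x \<sqsubseteq> y"
  shows "\<lbrace>x..y\<rbrace> \<subseteq> \<lbrace>x'..y'\<rbrace> \<longleftrightarrow> x' \<sqsubseteq> x \<and> y \<sqsubseteq> y'"
  using assms by (auto simp: at_least_at_most_def intro: le_trans)

lemma interval_eq_iff:
  assumes "x \<in> carrier L" "y \<in> carrier L" "x' \<in> carrier L" "y' \<in> carrier L" "x \<sqsubseteq> y" "x' \<sqsubseteq> y'"
  shows "\<lbrace>x..y\<rbrace> = \<lbrace>x'..y'\<rbrace> \<longleftrightarrow> x = x' \<and> y = y'"
  using interval_subset_iff[of x y x' y'] interval_subset_iff[of x' y' x y] assms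
  by (auto intro: le_antisym)

end

lemma gorder_lattice_iff: "gorder_lattice L \<longleftrightarrow> lattice L"
  by (simp add: gorder_lattice_def)

subsection \<open>Duality\<close>

lemma interval_dual [simp]: "\<lbrace>x..y\<rbrace>\<^bsub>inv_gorder L\<^esub> = \<lbrace>y..x\<rbrace>\<^bsub>L\<^esub>"
  by (auto simp: at_least_at_most_def)

lemma lattice_dual: "lattice L \<Longrightarrow> lattice (inv_gorder L)"
  by (rule lattice.dual_lattice)

lemma covers_dual: "lattice L \<Longrightarrow> covers (inv_gorder L) x y \<longleftrightarrow> covers L y x"
  using gorder_lattice.covers_iff[of L] gorder_lattice.covers_iff[of "inv_gorder L"] lattice_dual[of L]
  by (auto simp: gorder_lattice_iff)

lemma lffc_lattice_dual:
  assumes "lffc_lattice L" shows "lffc_lattice (inv_gorder L)"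
proof -
  have L: "lattice L" using assms by (simp add: lffc_lattice_def)
  have "covers (inv_gorder L) = (\<lambda>x y. covers L y x)"
    using covers_dual[OF L] by blast
  then show ?thesis
    using assms lattice_dual[OF L]
    by (auto simp: lffc_lattice_def locally_finite_def finite_covers_def)
qed

lemma modular_lattice_dual: "modular_lattice L \<Longrightarrow> modular_lattice (inv_gorder L)"
  unfolding modular_lattice_def
  using lattice_dual[of L] join_comm[of L] meet_comm[of L] by simp metis

lemma bounded_lattice_dual:
  assumes "bounded_lattice L" shows "bounded_lattice (inv_gorder L)"
proof -
  interpret bounded_lattice L by fact
  interpret d: lattice "inv_gorder L" by (rule dual_lattice)
  show ?thesis
    by unfold_locales (use bottom_exists top_exists in auto)
qed

lemma complemented_lattice_dual: "complemented_lattice L \<Longrightarrow> complemented_lattice (inv_gorder L)"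
  unfolding complemented_lattice_def using bounded_lattice_dual by auto

subsection \<open>Isomorphisms\<close>

lemma lattice_iso_orderD:
  assumes "lattice_iso L M f"
  shows "lattice L" "lattice M" "bij_betw f (carrier L) (carrier M)"
    "x \<in> carrier L \<Longrightarrow> y \<in> carrier L \<Longrightarrow> f x \<sqsubseteq>\<^bsub>M\<^esub> f y \<longleftrightarrow> x \<sqsubseteq>\<^bsub>L\<^esub> y"
proof -
  show L: "lattice L" and M: "lattice M" and b: "bij_betw f (carrier L) (carrier M)"
    using assms by (auto simp: lattice_iso_def join_pres_def)
  have j: "f (x \<squnion>\<^bsub>L\<^esub> y) = f x \<squnion>\<^bsub>M\<^esub> f y" if "x \<in> carrier L" "y \<in> carrier L"
    using assms that by (auto simp: lattice_iso_def join_pres_def)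
  show "f x \<sqsubseteq>\<^bsub>M\<^esub> f y \<longleftrightarrow> x \<sqsubseteq>\<^bsub>L\<^esub> y" if "x \<in> carrier L" "y \<in> carrier L"
  proof -
    interpret L: lattice L by fact
    interpret M: lattice M by fact
    have "f x \<sqsubseteq>\<^bsub>M\<^esub> f y \<longleftrightarrow> f (x \<squnion>\<^bsub>L\<^esub> y) = f y"
      using j that b by (simp add: M.le_iff_meet bij_betw_apply)
    also have "\<dots> \<longleftrightarrow> x \<squnion>\<^bsub>L\<^esub> y = y"
      using b that by (auto simp: bij_betw_def inj_on_eq_iff)
    also have "\<dots> \<longleftrightarrow> x \<sqsubseteq>\<^bsub>L\<^esub> y" using that by (simp add: L.le_iff_meet)
    finally show ?thesis .
  qed
qed

text \<open>Least upper bounds depend on the order alone, so images of joins and meets are joins and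
  meets again, and \<open>M\<close> turns out to be a lattice on the way. All isomorphisms below are
  obtained from this criterion.\<close>

lemma lattice_iso_orderI:
  assumes L: "lattice L" and b: "bij_betw f (carrier L) (carrier M)" and eq: "eq M = (=)"
    and le: "\<And>x y. x \<in> carrier L \<Longrightarrow> y \<in> carrier L \<Longrightarrow> f x \<sqsubseteq>\<^bsub>M\<^esub> f y \<longleftrightarrow> x \<sqsubseteq>\<^bsub>L\<^esub> y"
  shows "lattice_iso L M f"
proof -
  interpret L: lattice L by fact
  have sur: "\<exists>a\<in>carrier L. z = f a" if "z \<in> carrier M" for z
    using b that by (auto simp: bij_betw_def)
  have im: "f a \<in> carrier M" if "a \<in> carrier L" for a
    using b that by (rule bij_betw_apply)
  interpret M: partial_order M
  proof
    fix x y assume "x \<sqsubseteq>\<^bsub>M\<^esub> y" "y \<sqsubseteq>\<^bsub>M\<^esub> x" "x \<in> carrier M" "y \<in> carrier M"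
    then show "x .=\<^bsub>M\<^esub> y" using sur eq le L.le_antisym by metis
  next
    fix x y z assume "x \<sqsubseteq>\<^bsub>M\<^esub> y" "y \<sqsubseteq>\<^bsub>M\<^esub> z" "x \<in> carrier M" "y \<in> carrier M" "z \<in> carrier M"
    then show "x \<sqsubseteq>\<^bsub>M\<^esub> z" using sur le L.le_trans by metis
  next
    fix x assume "x \<in> carrier M"
    then show "x \<sqsubseteq>\<^bsub>M\<^esub> x" using sur le L.le_refl by metis
  qed (simp_all add: eq)
  have lub: "least M (f (a \<squnion>\<^bsub>L\<^esub> b)) (Upper M {f a, f b})" if "a \<in> carrier L" "b \<in> carrier L" for a b
  proof (rule least_UpperI)
    show "f (a \<squnion>\<^bsub>L\<^esub> b) \<sqsubseteq>\<^bsub>M\<^esub> y" if "y \<in> Upper M {f a, f b}" for y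
    proof -
      have "y \<in> carrier M" using \<open>y \<in> Upper _ _\<close> by (simp add: Upper_def)
      then obtain c where "c \<in> carrier L" "y = f c" using sur by metis
      then show ?thesis using \<open>y \<in> Upper _ _\<close> \<open>a \<in> _\<close> \<open>b \<in> _\<close> im by (auto simp: Upper_def le L.join_le)
    qed
  qed (use that im in \<open>auto simp: le L.join_left L.join_right\<close>)
  have glb: "greatest M (f (a \<sqinter>\<^bsub>L\<^esub> b)) (Lower M {f a, f b})" if "a \<in> carrier L" "b \<in> carrier L" for a b
  proof (rule greatest_LowerI)
    show "y \<sqsubseteq>\<^bsub>M\<^esub> f (a \<sqinter>\<^bsub>L\<^esub> b)" if "y \<in> Lower M {f a, f b}" for y
    proof -
      have "y \<in> carrier M" using \<open>y \<in> Lower _ _\<close> by (simp add: Lower_def)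
      then obtain c where "c \<in> carrier L" "y = f c" using sur by metis
      then show ?thesis using \<open>y \<in> Lower _ _\<close> \<open>a \<in> _\<close> \<open>b \<in> _\<close> im by (auto simp: Lower_def le L.meet_le)
    qed
  qed (use that im in \<open>auto simp: le L.meet_left L.meet_right\<close>)
  interpret M: lattice M
  proof
    fix x y assume "x \<in> carrier M" "y \<in> carrier M"
    then obtain a b where "a \<in> carrier L" "b \<in> carrier L" "x = f a" "y = f b" using sur by metis
    then show "\<exists>s. least M s (Upper M {x, y})" "\<exists>s. greatest M s (Lower M {x, y})"
      using lub glb by blast+
  qed
  have "f (x \<squnion>\<^bsub>L\<^esub> y) = f x \<squnion>\<^bsub>M\<^esub> f y" if "x \<in> carrier L" "y \<in> carrier L" for x y
    using lub[OF that] M.sup_of_two_least[OF im im] that M.least_unique unfolding join_def by metis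
  moreover have "f (x \<sqinter>\<^bsub>L\<^esub> y) = f x \<sqinter>\<^bsub>M\<^esub> f y" if "x \<in> carrier L" "y \<in> carrier L" for x y
    using glb[OF that] M.inf_of_two_greatest[OF im im] that M.greatest_unique
    unfolding meet_def by metis
  ultimately show ?thesis
    unfolding lattice_iso_def join_pres_def meet_pres_def
    using b L M.lattice_axioms by blast
qed

lemma lattice_iso_inv_into:
  assumes "lattice_iso L M f"
  shows "lattice_iso M L (inv_into (carrier L) f)"
proof (rule lattice_iso_orderI)
  note f = lattice_iso_orderD[OF assms]
  show "lattice M" by (fact f)
  show "bij_betw (inv_into (carrier L) f) (carrier M) (carrier L)"
    using f(3) by (rule bij_betw_inv_into)
  interpret L: lattice L by (fact f)
  show "eq L = (=)" by (rule L.eq_is_equal)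
  show "inv_into (carrier L) f x \<sqsubseteq>\<^bsub>L\<^esub> inv_into (carrier L) f y \<longleftrightarrow> x \<sqsubseteq>\<^bsub>M\<^esub> y"
    if "x \<in> carrier M" "y \<in> carrier M" for x y
    using f(4)[of "inv_into (carrier L) f x" "inv_into (carrier L) f y"] f(3) that
    by (simp add: bij_betw_def f_inv_into_f inv_into_into)
qed

lemma lattice_iso_comp:
  assumes "lattice_iso L M f" "lattice_iso M N g"
  shows "lattice_iso L N (g \<circ> f)"
proof (rule lattice_iso_orderI)
  note f = lattice_iso_orderD[OF assms(1)] and g = lattice_iso_orderD[OF assms(2)]
  show "lattice L" by (fact f)
  show "bij_betw (g \<circ> f) (carrier L) (carrier N)" using f(3) g(3) by (rule bij_betw_trans)
  interpret N: lattice N by (fact g)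
  show "eq N = (=)" by (rule N.eq_is_equal)
  show "(g \<circ> f) x \<sqsubseteq>\<^bsub>N\<^esub> (g \<circ> f) y \<longleftrightarrow> x \<sqsubseteq>\<^bsub>L\<^esub> y" if "x \<in> carrier L" "y \<in> carrier L" for x y
    using f(4) g(4) bij_betw_apply[OF f(3)] that by simp
qed

lemma lattice_isomorphic_sym: "L \<cong>\<^sub>L M \<Longrightarrow> M \<cong>\<^sub>L L"
  unfolding lattice_isomorphic_def using lattice_iso_inv_into by blast

lemma lattice_isomorphic_trans: "L \<cong>\<^sub>L M \<Longrightarrow> M \<cong>\<^sub>L N \<Longrightarrow> L \<cong>\<^sub>L N"
  unfolding lattice_isomorphic_def using lattice_iso_comp by blast

lemma has_minimum_iso:
  assumes "lattice_iso L M f" "has_minimum L"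
  shows "has_minimum M"
proof -
  note f = lattice_iso_orderD[OF assms(1)]
  obtain m where m: "m \<in> carrier L" "\<And>x. x \<in> carrier L \<Longrightarrow> m \<sqsubseteq>\<^bsub>L\<^esub> x"
    using assms(2) by (auto simp: has_minimum_def least_def)
  have "least M (f m) (carrier M)"
    unfolding least_def using m f(4) bij_betw_imp_surj_on[OF f(3), symmetric] by auto
  then show ?thesis by (auto simp: has_minimum_def)
qed

lemma has_minimum_isomorphic: "L \<cong>\<^sub>L M \<Longrightarrow> has_minimum L \<longleftrightarrow> has_minimum M"
  using has_minimum_iso lattice_isomorphic_sym unfolding lattice_isomorphic_def by metis

lemma modular_lattice_iso:
  assumes "lattice_iso L M f" "modular_lattice L"
  shows "modular_lattice M"
  unfolding modular_lattice_def
proof (intro conjI ballI impI)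
  note f = lattice_iso_orderD[OF assms(1)]
  show "lattice M" by (fact f)
  interpret L: lattice L by (fact f)
  have hom: "f (x \<squnion>\<^bsub>L\<^esub> y) = f x \<squnion>\<^bsub>M\<^esub> f y" "f (x \<sqinter>\<^bsub>L\<^esub> y) = f x \<sqinter>\<^bsub>M\<^esub> f y"
    if "x \<in> carrier L" "y \<in> carrier L" for x y
    using assms(1) that by (auto simp: lattice_iso_def join_pres_def meet_pres_def)
  fix a b c assume abc: "a \<in> carrier M" "b \<in> carrier M" "c \<in> carrier M" "a \<sqsubseteq>\<^bsub>M\<^esub> c"
  then obtain a' b' c' where abc': "a' \<in> carrier L" "b' \<in> carrier L" "c' \<in> carrier L"
    "a = f a'" "b = f b'" "c = f c'"
    using bij_betw_imp_surj_on[OF f(3), symmetric] by blast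
  then have "a' \<squnion>\<^bsub>L\<^esub> (b' \<sqinter>\<^bsub>L\<^esub> c') = (a' \<squnion>\<^bsub>L\<^esub> b') \<sqinter>\<^bsub>L\<^esub> c'"
    using assms(2) abc f(4) by (simp add: modular_lattice_def)
  then show "a \<squnion>\<^bsub>M\<^esub> (b \<sqinter>\<^bsub>M\<^esub> c) = (a \<squnion>\<^bsub>M\<^esub> b) \<sqinter>\<^bsub>M\<^esub> c"
    using abc' hom by (metis L.join_closed L.meet_closed)
qed

lemma complemented_lattice_iso:
  assumes "lattice_iso L M f" "complemented_lattice L"
  shows "complemented_lattice M"
proof -
  note f = lattice_iso_orderD[OF assms(1)]
  have sur: "\<exists>a\<in>carrier L. y = f a" if "y \<in> carrier M" for y
    using bij_betw_imp_surj_on[OF f(3)] that by blast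
  have im: "f a \<in> carrier M" if "a \<in> carrier L" for a using f(3) that by (rule bij_betw_apply)
  interpret L: bounded_lattice L using assms(2) by (simp add: complemented_lattice_def)
  interpret M: lattice M by (fact f)
  have bot: "least M (f \<bottom>\<^bsub>L\<^esub>) (carrier M)"
    unfolding least_def using im sur f(4) L.bottom_lower L.bottom_closed by blast
  have top: "greatest M (f \<top>\<^bsub>L\<^esub>) (carrier M)"
    unfolding greatest_def using im sur f(4) L.top_higher L.top_closed by blast
  interpret M: bounded_lattice M
    by unfold_locales (use bot top in blast)+
  have eqs: "f \<bottom>\<^bsub>L\<^esub> = \<bottom>\<^bsub>M\<^esub>" "f \<top>\<^bsub>L\<^esub> = \<top>\<^bsub>M\<^esub>"
    using bot top M.bottom_least M.top_greatest M.least_unique M.greatest_unique by blast+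
  have hom: "f (x \<squnion>\<^bsub>L\<^esub> y) = f x \<squnion>\<^bsub>M\<^esub> f y" "f (x \<sqinter>\<^bsub>L\<^esub> y) = f x \<sqinter>\<^bsub>M\<^esub> f y"
    if "x \<in> carrier L" "y \<in> carrier L" for x y
    using assms(1) that by (auto simp: lattice_iso_def join_pres_def meet_pres_def)
  have "\<exists>b\<in>carrier M. a \<squnion>\<^bsub>M\<^esub> b = \<top>\<^bsub>M\<^esub> \<and> a \<sqinter>\<^bsub>M\<^esub> b = \<bottom>\<^bsub>M\<^esub>" if a: "a \<in> carrier M" for a
  proof -
    obtain a' where a': "a' \<in> carrier L" "a = f a'" using sur[OF a] by blast
    then obtain b' where b': "b' \<in> carrier L" "a' \<squnion>\<^bsub>L\<^esub> b' = \<top>\<^bsub>L\<^esub>" "a' \<sqinter>\<^bsub>L\<^esub> b' = \<bottom>\<^bsub>L\<^esub>"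
      using assms(2) unfolding complemented_lattice_def by blast
    then show ?thesis using hom[OF a'(1) b'(1)] eqs a' im by (intro bexI[of _ "f b'"]) auto
  qed
  then show ?thesis unfolding complemented_lattice_def using M.bounded_lattice_axioms by blast
qed

subsection \<open>Local finiteness\<close>

text \<open>Moving \<open>x\<close> up strictly shrinks the finite interval up to \<open>w\<close>.
  With \<open>w\<close> fixed, this gives an induction in lattices that are themselves infinite in
  both directions.\<close>

lemma interval_induct [consumes 5, case_names step]:
  fixes L :: "'a gorder" (structure)
  assumes L: "lattice L" and fin: "locally_finite L"
    and x: "x \<in> carrier L" and w: "w \<in> carrier L" and xw: "x \<sqsubseteq> w"
    and step: "\<And>x. x \<in> carrier L \<Longrightarrow> x \<sqsubseteq> w \<Longrightarrow>
      (\<And>y. y \<in> carrier L \<Longrightarrow> x \<sqsubseteq> y \<Longrightarrow> x \<noteq> y \<Longrightarrow> y \<sqsubseteq> w \<Longrightarrow> P y) \<Longrightarrow> P x"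
  shows "P x"
  using x xw
proof (induction "card \<lbrace>x..w\<rbrace>" arbitrary: x rule: less_induct)
  case less
  interpret gorder_lattice L using L by (rule gorder_lattice.intro)
  show ?case
  proof (rule step[OF less.prems])
    fix y assume y: "y \<in> carrier L" "x \<sqsubseteq> y" "x \<noteq> y" "y \<sqsubseteq> w"
    have "\<lbrace>y..w\<rbrace> \<subset> \<lbrace>x..w\<rbrace>"
      using y less.prems w unfolding at_least_at_most_def
      by (auto intro: le_trans le_antisym)
    moreover have "finite \<lbrace>x..w\<rbrace>" using fin less.prems w by (simp add: locally_finite_def)
    ultimately show "P y" using less.hyps[of y] y psubset_card_mono by blast
  qed
qed

text \<open>An element strictly between \<open>x\<close> and \<open>w\<close> shortens the interval,
  so the search for a cover ends.\<close>

lemma exists_upper_cover: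
  fixes L :: "'a gorder" (structure)
  assumes L: "lattice L" and fin: "locally_finite L"
    and x: "x \<in> carrier L" and w: "w \<in> carrier L" and xw: "x \<sqsubseteq> w" "x \<noteq> w"
  shows "\<exists>y\<in>carrier L. covers L x y \<and> y \<sqsubseteq> w"
  using w xw
proof (induction "card \<lbrace>x..w\<rbrace>" arbitrary: w rule: less_induct)
  case less
  interpret gorder_lattice L using L by (rule gorder_lattice.intro)
  show ?case
  proof (cases "covers L x w")
    case True
    then show ?thesis using less.prems by blast
  next
    case False
    then obtain z where z: "z \<in> carrier L" "x \<sqsubseteq> z" "z \<sqsubseteq> w" "z \<noteq> x" "z \<noteq> w"
      using less.prems x covers_iff by blast
    have "\<lbrace>x..z\<rbrace> \<subset> \<lbrace>x..w\<rbrace>"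
      using z less.prems x unfolding at_least_at_most_def
      by (auto intro: le_trans le_antisym)
    moreover have "finite \<lbrace>x..w\<rbrace>" using fin less.prems x by (simp add: locally_finite_def)
    ultimately obtain y where "y \<in> carrier L" "covers L x y" "y \<sqsubseteq> z"
      using less.hyps[of z] z psubset_card_mono by blast
    then show ?thesis using z less.prems by (meson le_trans)
  qed
qed

lemma locally_finite_dual: "locally_finite L \<Longrightarrow> locally_finite (inv_gorder L)"
  by (auto simp: locally_finite_def)

lemma exists_lower_cover:
  assumes "lattice L" "locally_finite L" "x \<in> carrier L" "w \<in> carrier L" "w \<sqsubseteq>\<^bsub>L\<^esub> x" "x \<noteq> w"
  shows "\<exists>y\<in>carrier L. covers L y x \<and> w \<sqsubseteq>\<^bsub>L\<^esub> y"
  using exists_upper_cover[OF lattice_dual locally_finite_dual, of L x w] assms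
  by (simp add: covers_dual)

subsection \<open>Modularity and covers\<close>

text \<open>By modularity every \<open>c\<close> between \<open>a\<close> and
  \<open>a \<squnion> b\<close> equals \<open>a \<squnion> (b \<sqinter> c)\<close>, and
  \<open>b \<sqinter> c\<close> lies between \<open>r\<close> and \<open>b\<close>, hence is one of
  the two.\<close>

lemma modular_covers_join:
  fixes L :: "'a gorder" (structure)
  assumes M: "modular_lattice L" and rb: "covers L r b"
    and a: "a \<in> carrier L" "r \<sqsubseteq> a" "\<not> b \<sqsubseteq> a"
  shows "covers L a (a \<squnion> b)"
proof -
  interpret gorder_lattice L using M by (simp add: modular_lattice_def gorder_lattice.intro)
  have rb': "r \<in> carrier L" "b \<in> carrier L" "r \<sqsubseteq> b" using rb by (auto simp: covers_iff)
  have "c = a" if c: "c \<in> carrier L" "a \<sqsubseteq> c" "c \<sqsubseteq> a \<squnion> b" "c \<noteq> a \<squnion> b" for c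
  proof -
    have "b \<sqinter> c = r \<or> b \<sqinter> c = b"
      using rb c a rb' unfolding covers_iff
      by (meson le_trans meet_closed meet_le meet_left)
    moreover have "b \<sqinter> c \<noteq> b"
      using c a rb' by (metis join_closed join_le le_antisym meet_right)
    moreover have "a \<squnion> (b \<sqinter> c) = (a \<squnion> b) \<sqinter> c"
      using M a c rb' by (simp add: modular_lattice_def)
    ultimately show ?thesis using a c rb'
      by (metis join_absorb2 join_closed meet_absorb2)
  qed
  moreover have "a \<noteq> a \<squnion> b" using a rb' by (metis join_right)
  ultimately show ?thesis unfolding covers_iff using a rb' by (auto simp: join_left)
qed

text \<open>The local condition is propagated along covers from \<open>r\<close> to
  \<open>b\<close>: if \<open>t\<close> covers \<open>r\<close> below \<open>b\<close>, then
  \<open>t \<squnion> a\<close> covers \<open>t\<close>, and the argument continues with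
  \<open>t\<close> and \<open>t \<squnion> a\<close> in place of \<open>r\<close> and
  \<open>a\<close>.\<close>

lemma semimodular_covers_join:
  fixes L :: "'a gorder" (structure)
  assumes L: "lattice L" and fin: "locally_finite L"
    and loc: "\<And>r a b. covers L r a \<Longrightarrow> covers L r b \<Longrightarrow> a \<noteq> b \<Longrightarrow> covers L a (a \<squnion> b)"
    and cov: "covers L r a" and b: "b \<in> carrier L" "r \<sqsubseteq> b" "\<not> a \<sqsubseteq> b"
  shows "covers L b (b \<squnion> a)"
proof -
  interpret gorder_lattice L using L by (rule gorder_lattice.intro)
  have r: "r \<in> carrier L" using cov by (simp add: covers_iff)
  have "\<forall>a. covers L r a \<longrightarrow> \<not> a \<sqsubseteq> b \<longrightarrow> covers L b (b \<squnion> a)"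
    using L fin r b(1,2)
  proof (induction r rule: interval_induct)
    case (step r)
    show ?case
    proof (intro allI impI)
      fix a assume cov: "covers L r a" and nab: "\<not> a \<sqsubseteq> b"
      have a: "a \<in> carrier L" "r \<sqsubseteq> a" using cov by (auto simp: covers_iff)
      show "covers L b (b \<squnion> a)"
      proof (cases "r = b")
        case True
        then show ?thesis using cov a b by (simp add: join_absorb1)
      next
        case False
        then obtain t where t: "t \<in> carrier L" "covers L r t" "t \<sqsubseteq> b"
          using exists_upper_cover[OF L fin step.hyps(1) b(1)] step.hyps by blast
        then have rt: "r \<sqsubseteq> t" "r \<noteq> t" by (auto simp: covers_iff)
        have "t \<noteq> a" using t nab by blast
        then have "covers L t (t \<squnion> a)" using loc t cov by blast
        moreover have "\<not> t \<squnion> a \<sqsubseteq> b"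
          using nab a t b by (meson join_closed join_right le_trans)
        ultimately have "covers L b (b \<squnion> (t \<squnion> a))"
          using step.IH[of t] t rt by blast
        moreover have "b \<squnion> (t \<squnion> a) = b \<squnion> a"
        proof (rule join_eqI)
          show "t \<squnion> a \<sqsubseteq> b \<squnion> a"
            using a b t by (meson join_closed join_le join_left join_right le_trans)
          show "b \<squnion> a \<sqsubseteq> u"
            if "u \<in> carrier L" "b \<sqsubseteq> u" "t \<squnion> a \<sqsubseteq> u" for u
            using a b t that by (meson join_closed join_le join_right le_trans)
        qed (use a b t in \<open>simp_all add: join_left\<close>)
        ultimately show ?thesis by simp
      qed
    qed
  qed
  then show ?thesis using cov b by blast
qed

text \<open>Suppose \<open>t\<close> does not cover \<open>b\<close>. An atom \<open>d\<close> over
  \<open>z\<close> below \<open>a\<close> gives \<open>b' = b \<squnion> d\<close>, which covers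
  \<open>b\<close> and so differs from \<open>t\<close>. This element cuts the pentagon into two
  smaller ones, which collapse by minimality.\<close>

lemma minimal_pentagon_cover:
  fixes L :: "'a gorder" (structure)
  assumes L: "lattice L" and fin: "locally_finite L"
    and loc: "\<And>r a b. covers L r a \<Longrightarrow> covers L r b \<Longrightarrow> a \<noteq> b \<Longrightarrow> covers L a (a \<squnion> b)"
    and abc: "a \<in> carrier L" "b \<in> carrier L" "c \<in> carrier L" "a \<sqsubseteq> c" "a \<noteq> c"
      "a \<sqinter> b = z" "c \<sqinter> b = z" "a \<squnion> b = t" "c \<squnion> b = t"
    and minimal: "\<And>a b c. a \<in> carrier L \<Longrightarrow> b \<in> carrier L \<Longrightarrow> c \<in> carrier L \<Longrightarrow> a \<sqsubseteq> c \<Longrightarrow>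
      a \<sqinter> b = c \<sqinter> b \<Longrightarrow> a \<squnion> b = c \<squnion> b \<Longrightarrow> z \<sqsubseteq> c \<sqinter> b \<Longrightarrow> c \<squnion> b \<sqsubseteq> t \<Longrightarrow>
      c \<sqinter> b \<noteq> z \<or> c \<squnion> b \<noteq> t \<Longrightarrow> a = c"
  shows "covers L b t"
proof (rule ccontr)
  assume nt: "\<not> covers L b t"
  interpret gorder_lattice L using L by (rule gorder_lattice.intro)
  have z: "z \<in> carrier L" and t: "t \<in> carrier L" using abc by auto
  have le: "z \<sqsubseteq> a" "z \<sqsubseteq> b" "z \<sqsubseteq> c" "a \<sqsubseteq> t" "b \<sqsubseteq> t" "c \<sqsubseteq> t"
    using meet_left[OF abc(1,2)] meet_right[OF abc(1,2)] meet_left[OF abc(3,2)]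
      join_left[OF abc(1,2)] join_right[OF abc(1,2)] join_left[OF abc(3,2)] abc(6-9) by simp_all
  have "z \<noteq> a"
    using abc le by (metis join_absorb1 join_left meet_absorb1)
  then obtain d where d: "d \<in> carrier L" "covers L z d" "d \<sqsubseteq> a"
    using exists_upper_cover[OF L fin z] abc le by blast
  have zd: "z \<sqsubseteq> d" "z \<noteq> d" using d by (auto simp: covers_iff)
  have db: "\<not> d \<sqsubseteq> b" using d zd abc z by (metis le_antisym meet_le)
  define b' where "b' = b \<squnion> d"
  have b': "b' \<in> carrier L" "b \<sqsubseteq> b'" "d \<sqsubseteq> b'"
    using abc d by (auto simp: b'_def join_left join_right)
  have "covers L b b'"
    unfolding b'_def by (rule semimodular_covers_join[OF L fin loc d(2) abc(2) le(2) db])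
  then have b't: "b' \<noteq> t" using nt by blast
  have b'le: "b' \<sqsubseteq> t"
    unfolding b'_def using abc d le t by (meson join_le le_trans)
  \<comment> \<open>The lower part consists of \<open>a1\<close>, \<open>c1\<close> and
    \<open>b\<close>, with join \<open>b'\<close> instead of \<open>t\<close>; the upper part of
    \<open>a \<squnion> c1\<close>, \<open>c\<close> and \<open>b'\<close>, with meet
    \<open>c1\<close> instead of \<open>z\<close>. Their collapse gives \<open>a1 = c1\<close> and
    \<open>a \<squnion> c1 = c\<close>, so \<open>c1\<close> is below \<open>a\<close> and
    \<open>a = c\<close>.\<close>
  define a1 where "a1 = a \<sqinter> b'"
  define c1 where "c1 = c \<sqinter> b'"
  have a1: "a1 \<in> carrier L" "a1 \<sqsubseteq> a" "a1 \<sqsubseteq> b'" and c1: "c1 \<in> carrier L" "c1 \<sqsubseteq> c" "c1 \<sqsubseteq> b'"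
    using abc b' by (auto simp: a1_def c1_def meet_left meet_right)
  have da1: "d \<sqsubseteq> a1" unfolding a1_def using abc b' d by (simp add: meet_le)
  have a1c1: "a1 \<sqsubseteq> c1"
    unfolding c1_def using abc a1 b' c1 by (meson le_trans meet_le)
  then have dc1: "d \<sqsubseteq> c1" using da1 a1 c1 d le_trans by blast
  have "a1 = c1"
  proof (rule minimal[of a1 b c1])
    have "a1 \<sqinter> b = z"
    proof (rule meet_eqI)
      show "z \<sqsubseteq> a1" using zd da1 z d a1 le_trans by blast
      show "u \<sqsubseteq> z" if "u \<in> carrier L" "u \<sqsubseteq> a1" "u \<sqsubseteq> b" for u
        using that a1 abc le_trans meet_le by metis
    qed (use a1 abc le z in auto)
    moreover have c1b: "c1 \<sqinter> b = z"
    proof (rule meet_eqI)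
      show "z \<sqsubseteq> c1" using zd dc1 z d c1 le_trans by blast
      show "u \<sqsubseteq> z" if "u \<in> carrier L" "u \<sqsubseteq> c1" "u \<sqsubseteq> b" for u
        using that c1 abc le_trans meet_le by metis
    qed (use c1 abc le z in auto)
    ultimately show "a1 \<sqinter> b = c1 \<sqinter> b" by simp
    have j: "x \<squnion> b = b'" if "x \<in> carrier L" "d \<sqsubseteq> x" "x \<sqsubseteq> b'" for x
    proof (rule join_eqI)
      show "b' \<sqsubseteq> u" if u: "u \<in> carrier L" "x \<sqsubseteq> u" "b \<sqsubseteq> u" for u
      proof -
        have "d \<sqsubseteq> u" using u \<open>d \<sqsubseteq> x\<close> \<open>x \<in> carrier L\<close> d le_trans by blast
        then show ?thesis unfolding b'_def using u abc d by (simp add: join_le)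
      qed
    qed (use that abc b' in auto)
    show "a1 \<squnion> b = c1 \<squnion> b" "c1 \<squnion> b \<sqsubseteq> t" "c1 \<sqinter> b \<noteq> z \<or> c1 \<squnion> b \<noteq> t"
      using j[of a1] j[of c1] a1 c1 da1 dc1 b't b'le by auto
    show "z \<sqsubseteq> c1 \<sqinter> b" using c1b z by simp
  qed (use a1 c1 a1c1 abc in auto)
  moreover have "a \<squnion> c1 = c"
  proof (rule minimal[of "a \<squnion> c1" b' c])
    show ac1: "a \<squnion> c1 \<in> carrier L" using abc c1 by simp
    show lec: "a \<squnion> c1 \<sqsubseteq> c" using abc c1 by (simp add: join_le)
    have "(a \<squnion> c1) \<sqinter> b' = c1"
    proof (rule meet_eqI)
      show "u \<sqsubseteq> c1" if "u \<in> carrier L" "u \<sqsubseteq> a \<squnion> c1" "u \<sqsubseteq> b'" for u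
        using that lec ac1 abc b' le_trans meet_le unfolding c1_def by metis
    qed (use ac1 c1 abc b' in \<open>auto simp: join_right\<close>)
    then show "(a \<squnion> c1) \<sqinter> b' = c \<sqinter> b'" by (simp add: c1_def)
    have ge: "u = t" if "u \<in> carrier L" "a \<sqsubseteq> u" "b' \<sqsubseteq> u" "u \<sqsubseteq> t" for u
    proof -
      have "b \<sqsubseteq> u" using that b' abc le_trans by blast
      then have "t \<sqsubseteq> u" using abc that join_le by metis
      then show ?thesis using that t by (simp add: le_antisym)
    qed
    have "(a \<squnion> c1) \<squnion> b' = t"
    proof (rule ge)
      show "a \<sqsubseteq> a \<squnion> c1 \<squnion> b'"
        using ac1 abc c1 b' by (meson join_closed join_left le_trans)
      show "a \<squnion> c1 \<squnion> b' \<sqsubseteq> t"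
        using ac1 abc lec le b' b'le t by (meson join_le le_trans)
    qed (use ac1 b' in \<open>auto simp: join_right\<close>)
    moreover have cb': "c \<squnion> b' = t"
    proof (rule ge)
      show "a \<sqsubseteq> c \<squnion> b'"
        using abc b' by (meson join_closed join_left le_trans)
      show "c \<squnion> b' \<sqsubseteq> t" using abc le b' b'le t by (simp add: join_le)
    qed (use abc b' in \<open>auto simp: join_right\<close>)
    ultimately show "a \<squnion> c1 \<squnion> b' = c \<squnion> b'" "c \<squnion> b' \<sqsubseteq> t" using t by auto
    show "z \<sqsubseteq> c \<sqinter> b'"
      using abc b' le z by (meson le_trans meet_le)
    have "c1 \<noteq> z" using dc1 zd d z by (auto intro: le_antisym)
    then show "c \<sqinter> b' \<noteq> z \<or> c \<squnion> b' \<noteq> t" by (simp add: c1_def)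
  qed (use abc b' in auto)
  ultimately show False
    using a1 abc join_absorb2 by metis
qed

text \<open>In a minimal pentagon, the incomparable element \<open>b\<close> is both an atom and a coatom.\<close>

lemma modular_latticeI_covers:
  fixes L :: "'a gorder" (structure)
  assumes L: "lattice L" and fin: "locally_finite L"
    and up: "\<And>r a b. covers L r a \<Longrightarrow> covers L r b \<Longrightarrow> a \<noteq> b \<Longrightarrow> covers L a (a \<squnion>\<^bsub>L\<^esub> b)"
    and down: "\<And>r a b. covers L a r \<Longrightarrow> covers L b r \<Longrightarrow> a \<noteq> b \<Longrightarrow> covers L (a \<sqinter>\<^bsub>L\<^esub> b) a"
  shows "modular_lattice L"
proof -
  interpret gorder_lattice L using L by (rule gorder_lattice.intro)
  note L' = lattice_dual[OF L] and fin' = locally_finite_dual[OF fin]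
  have no_pentagon: "a = c"
    if "a \<in> carrier L" "b \<in> carrier L" "c \<in> carrier L" "a \<sqsubseteq> c"
      "a \<sqinter> b = z" "c \<sqinter> b = z" "a \<squnion> b = t" "c \<squnion> b = t" for a b c z t
    using that
  proof (induction "card \<lbrace>z..t\<rbrace>" arbitrary: a b c z t rule: less_induct)
    case less
    note abc = less.prems
    have z: "z \<in> carrier L" and t: "t \<in> carrier L" using abc by auto
    have zt: "z \<sqsubseteq> t" using abc by (meson join_left le_trans meet_left meet_closed join_closed)
    have smaller: "a' = c'" if "a' \<in> carrier L" "b' \<in> carrier L" "c' \<in> carrier L" "a' \<sqsubseteq> c'"
      "a' \<sqinter> b' = c' \<sqinter> b'" "a' \<squnion> b' = c' \<squnion> b'" "z \<sqsubseteq> c' \<sqinter> b'" "c' \<squnion> b' \<sqsubseteq> t"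
      "c' \<sqinter> b' \<noteq> z \<or> c' \<squnion> b' \<noteq> t" for a' b' c'
    proof (rule less.hyps)
      have le: "c' \<sqinter> b' \<sqsubseteq> c' \<squnion> b'"
        using that by (meson join_left le_trans meet_left meet_closed join_closed)
      have "\<lbrace>c' \<sqinter> b'..c' \<squnion> b'\<rbrace> \<subset> \<lbrace>z..t\<rbrace>"
        unfolding psubset_eq
        using interval_subset_iff[of "c' \<sqinter> b'" "c' \<squnion> b'" z t]
          interval_eq_iff[of "c' \<sqinter> b'" "c' \<squnion> b'" z t] that le z t zt by auto
      then show "card \<lbrace>c' \<sqinter> b'..c' \<squnion> b'\<rbrace> < card \<lbrace>z..t\<rbrace>"
        using fin z t by (auto simp: locally_finite_def intro: psubset_card_mono)
    qed (use that in auto)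
    show "a = c"
    proof (rule ccontr)
      assume ac: "a \<noteq> c"
      have "covers L b t"
        by (rule minimal_pentagon_cover[OF L fin up abc(1-4) ac abc(5-8) smaller])
      have "covers (inv_gorder L) b z"
      \<comment> \<open>The dual lattice turns the pentagon over: \<open>a\<close> and
        \<open>c\<close> change places, and so do \<open>z\<close> and \<open>t\<close>.\<close>
      proof (rule minimal_pentagon_cover[OF L' fin', of c b a t z])
        show "covers (inv_gorder L) a (a \<squnion>\<^bsub>inv_gorder L\<^esub> b)"
          if "covers (inv_gorder L) r a" "covers (inv_gorder L) r b" "a \<noteq> b" for r a b
          using that down by (simp add: covers_dual L)
        show "a' = c'" if "a' \<in> carrier (inv_gorder L)" "b' \<in> carrier (inv_gorder L)"
          "c' \<in> carrier (inv_gorder L)" "a' \<sqsubseteq>\<^bsub>inv_gorder L\<^esub> c'"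
          "a' \<sqinter>\<^bsub>inv_gorder L\<^esub> b' = c' \<sqinter>\<^bsub>inv_gorder L\<^esub> b'"
          "a' \<squnion>\<^bsub>inv_gorder L\<^esub> b' = c' \<squnion>\<^bsub>inv_gorder L\<^esub> b'"
          "t \<sqsubseteq>\<^bsub>inv_gorder L\<^esub> c' \<sqinter>\<^bsub>inv_gorder L\<^esub> b'" "c' \<squnion>\<^bsub>inv_gorder L\<^esub> b' \<sqsubseteq>\<^bsub>inv_gorder L\<^esub> z"
          "c' \<sqinter>\<^bsub>inv_gorder L\<^esub> b' \<noteq> t \<or> c' \<squnion>\<^bsub>inv_gorder L\<^esub> b' \<noteq> z" for a' b' c'
          using smaller[of c' b' a'] that by auto
      qed (use abc ac in auto)
      then have zb: "covers L z b" by (simp add: covers_dual L)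
      \<comment> \<open>Since \<open>b\<close> is an atom over \<open>z\<close>, the element
        \<open>t\<close> covers \<open>a\<close>. So \<open>c\<close>, strictly above
        \<open>a\<close>, can only be \<open>t\<close>; then \<open>b\<close> lies below
        \<open>c\<close> and equals its meet \<open>z\<close> with \<open>c\<close>.\<close>
      have "\<not> b \<sqsubseteq> a"
        using abc ac by (metis join_absorb2 join_left le_antisym)
      moreover have "z \<sqsubseteq> a" using meet_left[OF abc(1,2)] abc(5) by simp
      ultimately have "covers L a (a \<squnion> b)"
        by (intro semimodular_covers_join[where r = z, OF L fin up zb abc(1)])
      then have "covers L a t" using abc(7) by simp
      then have "c = t"
        using abc ac join_left unfolding covers_iff by metis
      then have "b \<sqsubseteq> c" using abc join_right by blast
      then have "b = z" using abc meet_absorb2 by metis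
      then show False using zb by (simp add: covers_iff)
    qed
  qed
  \<comment> \<open>Both sides of the modular law have the same meet and the same join with
    \<open>b\<close>; if they differed, they would form a pentagon with it.\<close>
  have "a \<squnion> (b \<sqinter> c) = (a \<squnion> b) \<sqinter> c"
    if abc: "a \<in> carrier L" "b \<in> carrier L" "c \<in> carrier L" "a \<sqsubseteq> c" for a b c
  proof -
    have le: "a \<squnion> (b \<sqinter> c) \<sqsubseteq> (a \<squnion> b) \<sqinter> c"
    proof (rule meet_le)
      have "b \<sqinter> c \<sqsubseteq> a \<squnion> b"
        using le_trans[OF meet_left[of b c] join_right[of a b]] abc by simp
      then show "a \<squnion> (b \<sqinter> c) \<sqsubseteq> a \<squnion> b" using abc by (simp add: join_le join_left)
      show "a \<squnion> (b \<sqinter> c) \<sqsubseteq> c" using abc by (simp add: join_le meet_right)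
    qed (use abc in auto)
    have m: "x \<sqinter> b = b \<sqinter> c" if "x \<in> carrier L" "b \<sqinter> c \<sqsubseteq> x" "x \<sqsubseteq> c" for x
    proof (rule meet_eqI)
      show "u \<sqsubseteq> b \<sqinter> c" if "u \<in> carrier L" "u \<sqsubseteq> x" "u \<sqsubseteq> b" for u
        using that \<open>x \<sqsubseteq> c\<close> \<open>x \<in> carrier L\<close> abc by (meson le_trans meet_le)
    qed (use that abc in \<open>auto simp: meet_left\<close>)
    have j: "x \<squnion> b = a \<squnion> b" if "x \<in> carrier L" "a \<sqsubseteq> x" "x \<sqsubseteq> a \<squnion> b" for x
    proof (rule join_eqI)
      show "a \<squnion> b \<sqsubseteq> u" if "u \<in> carrier L" "x \<sqsubseteq> u" "b \<sqsubseteq> u" for u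
        using that \<open>a \<sqsubseteq> x\<close> \<open>x \<in> carrier L\<close> abc by (meson le_trans join_le)
    qed (use that abc in \<open>auto simp: join_right\<close>)
    have A: "b \<sqinter> c \<sqsubseteq> a \<squnion> (b \<sqinter> c)" "a \<sqsubseteq> a \<squnion> (b \<sqinter> c)" "(a \<squnion> b) \<sqinter> c \<sqsubseteq> c"
      "(a \<squnion> b) \<sqinter> c \<sqsubseteq> a \<squnion> b"
      using abc by (auto simp: join_left join_right meet_left meet_right)
    have C: "a \<squnion> (b \<sqinter> c) \<in> carrier L" "(a \<squnion> b) \<sqinter> c \<in> carrier L" "b \<sqinter> c \<in> carrier L" "a \<squnion> b \<in> carrier L"
      using abc by auto
    show ?thesis
    proof (rule no_pentagon[OF C(1) abc(2) C(2) le])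
      show "(a \<squnion> (b \<sqinter> c)) \<sqinter> b = b \<sqinter> c" "(a \<squnion> b) \<sqinter> c \<sqinter> b = b \<sqinter> c"
        using A C abc le by (auto intro!: m elim: le_trans)
      show "a \<squnion> (b \<sqinter> c) \<squnion> b = a \<squnion> b" "(a \<squnion> b) \<sqinter> c \<squnion> b = a \<squnion> b"
        using A C abc le by (auto intro!: j elim: le_trans)
    qed
  qed
  then show ?thesis unfolding modular_lattice_def using L by blast
qed

subsection \<open>Complemented intervals\<close>

text \<open>This variant of \<open>complemented_interval\<close> names the end points and uses the
  operations of \<open>L\<close> itself, so that dualising just exchanges the two ends.\<close>

definition complemented_between :: "'a gorder \<Rightarrow> 'a \<Rightarrow> 'a \<Rightarrow> bool" where
  "complemented_between L x y \<longleftrightarrow> x \<in> carrier L \<and> y \<in> carrier L \<and> x \<sqsubseteq>\<^bsub>L\<^esub> y \<and>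
     (\<forall>a\<in>\<lbrace>x..y\<rbrace>\<^bsub>L\<^esub>. \<exists>b\<in>\<lbrace>x..y\<rbrace>\<^bsub>L\<^esub>. a \<squnion>\<^bsub>L\<^esub> b = y \<and> a \<sqinter>\<^bsub>L\<^esub> b = x)"

lemma complemented_interval_between:
  "lattice L \<Longrightarrow> complemented_interval L B \<longleftrightarrow> (\<exists>x y. complemented_between L x y \<and> B = \<lbrace>x..y\<rbrace>\<^bsub>L\<^esub>)"
  using gorder_lattice.complemented_interval_iff[of L B]
  unfolding complemented_between_def gorder_lattice_iff by blast

lemma complemented_between_dual:
  "complemented_between (inv_gorder L) x y \<longleftrightarrow> complemented_between L y x"
  by (auto simp: complemented_between_def)

text \<open>If \<open>c\<close> is a complement of \<open>a\<close> in the large interval, then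
  \<open>(x \<squnion> c) \<sqinter> y\<close> is one in the small interval; each of the two
  equations is an instance of the modular law.\<close>

lemma complemented_between_sub:
  fixes L :: "'a gorder" (structure)
  assumes M: "modular_lattice L" and uv: "complemented_between L u v"
    and xy: "x \<in> carrier L" "y \<in> carrier L" "u \<sqsubseteq> x" "x \<sqsubseteq> y" "y \<sqsubseteq> v"
  shows "complemented_between L x y"
  unfolding complemented_between_def
proof (intro conjI ballI)
  interpret gorder_lattice L using M by (simp add: modular_lattice_def gorder_lattice_iff)
  fix a assume "a \<in> \<lbrace>x..y\<rbrace>"
  then have a: "a \<in> carrier L" "x \<sqsubseteq> a" "a \<sqsubseteq> y" by (auto simp: at_least_at_most_def)
  have uv': "u \<in> carrier L" "v \<in> carrier L" using uv by (auto simp: complemented_between_def)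
  have "a \<in> \<lbrace>u..v\<rbrace>"
    using a uv' xy le_trans[of u x a] le_trans[of a y v] by (simp add: at_least_at_most_def)
  then obtain c where c: "c \<in> carrier L" "u \<sqsubseteq> c" "c \<sqsubseteq> v" "a \<squnion> c = v" "a \<sqinter> c = u"
    using uv unfolding complemented_between_def at_least_at_most_def by blast
  define d where "d = x \<squnion> c"
  have d: "d \<in> carrier L" "x \<sqsubseteq> d" "c \<sqsubseteq> d"
    using xy c by (auto simp: d_def join_left join_right)
  have mod: "\<And>a b c. a \<in> carrier L \<Longrightarrow> b \<in> carrier L \<Longrightarrow> c \<in> carrier L \<Longrightarrow> a \<sqsubseteq> c \<Longrightarrow>
    a \<squnion> (b \<sqinter> c) = (a \<squnion> b) \<sqinter> c"
    using M by (simp add: modular_lattice_def)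
  have "v \<sqsubseteq> a \<squnion> d"
    using join_le[of a "a \<squnion> d" c] c(1,4) d a
      le_trans[of c d "a \<squnion> d"] join_left[of a d] join_right[of a d] by simp
  then have "y \<sqsubseteq> a \<squnion> d" using xy uv' a d le_trans[of y v "a \<squnion> d"] by simp
  then have 1: "a \<squnion> (d \<sqinter> y) = y"
    using mod[of a d y] a d xy by (simp add: meet_absorb2)
  have "x \<squnion> (c \<sqinter> a) = d \<sqinter> a"
    using mod[of x c a] xy c a by (simp add: d_def)
  then have da: "d \<sqinter> a = x"
    using c(5) meet_comm[of L a c] xy uv' by (simp add: join_absorb2)
  have dy: "d \<sqinter> y \<in> \<lbrace>x..y\<rbrace>"
    using d xy by (simp add: at_least_at_most_def meet_le meet_right)
  have 2: "a \<sqinter> (d \<sqinter> y) = x"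
  proof (rule meet_eqI)
    fix w assume w: "w \<in> carrier L" "w \<sqsubseteq> a" "w \<sqsubseteq> d \<sqinter> y"
    then have "w \<sqsubseteq> d" using le_trans[of w "d \<sqinter> y" d] meet_left[of d y] d xy by simp
    then show "w \<sqsubseteq> x" using meet_le[of w d a] w d a da by simp
  qed (use a d xy dy in \<open>auto simp: at_least_at_most_def\<close>)
  show "\<exists>b\<in>\<lbrace>x..y\<rbrace>. a \<squnion> b = y \<and> a \<sqinter> b = x" using 1 2 dy by blast
qed (use xy in auto)

text \<open>This expresses that the top of a complemented interval is the join of its atoms. A
  complement of \<open>w \<sqinter> v\<close> strictly above \<open>u\<close> would contain an atom,
  which also lies below \<open>w \<sqinter> v\<close> and therefore below \<open>u\<close>.\<close>

lemma complemented_between_top_le: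
  fixes L :: "'a gorder" (structure)
  assumes L: "lattice L" and fin: "locally_finite L" and uv: "complemented_between L u v"
    and o: "w \<in> carrier L" "u \<sqsubseteq> w" "\<And>t. covers L u t \<Longrightarrow> t \<sqsubseteq> v \<Longrightarrow> t \<sqsubseteq> w"
  shows "v \<sqsubseteq> w"
proof -
  interpret gorder_lattice L using L by (rule gorder_lattice.intro)
  have uv': "u \<in> carrier L" "v \<in> carrier L" "u \<sqsubseteq> v" using uv by (auto simp: complemented_between_def)
  define m where "m = w \<sqinter> v"
  have m: "m \<in> carrier L" "u \<sqsubseteq> m" "m \<sqsubseteq> v" "m \<sqsubseteq> w"
    using o uv' by (auto simp: m_def meet_le meet_left meet_right)
  then obtain c where c: "c \<in> carrier L" "u \<sqsubseteq> c" "c \<sqsubseteq> v" "m \<squnion> c = v" "m \<sqinter> c = u"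
    using uv unfolding complemented_between_def at_least_at_most_def by blast
  have "c = u"
  proof (rule ccontr)
    assume "c \<noteq> u"
    then obtain t where t: "t \<in> carrier L" "covers L u t" "t \<sqsubseteq> c"
      using exists_upper_cover[OF L fin uv'(1) c(1,2)] by blast
    have "t \<sqsubseteq> v" using le_trans[OF t(3) c(3)] t c uv' by blast
    then have "t \<sqsubseteq> m" using o(3)[OF t(2)] o(1) t uv' by (simp add: m_def meet_le)
    then have "t \<sqsubseteq> u" using meet_le[OF _ t(3) m(1) c(1) t(1)] c(5) by simp
    then show False using t(2) by (auto simp: covers_iff intro: le_antisym)
  qed
  then have "m = v" using c(4) m uv' by (simp add: join_absorb2)
  then show ?thesis using m by simp
qed

lemma complemented_between_bot_ge:
  fixes L :: "'a gorder" (structure)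
  assumes L: "lattice L" and fin: "locally_finite L" and uv: "complemented_between L u v"
    and o: "w \<in> carrier L" "w \<sqsubseteq> v" "\<And>t. covers L t v \<Longrightarrow> u \<sqsubseteq> t \<Longrightarrow> w \<sqsubseteq> t"
  shows "w \<sqsubseteq> u"
  using complemented_between_top_le[OF lattice_dual[OF L] locally_finite_dual[OF fin], of v u w]
    assms by (simp add: complemented_between_dual covers_dual)

section \<open>Lattices covered by a family of blocks\<close>

definition block_le :: "'s gorder \<Rightarrow> ('s \<Rightarrow> 'p gorder) \<Rightarrow> 's \<Rightarrow> 'p \<Rightarrow> 'p \<Rightarrow> bool" where
  "block_le S Blk x p q \<longleftrightarrow> x \<in> carrier S \<and> p \<in> carrier (Blk x) \<and> q \<in> carrier (Blk x) \<and>
     p \<sqsubseteq>\<^bsub>Blk x\<^esub> q"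

text \<open>The steps of a path may use blocks in any order, so paths can be extended at either end
  and reversed. The conjunct on \<open>p\<close> restricts the reflexive closure to the
  carrier.\<close>

definition glue :: "'s gorder \<Rightarrow> ('s \<Rightarrow> 'p gorder) \<Rightarrow> 'p gorder" where
  "glue S Blk = \<lparr>carrier = (\<Union>x\<in>carrier S. carrier (Blk x)), eq = (=),
     le = (\<lambda>p q. p \<in> (\<Union>x\<in>carrier S. carrier (Blk x)) \<and>
       (\<lambda>p q. \<exists>x. block_le S Blk x p q)\<^sup>*\<^sup>* p q)\<rparr>"

locale glued_blocks =
  fixes S :: "'s gorder" (structure) and Blk :: "'s \<Rightarrow> 'p gorder"
  assumes skeleton: "lffc_lattice S"
    and block: "x \<in> carrier S \<Longrightarrow>
      finite (carrier (Blk x)) \<and> modular_lattice (Blk x) \<and> complemented_lattice (Blk x)"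
    and mem_join: "\<lbrakk>x \<in> carrier S; y \<in> carrier S; p \<in> carrier (Blk x); p \<in> carrier (Blk y)\<rbrakk> \<Longrightarrow>
      p \<in> carrier (Blk (x \<squnion> y))"
    and mem_meet: "\<lbrakk>x \<in> carrier S; y \<in> carrier S; p \<in> carrier (Blk x); p \<in> carrier (Blk y)\<rbrakk> \<Longrightarrow>
      p \<in> carrier (Blk (x \<sqinter> y))"
    and mem_convex: "\<lbrakk>x \<in> carrier S; y \<in> carrier S; z \<in> carrier S; x \<sqsubseteq> z; z \<sqsubseteq> y;
      p \<in> carrier (Blk x); p \<in> carrier (Blk y)\<rbrakk> \<Longrightarrow> p \<in> carrier (Blk z)"
    and le_up: "\<lbrakk>x \<in> carrier S; y \<in> carrier S; x \<sqsubseteq> y; p \<in> carrier (Blk x); p \<in> carrier (Blk y);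
      q \<in> carrier (Blk x); p \<sqsubseteq>\<^bsub>Blk x\<^esub> q\<rbrakk> \<Longrightarrow> q \<in> carrier (Blk y) \<and> p \<sqsubseteq>\<^bsub>Blk y\<^esub> q"
    and le_down: "\<lbrakk>x \<in> carrier S; y \<in> carrier S; x \<sqsubseteq> y; p \<in> carrier (Blk x); p \<in> carrier (Blk y);
      q \<in> carrier (Blk y); q \<sqsubseteq>\<^bsub>Blk y\<^esub> p\<rbrakk> \<Longrightarrow> q \<in> carrier (Blk x) \<and> q \<sqsubseteq>\<^bsub>Blk x\<^esub> p"
    and cover: "covers S x y \<Longrightarrow> carrier (Blk x) \<inter> carrier (Blk y) \<noteq> {} \<and>
      \<not> carrier (Blk x) \<subseteq> carrier (Blk y) \<and> \<not> carrier (Blk y) \<subseteq> carrier (Blk x)"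
begin

abbreviation G where "G \<equiv> glue S Blk"
abbreviation at where "at \<equiv> block_le S Blk"
abbreviation mem (\<open>\<Lambda>\<close>) where "mem x \<equiv> carrier (Blk x)"
abbreviation zero where "zero x \<equiv> \<bottom>\<^bsub>Blk x\<^esub>"
abbreviation one where "one x \<equiv> \<top>\<^bsub>Blk x\<^esub>"

lemma S_lattice: "lattice S" and S_finite: "locally_finite S"
  using skeleton by (auto simp: lffc_lattice_def)

sublocale S: gorder_lattice S
  by (simp add: gorder_lattice_iff S_lattice)

lemma block_lattice: "x \<in> carrier S \<Longrightarrow> gorder_lattice (Blk x)"
  using block by (simp add: modular_lattice_def gorder_lattice_iff)

lemma block_bounded: "x \<in> carrier S \<Longrightarrow> bounded_lattice (Blk x)"
  using block by (simp add: complemented_lattice_def)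

text \<open>The axioms come in mirror pairs: \<open>mem_join\<close> with \<open>mem_meet\<close>,
  \<open>le_up\<close> with \<open>le_down\<close>. Through this lemma each half of the theory is
  obtained from the other.\<close>

lemma dual: "glued_blocks (inv_gorder S) (\<lambda>x. inv_gorder (Blk x))"
  apply unfold_locales
  subgoal using skeleton by (rule lffc_lattice_dual)
  subgoal for x using block[of x] by (simp add: modular_lattice_dual complemented_lattice_dual)
  subgoal for x y p using mem_meet[of x y p] by simp
  subgoal for x y p using mem_join[of x y p] by simp
  subgoal for x y z p using mem_convex[of y x z p] by simp
  subgoal for x y p q using le_down[of y x p q] by simp
  subgoal for x y p q using le_up[of y x p q] by simp
  subgoal for x y using cover[of y x] by (auto simp: covers_dual S_lattice)
  done

lemma block_le_dual:
  "block_le (inv_gorder S) (\<lambda>x. inv_gorder (Blk x)) x p q \<longleftrightarrow> at x q p"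
  by (auto simp: block_le_def)

lemma at_mem: "at x p q \<Longrightarrow> x \<in> carrier S \<and> p \<in> \<Lambda> x \<and> q \<in> \<Lambda> x"
  by (simp add: block_le_def)

lemma at_refl: "x \<in> carrier S \<Longrightarrow> p \<in> \<Lambda> x \<Longrightarrow> at x p p"
proof -
  assume "x \<in> carrier S" "p \<in> \<Lambda> x"
  then interpret gorder_lattice "Blk x" by (intro block_lattice)
  show ?thesis using \<open>x \<in> carrier S\<close> \<open>p \<in> \<Lambda> x\<close> by (simp add: block_le_def)
qed

lemma at_trans: "at x p q \<Longrightarrow> at x q r \<Longrightarrow> at x p r"
proof -
  assume a: "at x p q" "at x q r"
  then interpret gorder_lattice "Blk x" by (intro block_lattice) (simp add: block_le_def)
  show ?thesis using a unfolding block_le_def by (auto intro: le_trans)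
qed

lemma at_antisym: "at x p q \<Longrightarrow> at x q p \<Longrightarrow> p = q"
proof -
  assume a: "at x p q" "at x q p"
  then interpret gorder_lattice "Blk x" by (intro block_lattice) (simp add: block_le_def)
  show ?thesis using a unfolding block_le_def by (auto intro: le_antisym)
qed

text \<open>\<open>mem_join\<close> brings \<open>p\<close> into the block of the join, and
  \<open>le_up\<close> then carries the whole comparison from \<open>x\<close> into that
  block.\<close>

lemma at_join:
  assumes "v \<in> carrier S" "p \<in> \<Lambda> v" "at x p q"
  shows "at (v \<squnion> x) p q"
  using assms le_up[of x "v \<squnion> x" p q] mem_join[of v x p] S.join_right
  by (auto simp: block_le_def)

lemma at_meet:
  assumes "v \<in> carrier S" "q \<in> \<Lambda> v" "at x p q"
  shows "at (v \<sqinter> x) p q"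
  using assms le_down[of "v \<sqinter> x" x q p] mem_meet[of v x q] S.meet_right
  by (auto simp: block_le_def)

lemma at_up: "at x p q \<Longrightarrow> y \<in> carrier S \<Longrightarrow> x \<sqsubseteq> y \<Longrightarrow> p \<in> \<Lambda> y \<Longrightarrow> at y p q"
  using le_up[of x y p q] by (auto simp: block_le_def)

subsection \<open>The glued order\<close>

abbreviation gle (infix \<open>\<preceq>\<close> 50) where "p \<preceq> q \<equiv> p \<sqsubseteq>\<^bsub>G\<^esub> q"

lemma glue_carrier: "carrier G = (\<Union>x\<in>carrier S. \<Lambda> x)"
  by (simp add: glue_def)

lemma mem_carrier: "x \<in> carrier S \<Longrightarrow> p \<in> \<Lambda> x \<Longrightarrow> p \<in> carrier G"
  by (auto simp: glue_carrier)

lemma carrierE: "p \<in> carrier G \<Longrightarrow> (\<And>x. x \<in> carrier S \<Longrightarrow> p \<in> \<Lambda> x \<Longrightarrow> thesis) \<Longrightarrow> thesis"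
  by (auto simp: glue_carrier)

lemma gle_iff: "p \<preceq> q \<longleftrightarrow> p \<in> carrier G \<and> (\<lambda>p q. \<exists>x. at x p q)\<^sup>*\<^sup>* p q"
  by (simp add: glue_def)

lemma at_gle: "at x p q \<Longrightarrow> p \<preceq> q"
  unfolding gle_iff using at_mem mem_carrier by blast

lemma gle_refl: "p \<in> carrier G \<Longrightarrow> p \<preceq> p"
  by (simp add: gle_iff)

lemma gle_trans: "p \<preceq> q \<Longrightarrow> q \<preceq> r \<Longrightarrow> p \<preceq> r"
  unfolding gle_iff by auto

lemma gle_carrier: "p \<preceq> q \<Longrightarrow> p \<in> carrier G \<and> q \<in> carrier G"
proof -
  assume "p \<preceq> q"
  then have "(\<lambda>p q. \<exists>x. at x p q)\<^sup>*\<^sup>* p q" "p \<in> carrier G" by (auto simp: gle_iff)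
  then have "q \<in> carrier G"
    by (induction rule: rtranclp_induct) (use at_mem mem_carrier in blast)+
  then show ?thesis using \<open>p \<in> carrier G\<close> by blast
qed

text \<open>Reversing all steps reverses the closure. The carrier condition is imposed on one end of
  a path only and has to be transported to the other end.\<close>

lemma glue_dual: "glue (inv_gorder S) (\<lambda>x. inv_gorder (Blk x)) = inv_gorder G"
proof -
  have "(\<lambda>p q. \<exists>x. at x q p)\<^sup>*\<^sup>* = (\<lambda>p q. (\<lambda>p q. \<exists>x. at x p q)\<^sup>*\<^sup>* q p)"
    using rtranclp_conversep[of "\<lambda>p q. \<exists>x. at x p q"] by (simp add: conversep_iff[abs_def] fun_eq_iff)
  moreover have "q \<in> carrier G" if "(\<lambda>p q. \<exists>x. at x p q)\<^sup>*\<^sup>* q p" "p \<in> carrier G" for p q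
    using that by (induction rule: converse_rtranclp_induct) (use at_mem mem_carrier in blast)+
  ultimately have "(p \<in> carrier G \<and> (\<lambda>p q. \<exists>x. at x q p)\<^sup>*\<^sup>* p q) = (q \<preceq> p)" for p q
    using gle_carrier[of q p] gle_iff[of q p] by auto
  then show ?thesis
    by (simp add: glue_def block_le_dual)
qed

text \<open>Each step is lifted by \<open>at_join\<close> with the index reached so far, so the
  indices never drop below \<open>v\<close>.\<close>

lemma path_above:
  assumes v: "v \<in> carrier S" "p \<in> \<Lambda> v" and pq: "p \<preceq> q"
  shows "(\<exists>w\<in>carrier S. v \<sqsubseteq> w \<and> q \<in> \<Lambda> w) \<and>
    (\<lambda>r s. \<exists>z. v \<sqsubseteq> z \<and> at z r s)\<^sup>*\<^sup>* p q"
proof -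
  have "(\<lambda>p q. \<exists>x. at x p q)\<^sup>*\<^sup>* p q" using pq by (simp add: gle_iff)
  then show ?thesis
  proof (induction rule: rtranclp_induct)
    case base
    then show ?case using v by auto
  next
    case (step r s)
    then obtain w x where w: "w \<in> carrier S" "v \<sqsubseteq> w" "r \<in> \<Lambda> w" and x: "at x r s" by blast
    have "at (w \<squnion> x) r s" using at_join w x by blast
    moreover have "v \<sqsubseteq> w \<squnion> x" "w \<squnion> x \<in> carrier S"
      using v w at_mem[OF x] by (meson S.join_closed S.join_left S.le_trans)+
    ultimately show ?case
      using step.IH at_mem[of "w \<squnion> x" r s]
      by (intro conjI rtranclp.rtrancl_into_rtrancl[of _ p r s]) blast+
  qed
qed

lemma mem_above: "v \<in> carrier S \<Longrightarrow> p \<in> \<Lambda> v \<Longrightarrow> p \<preceq> q \<Longrightarrow> \<exists>w\<in>carrier S. v \<sqsubseteq> w \<and> q \<in> \<Lambda> w"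
  using path_above by blast

lemma mem_below: "v \<in> carrier S \<Longrightarrow> q \<in> \<Lambda> v \<Longrightarrow> p \<preceq> q \<Longrightarrow> \<exists>w\<in>carrier S. w \<sqsubseteq> v \<and> p \<in> \<Lambda> w"
  using glued_blocks.mem_above[OF dual, of v q p] by (simp add: glue_dual)

text \<open>The indices are already above \<open>x\<close>. Going back from \<open>q\<close>, each
  step is pushed down by \<open>at_meet\<close> with an index below \<open>w\<close>; the meet of
  two indices above \<open>x\<close> stays above \<open>x\<close>.\<close>

lemma path_between:
  assumes "x \<in> carrier S" "w \<in> carrier S" "x \<sqsubseteq> w" "p \<in> \<Lambda> x" "q \<in> \<Lambda> w" "p \<preceq> q"
  shows "(\<lambda>r s. \<exists>z. x \<sqsubseteq> z \<and> z \<sqsubseteq> w \<and> at z r s)\<^sup>*\<^sup>* p q"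
proof -
  have "(\<lambda>r s. \<exists>z. x \<sqsubseteq> z \<and> at z r s)\<^sup>*\<^sup>* p q" using path_above assms by blast
  then have "(\<exists>v\<in>carrier S. x \<sqsubseteq> v \<and> v \<sqsubseteq> w \<and> p \<in> \<Lambda> v) \<and>
    (\<lambda>r s. \<exists>z. x \<sqsubseteq> z \<and> z \<sqsubseteq> w \<and> at z r s)\<^sup>*\<^sup>* p q"
  proof (induction rule: converse_rtranclp_induct)
    case base
    then show ?case using assms by auto
  next
    case (step r s)
    then obtain v z where v: "v \<in> carrier S" "x \<sqsubseteq> v" "v \<sqsubseteq> w" "s \<in> \<Lambda> v"
      and z: "x \<sqsubseteq> z" "at z r s" by blast
    have "at (v \<sqinter> z) r s" using at_meet v z by blast
    moreover have "x \<sqsubseteq> v \<sqinter> z" "v \<sqinter> z \<sqsubseteq> w"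
      using v z at_mem[OF z(2)] assms(1,2)
      by (auto intro: S.meet_le S.le_trans[OF S.meet_left])
    ultimately show ?case
      using step.IH at_mem[of "v \<sqinter> z" r s]
      by (intro conjI converse_rtranclp_into_rtranclp[of _ r s]) blast+
  qed
  then show ?thesis by blast
qed

text \<open>Some index \<open>u\<close> above \<open>x\<close> and some index \<open>v\<close> below
  \<open>w\<close> contain \<open>r\<close>. Then \<open>u \<sqinter> v\<close> contains
  \<open>r\<close> as well, and \<open>x \<squnion> (u \<sqinter> v)\<close> lies between it and
  \<open>u\<close>, so convexity applies.\<close>

lemma mem_between:
  assumes x: "x \<in> carrier S" "w \<in> carrier S" "x \<sqsubseteq> w" "p \<in> \<Lambda> x" "q \<in> \<Lambda> w" and pr: "p \<preceq> r" "r \<preceq> q"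
  shows "\<exists>z\<in>carrier S. x \<sqsubseteq> z \<and> z \<sqsubseteq> w \<and> r \<in> \<Lambda> z"
proof -
  obtain u where u: "u \<in> carrier S" "x \<sqsubseteq> u" "r \<in> \<Lambda> u" using mem_above x pr by blast
  obtain v where v: "v \<in> carrier S" "v \<sqsubseteq> w" "r \<in> \<Lambda> v" using mem_below x pr by blast
  let ?m = "u \<sqinter> v"
  have m: "?m \<in> carrier S" "r \<in> \<Lambda> ?m" using u v mem_meet by auto
  have "?m \<sqsubseteq> u" "?m \<sqsubseteq> v" using u v S.meet_left S.meet_right by auto
  then have "x \<squnion> ?m \<sqsubseteq> u" "x \<squnion> ?m \<sqsubseteq> w"
    using x u v m S.le_trans[of ?m v w] by (auto intro: S.join_le)
  then have "r \<in> \<Lambda> (x \<squnion> ?m)"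
    using mem_convex[of ?m u "x \<squnion> ?m" r] u m x S.join_right[of x ?m] by simp
  then show ?thesis
    using \<open>x \<squnion> ?m \<sqsubseteq> w\<close> m x S.join_left[of x ?m] by (intro bexI[of _ "x \<squnion> ?m"]) simp_all
qed

text \<open>All indices of the path are squeezed between \<open>v\<close> and \<open>v\<close>.
  Hence gluing creates no new comparison inside a block.\<close>

lemma gle_at:
  assumes v: "v \<in> carrier S" "p \<in> \<Lambda> v" "q \<in> \<Lambda> v" and pq: "p \<preceq> q"
  shows "at v p q"
proof -
  have "(\<lambda>r s. \<exists>z. v \<sqsubseteq> z \<and> z \<sqsubseteq> v \<and> at z r s)\<^sup>*\<^sup>* p q"
    using path_between assms by blast
  then show ?thesis
  proof (induction rule: rtranclp_induct)
    case base
    then show ?case using v at_refl by blast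
  next
    case (step r s)
    then obtain z where "v \<sqsubseteq> z" "z \<sqsubseteq> v" "at z r s" by blast
    then have "at v r s" using at_mem v S.le_antisym by metis
    then show ?case using step.IH at_trans by blast
  qed
qed

lemma at_iff: "v \<in> carrier S \<Longrightarrow> p \<in> \<Lambda> v \<Longrightarrow> q \<in> \<Lambda> v \<Longrightarrow> p \<sqsubseteq>\<^bsub>Blk v\<^esub> q \<longleftrightarrow> p \<preceq> q"
  using gle_at at_gle unfolding block_le_def by blast

lemma mem_convex_glue:
  assumes "v \<in> carrier S" "p \<in> \<Lambda> v" "q \<in> \<Lambda> v" "p \<preceq> r" "r \<preceq> q"
  shows "r \<in> \<Lambda> v"
  using mem_between[of v v p q r] assms S.le_antisym by auto

lemma glue_partial_order: "partial_order G"
proof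
  show "p .=\<^bsub>G\<^esub> q" if "p \<preceq> q" "q \<preceq> p" "p \<in> carrier G" "q \<in> carrier G" for p q
  proof -
    obtain v where v: "v \<in> carrier S" "p \<in> \<Lambda> v" using \<open>p \<in> carrier G\<close> by (rule carrierE)
    then have "q \<in> \<Lambda> v" using mem_convex_glue that by blast
    then have "p = q" using gle_at v that at_antisym by blast
    then show ?thesis by (simp add: glue_def)
  qed
qed (use gle_refl gle_trans in \<open>auto simp: glue_def\<close>)

sublocale G: partial_order G by (rule glue_partial_order)

subsection \<open>Bounds of the blocks\<close>

lemma zero_mem: "x \<in> carrier S \<Longrightarrow> zero x \<in> \<Lambda> x"
  by (meson block_bounded bounded_lattice.axioms(2) weak_partial_order_bottom.bottom_closed)

lemma one_mem: "x \<in> carrier S \<Longrightarrow> one x \<in> \<Lambda> x"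
  by (meson block_bounded bounded_lattice.axioms(3) weak_partial_order_top.top_closed)

lemma zero_gle: "x \<in> carrier S \<Longrightarrow> p \<in> \<Lambda> x \<Longrightarrow> zero x \<preceq> p"
  by (meson block_bounded bounded_lattice.axioms(2) weak_partial_order_bottom.bottom_lower
      at_iff zero_mem)

lemma gle_one: "x \<in> carrier S \<Longrightarrow> p \<in> \<Lambda> x \<Longrightarrow> p \<preceq> one x"
  by (meson block_bounded bounded_lattice.axioms(3) weak_partial_order_top.top_higher
      at_iff one_mem)

text \<open>The overlap is a down-set of the upper block. Its bottom is thus a canonical witness
  that two comparable blocks meet.\<close>

lemma zero_mem_lower:
  assumes "x \<in> carrier S" "y \<in> carrier S" "x \<sqsubseteq> y" "p \<in> \<Lambda> x" "p \<in> \<Lambda> y"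
  shows "zero y \<in> \<Lambda> x"
  using le_down[of x y p "zero y"] at_iff[of y "zero y" p] zero_gle[of y p] zero_mem[of y] assms by blast

lemma zero_cover_mem: "covers S x y \<Longrightarrow> zero y \<in> \<Lambda> x"
  using cover[of x y] zero_mem_lower[of x y] by (auto simp: S.covers_iff)

text \<open>Distant blocks may be disjoint, so their bottoms are compared through a chain of covers,
  along which consecutive blocks overlap.\<close>

lemma zero_mono:
  assumes "x \<in> carrier S" "y \<in> carrier S" "x \<sqsubseteq> y"
  shows "zero x \<preceq> zero y"
  using S_lattice S_finite assms
proof (induction x rule: interval_induct)
  case (step x)
  show ?case
  proof (cases "x = y")
    case True
    then show ?thesis using step zero_mem mem_carrier gle_refl by simp
  next
    case False
    then obtain z where z: "z \<in> carrier S" "covers S x z" "z \<sqsubseteq> y"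
      using exists_upper_cover[OF S_lattice S_finite] step.hyps assms(2) by blast
    then have "zero z \<preceq> zero y" using step.IH[of z] by (auto simp: S.covers_iff)
    moreover have "zero x \<preceq> zero z" using z step.hyps zero_gle zero_cover_mem by blast
    ultimately show ?thesis using gle_trans by blast
  qed
qed

subsection \<open>Joins\<close>

abbreviation bjoin where "bjoin x p q \<equiv> p \<squnion>\<^bsub>Blk x\<^esub> q"

lemma bjoin:
  assumes "x \<in> carrier S" "p \<in> \<Lambda> x" "q \<in> \<Lambda> x"
  shows "bjoin x p q \<in> \<Lambda> x" "p \<preceq> bjoin x p q" "q \<preceq> bjoin x p q"
    "\<And>r. r \<in> \<Lambda> x \<Longrightarrow> p \<preceq> r \<Longrightarrow> q \<preceq> r \<Longrightarrow> bjoin x p q \<preceq> r"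
proof -
  interpret gorder_lattice "Blk x" using assms(1) by (rule block_lattice)
  show 1: "bjoin x p q \<in> \<Lambda> x" using assms by simp
  show "p \<preceq> bjoin x p q" "q \<preceq> bjoin x p q"
    using assms 1 by (auto simp flip: at_iff[OF assms(1)] intro: join_left join_right)
  show "bjoin x p q \<preceq> r" if "r \<in> \<Lambda> x" "p \<preceq> r" "q \<preceq> r" for r
    using assms 1 that by (auto simp flip: at_iff[OF assms(1)] intro: join_le)
qed

lemma mem_up:
  assumes "x \<in> carrier S" "y \<in> carrier S" "x \<sqsubseteq> y" "p \<in> \<Lambda> x" "p \<in> \<Lambda> y" "q \<in> \<Lambda> x" "p \<preceq> q"
  shows "q \<in> \<Lambda> y"
  using le_up[of x y p q] at_iff[of x p q] assms by blast

lemma mem_down: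
  assumes "x \<in> carrier S" "y \<in> carrier S" "x \<sqsubseteq> y" "p \<in> \<Lambda> x" "p \<in> \<Lambda> y" "q \<in> \<Lambda> y" "q \<preceq> p"
  shows "q \<in> \<Lambda> x"
  using le_down[of x y p q] at_iff[of y q p] assms by blast

lemma bjoin_mono:
  assumes x: "x \<in> carrier S" and pq: "p \<in> \<Lambda> x" "q \<in> \<Lambda> x" "p' \<in> \<Lambda> x" "q' \<in> \<Lambda> x"
    and le: "p \<preceq> p'" "q \<preceq> q'"
  shows "bjoin x p q \<preceq> bjoin x p' q'"
  using bjoin(4)[OF x pq(1,2) bjoin(1)[OF x pq(3,4)]] gle_trans[OF le(1) bjoin(2)[OF x pq(3,4)]]
    gle_trans[OF le(2) bjoin(3)[OF x pq(3,4)]] by blast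

text \<open>The join lies above \<open>zero y\<close>, which is in the overlap, and the overlap is
  an up-set of the lower block. This is the device that raises an element along a cover.\<close>

lemma bjoin_zero_mem:
  assumes "covers S x y" "p \<in> \<Lambda> x"
  shows "bjoin x p (zero y) \<in> \<Lambda> y"
proof -
  have xy: "x \<in> carrier S" "y \<in> carrier S" "x \<sqsubseteq> y" using assms by (auto simp: S.covers_iff)
  note z = zero_cover_mem[OF assms(1)]
  show ?thesis
    by (rule mem_up[OF xy z zero_mem[OF xy(2)]]) (rule bjoin[OF xy(1) assms(2) z])+
qed

lemma bjoin_agree:
  assumes "x \<in> carrier S" "y \<in> carrier S" "x \<sqsubseteq> y"
    "p \<in> \<Lambda> x" "p \<in> \<Lambda> y" "q \<in> \<Lambda> x" "q \<in> \<Lambda> y"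
  shows "bjoin x p q = bjoin y p q"
proof -
  note jx = bjoin[OF assms(1,4,6)] and jy = bjoin[OF assms(2,5,7)]
  have xy: "bjoin x p q \<in> \<Lambda> y" using mem_up[of x y p] assms jx by blast
  then have yx: "bjoin y p q \<preceq> bjoin x p q" using jx jy by blast
  then have "bjoin y p q \<in> \<Lambda> x" using mem_down[of x y "bjoin x p q"] assms jx jy xy by blast
  then have "bjoin x p q \<preceq> bjoin y p q" using jx jy by blast
  then show ?thesis using yx gle_carrier by blast
qed

text \<open>A join in block \<open>x\<close> is not yet known to be least in the glued order. The
  path to \<open>u\<close> is followed as long as its steps stay in block \<open>x\<close>, which
  only enlarges \<open>p\<close>. At the first step in another block, or at the end of the path, the
  current element lies in \<open>\<Lambda> y\<close> for some cover \<open>y\<close>, so joining it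
  with \<open>zero y\<close> changes nothing.\<close>

lemma first_step:
  assumes x: "x \<in> carrier S" and w: "w \<in> carrier S" and xw: "x \<sqsubseteq> w" "x \<noteq> w"
    and pq: "p \<in> \<Lambda> x" "u \<in> \<Lambda> w" "p \<preceq> u"
  shows "\<exists>y. covers S x y \<and> y \<sqsubseteq> w \<and> bjoin x p (zero y) \<preceq> u"
proof -
  have absorb: "bjoin x p (zero y) = p" if "covers S x y" "p \<in> \<Lambda> x" "p \<in> \<Lambda> y" for p y
  proof -
    have y: "y \<in> carrier S" using that by (simp add: S.covers_iff)
    have z: "zero y \<in> \<Lambda> x" using that zero_cover_mem by blast
    have "bjoin x p (zero y) \<preceq> p"
      using bjoin(4)[OF x that(2) z that(2)] zero_gle[OF y that(3)] gle_refl mem_carrier x that by blast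
    then show ?thesis using bjoin(2)[OF x that(2) z] gle_carrier by blast
  qed
  have "(\<lambda>r s. \<exists>z. x \<sqsubseteq> z \<and> z \<sqsubseteq> w \<and> at z r s)\<^sup>*\<^sup>* p u"
    using path_between assms by blast
  then show ?thesis using pq(1)
  proof (induction rule: converse_rtranclp_induct)
    case base
    obtain y where y: "y \<in> carrier S" "covers S x y" "y \<sqsubseteq> w"
      using exists_upper_cover[OF S_lattice S_finite x w xw] by blast
    then have "u \<in> \<Lambda> y" using mem_convex[of x w y u] base pq x w by (auto simp: S.covers_iff)
    then have "bjoin x u (zero y) \<preceq> u" using absorb y base gle_refl mem_carrier x by simp
    then show ?case using y by blast
  next
    case (step p r)
    have ru: "r \<preceq> u"
    proof -
      have "(\<lambda>p q. \<exists>x. at x p q)\<^sup>*\<^sup>* r u"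
        using step.hyps(2) by (rule rtranclp_mono[THEN predicate2D, rotated]) blast
      moreover have "r \<in> carrier G" using step.hyps(1) at_mem mem_carrier by blast
      ultimately show ?thesis by (simp add: gle_iff)
    qed
    obtain z where z: "x \<sqsubseteq> z" "z \<sqsubseteq> w" "at z p r" using step.hyps by blast
    show ?case
    proof (cases "x = z")
      case True
      then have r: "r \<in> \<Lambda> x" "p \<preceq> r" using z at_mem at_gle by blast+
      then obtain y where y: "covers S x y" "y \<sqsubseteq> w" "bjoin x r (zero y) \<preceq> u"
        using step.IH by blast
      have "bjoin x p (zero y) \<preceq> bjoin x r (zero y)"
        using bjoin_mono[OF x step.prems zero_cover_mem[OF y(1)] r(1) zero_cover_mem[OF y(1)] r(2)]
          gle_refl mem_carrier[OF x zero_cover_mem[OF y(1)]] by blast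
      then show ?thesis using y gle_trans by blast
    next
      case False
      have zS: "z \<in> carrier S" "p \<in> \<Lambda> z" "p \<preceq> r" using z at_mem at_gle by blast+
      obtain y where y: "y \<in> carrier S" "covers S x y" "y \<sqsubseteq> z"
        using exists_upper_cover[OF S_lattice S_finite x zS(1) z(1) False] by blast
      then have "p \<in> \<Lambda> y" using mem_convex[of x z y p] step.prems zS x by (auto simp: S.covers_iff)
      then have "bjoin x p (zero y) \<preceq> u" using absorb y step.prems zS ru gle_trans by metis
      then show ?thesis using y z zS w S.le_trans by blast
    qed
  qed
qed

text \<open>The two first steps from \<open>x\<close> towards \<open>w\<close>, one for \<open>p\<close> and one for \<open>q\<close>, may lead to different
  covers \<open>y\<close> and \<open>z\<close> of \<open>x\<close>.  They are reconciled by \<open>e = zero y \<squnion> zero z\<close>, which equals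
  \<open>zero (y \<squnion> z)\<close> and therefore lies below every \<open>u \<in> \<Lambda> w\<close>.\<close>

lemma bjoin_least:
  assumes x: "x \<in> carrier S" and w: "w \<in> carrier S" and xw: "x \<sqsubseteq> w"
    and "p \<in> \<Lambda> x" "q \<in> \<Lambda> x" "u \<in> \<Lambda> w" "p \<preceq> u" "q \<preceq> u"
  shows "bjoin x p q \<preceq> u"
proof -
  have "\<forall>p q. p \<in> \<Lambda> x \<longrightarrow> q \<in> \<Lambda> x \<longrightarrow> p \<preceq> u \<longrightarrow> q \<preceq> u \<longrightarrow> bjoin x p q \<preceq> u"
    using S_lattice S_finite x w xw
  proof (induction x rule: interval_induct)
    case (step x)
    note x = step.hyps(1)
    show ?case
    proof (intro allI impI)
      fix p q assume pq: "p \<in> \<Lambda> x" "q \<in> \<Lambda> x" "p \<preceq> u" "q \<preceq> u"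
      show "bjoin x p q \<preceq> u"
      proof (cases "x = w")
        case True
        then show ?thesis using bjoin(4) x pq \<open>u \<in> \<Lambda> w\<close> by blast
      next
        case False
        obtain y where y: "covers S x y" "y \<sqsubseteq> w" and py: "bjoin x p (zero y) \<preceq> u"
          using first_step[OF x w step.hyps(2) False pq(1) \<open>u \<in> \<Lambda> w\<close> pq(3)] by blast
        obtain z where z: "covers S x z" "z \<sqsubseteq> w" and qz: "bjoin x q (zero z) \<preceq> u"
          using first_step[OF x w step.hyps(2) False pq(2) \<open>u \<in> \<Lambda> w\<close> pq(4)] by blast
        have yz: "y \<in> carrier S" "z \<in> carrier S" "x \<sqsubseteq> y" "x \<sqsubseteq> z" "x \<noteq> y" "x \<noteq> z"
          using y z by (auto simp: S.covers_iff)
        define t where "t = y \<squnion> z"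
        have t: "t \<in> carrier S" "y \<sqsubseteq> t" "z \<sqsubseteq> t" "t \<sqsubseteq> w"
          using yz y z w by (auto simp: t_def intro: S.join_left S.join_right S.join_le)
        define e where "e = bjoin x (zero y) (zero z)"
        note zy = zero_cover_mem[OF y(1)] and zz = zero_cover_mem[OF z(1)]
        note e' = bjoin[OF x zy zz, folded e_def]
        have ey: "e \<in> \<Lambda> y" using mem_up[of x y "zero y" e] x yz zy e' zero_mem by blast
        have ez: "e \<in> \<Lambda> z" using mem_up[of x z "zero z" e] x yz zz e' zero_mem by blast
        have et: "e \<in> \<Lambda> t" using mem_join yz ey ez by (simp add: t_def)
        have xt: "x \<sqsubseteq> t" using x yz t S.le_trans by blast
        \<comment> \<open>The element \<open>e\<close> witnesses that blocks \<open>x\<close> and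
          \<open>t\<close> overlap, so \<open>zero t\<close> lies in block \<open>x\<close>, where
          \<open>e\<close> is the least bound of \<open>zero y\<close> and
          \<open>zero z\<close>.\<close>
        have "zero t \<in> \<Lambda> x" using zero_mem_lower x t xt e' et by blast
        then have "e \<preceq> zero t"
          by (rule e'(4)) (use zero_mono yz t in blast)+
        moreover have "zero t \<preceq> u"
          using zero_mono[OF t(1) w t(4)] zero_gle[OF w \<open>u \<in> \<Lambda> w\<close>] gle_trans by blast
        ultimately have eu: "e \<preceq> u" using gle_trans by blast
        \<comment> \<open>After \<open>r\<close> has been raised to
          \<open>bjoin x r (zero v)\<close>, the join with \<open>e\<close> can be computed in block
          \<open>v\<close>, where the induction hypothesis applies. The instances are
          \<open>p\<close> with \<open>y\<close> and \<open>q\<close> with \<open>z\<close>.\<close>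
        have lift: "bjoin x r e \<preceq> u"
          if r: "r \<in> \<Lambda> x" and v: "covers S x v" "v \<sqsubseteq> w" "e \<in> \<Lambda> v" "zero v \<preceq> e"
            and ru: "bjoin x r (zero v) \<preceq> u" for r v
        proof -
          have vS: "v \<in> carrier S" "x \<sqsubseteq> v" "x \<noteq> v" using v by (auto simp: S.covers_iff)
          note r' = bjoin[OF x r zero_cover_mem[OF v(1)]]
          have rv: "bjoin x r (zero v) \<in> \<Lambda> v"
            by (rule bjoin_zero_mem[OF v(1) r])
          have "bjoin v (bjoin x r (zero v)) e \<preceq> u"
            using step.IH[OF vS(1) vS(2) vS(3) v(2)] rv v(3) ru eu by blast
          moreover have "bjoin v (bjoin x r (zero v)) e = bjoin x (bjoin x r (zero v)) e"
            using bjoin_agree[OF x vS(1,2) r'(1) rv e'(1) v(3)] by simp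
          moreover have "bjoin x r e \<preceq> bjoin x (bjoin x r (zero v)) e"
            using bjoin_mono[OF x r e'(1) r'(1) e'(1) r'(2)] gle_refl mem_carrier[OF x e'(1)] by blast
          ultimately show ?thesis using gle_trans by metis
        qed
        have pe: "bjoin x p e \<preceq> u" using lift[OF pq(1) y ey e'(2) py] .
        have qe: "bjoin x q e \<preceq> u" using lift[OF pq(2) z ez e'(3) qz] .
        note p' = bjoin[OF x pq(1) e'(1)] and q' = bjoin[OF x pq(2) e'(1)]
        \<comment> \<open>Although \<open>q\<close> was first raised towards \<open>z\<close>, after
          joining with \<open>e\<close> both elements lie in the same block
          \<open>y\<close>.\<close>
        have pey: "bjoin x p e \<in> \<Lambda> y" "bjoin x q e \<in> \<Lambda> y"
          using mem_up[of x y e] x yz ey e' p' q' by blast+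
        have "bjoin y (bjoin x p e) (bjoin x q e) \<preceq> u"
          using step.IH[OF yz(1,3,5) y(2)] pey pe qe by blast
        moreover have "bjoin y (bjoin x p e) (bjoin x q e) = bjoin x (bjoin x p e) (bjoin x q e)"
          using bjoin_agree[OF x yz(1,3) p'(1) pey(1) q'(1) pey(2)] by simp
        moreover have "bjoin x p q \<preceq> bjoin x (bjoin x p e) (bjoin x q e)"
          by (rule bjoin_mono[OF x pq(1,2) p'(1) q'(1) p'(2) q'(2)])
        ultimately show ?thesis using gle_trans by metis
      qed
    qed
  qed
  then show ?thesis using assms by blast
qed

text \<open>The element \<open>j\<close> arises from \<open>p\<close> by joining with the bottoms
  met along a chain of covers from \<open>x\<close> to \<open>t\<close>; each of them is below
  \<open>u\<close>, so \<open>bjoin_least\<close> keeps the joins below \<open>u\<close>. Minimality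
  ranges over all blocks above \<open>t\<close>, since upper bounds may live there.\<close>

lemma least_in_block:
  assumes x: "x \<in> carrier S" and t: "t \<in> carrier S" and xt: "x \<sqsubseteq> t" and "p \<in> \<Lambda> x"
  shows "\<exists>j\<in>\<Lambda> t. p \<preceq> j \<and> (\<forall>w\<in>carrier S. \<forall>u\<in>\<Lambda> w. t \<sqsubseteq> w \<longrightarrow> p \<preceq> u \<longrightarrow> j \<preceq> u)"
proof -
  have "\<forall>p\<in>\<Lambda> x. \<exists>j\<in>\<Lambda> t. p \<preceq> j \<and> (\<forall>w\<in>carrier S. \<forall>u\<in>\<Lambda> w. t \<sqsubseteq> w \<longrightarrow> p \<preceq> u \<longrightarrow> j \<preceq> u)"
    using S_lattice S_finite x t xt
  proof (induction x rule: interval_induct)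
    case (step x)
    show ?case
    proof (cases "x = t")
      case True
      then show ?thesis using gle_refl mem_carrier t by blast
    next
      case False
      then obtain y where y: "y \<in> carrier S" "covers S x y" "y \<sqsubseteq> t"
        using exists_upper_cover[OF S_lattice S_finite] step.hyps t by blast
      have xy: "x \<sqsubseteq> y" "x \<noteq> y" using y by (auto simp: S.covers_iff)
      show ?thesis
      proof
        fix p assume p: "p \<in> \<Lambda> x"
        note b = bjoin[OF step.hyps(1) p zero_cover_mem[OF y(2)]]
        have "bjoin x p (zero y) \<in> \<Lambda> y"
          by (rule bjoin_zero_mem[OF y(2) p])
        then obtain j where j: "j \<in> \<Lambda> t" "bjoin x p (zero y) \<preceq> j"
          "\<And>w u. w \<in> carrier S \<Longrightarrow> u \<in> \<Lambda> w \<Longrightarrow> t \<sqsubseteq> w \<Longrightarrow> bjoin x p (zero y) \<preceq> u \<Longrightarrow> j \<preceq> u"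
          using step.IH[OF y(1) xy y(3)] by blast
        have "j \<preceq> u" if u: "w \<in> carrier S" "u \<in> \<Lambda> w" "t \<sqsubseteq> w" "p \<preceq> u" for w u
        proof (rule j(3)[OF u(1-3)])
          have yw: "y \<sqsubseteq> w" "x \<sqsubseteq> w" using y xy u t step.hyps S.le_trans by blast+
          then have "zero y \<preceq> u"
            using zero_mono[OF y(1) u(1)] zero_gle[OF u(1,2)] gle_trans by blast
          then show "bjoin x p (zero y) \<preceq> u"
            using bjoin_least[OF step.hyps(1) u(1) yw(2) p zero_cover_mem[OF y(2)] u(2,4)] by blast
        qed
        moreover have "p \<preceq> j" using b j gle_trans by blast
        ultimately show "\<exists>j\<in>\<Lambda> t. p \<preceq> j \<and>
            (\<forall>w\<in>carrier S. \<forall>u\<in>\<Lambda> w. t \<sqsubseteq> w \<longrightarrow> p \<preceq> u \<longrightarrow> j \<preceq> u)"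
          using j(1) by blast
      qed
    qed
  qed
  then show ?thesis using assms by blast
qed

text \<open>Both elements are raised into the block of \<open>x \<squnion> y\<close> and joined
  there. An upper bound lies in a block above \<open>x\<close> and in one above \<open>y\<close>,
  hence in the block of their join, where it can be compared.\<close>

lemma glue_sup:
  assumes "x \<in> carrier S" "y \<in> carrier S" "p \<in> \<Lambda> x" "q \<in> \<Lambda> y"
  shows "\<exists>s\<in>\<Lambda> (x \<squnion> y). least G s (Upper G {p, q})"
proof -
  let ?t = "x \<squnion> y"
  have t: "?t \<in> carrier S" "x \<sqsubseteq> ?t" "y \<sqsubseteq> ?t"
    using assms S.join_left S.join_right by auto
  obtain i where i: "i \<in> \<Lambda> ?t" "p \<preceq> i"
    "\<And>w u. w \<in> carrier S \<Longrightarrow> u \<in> \<Lambda> w \<Longrightarrow> ?t \<sqsubseteq> w \<Longrightarrow> p \<preceq> u \<Longrightarrow> i \<preceq> u"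
    using least_in_block[OF assms(1) t(1) t(2) assms(3)] by blast
  obtain j where j: "j \<in> \<Lambda> ?t" "q \<preceq> j"
    "\<And>w u. w \<in> carrier S \<Longrightarrow> u \<in> \<Lambda> w \<Longrightarrow> ?t \<sqsubseteq> w \<Longrightarrow> q \<preceq> u \<Longrightarrow> j \<preceq> u"
    using least_in_block[OF assms(2) t(1) t(3) assms(4)] by blast
  note b = bjoin[OF t(1) i(1) j(1)]
  have "bjoin ?t i j \<preceq> u" if u: "p \<preceq> u" "q \<preceq> u" for u
  proof -
    obtain v w where vw: "v \<in> carrier S" "x \<sqsubseteq> v" "u \<in> \<Lambda> v" "w \<in> carrier S" "y \<sqsubseteq> w" "u \<in> \<Lambda> w"
      using mem_above[OF assms(1,3) u(1)] mem_above[OF assms(2,4) u(2)] by blast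
    have m: "v \<squnion> w \<in> carrier S" "u \<in> \<Lambda> (v \<squnion> w)" "?t \<sqsubseteq> v \<squnion> w"
      using vw mem_join assms
      by (auto intro!: S.join_le S.le_trans[OF _ S.join_left, of x v] S.le_trans[OF _ S.join_right, of y w])
    show ?thesis using bjoin_least[OF t(1) m(1) m(3) i(1) j(1) m(2)] i(3)[OF m(1,2,3) u(1)] j(3)[OF m(1,2,3) u(2)] by blast
  qed
  moreover have "p \<preceq> bjoin ?t i j" "q \<preceq> bjoin ?t i j" 
    using gle_trans[OF i(2) b(2)] gle_trans[OF j(2) b(3)] by blast+
  ultimately have "least G (bjoin ?t i j) (Upper G {p, q})"
    using gle_carrier by (intro least_UpperI) (auto simp: Upper_def)
  then show ?thesis using b by blast
qed

lemma glue_inf: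
  assumes "x \<in> carrier S" "y \<in> carrier S" "p \<in> \<Lambda> x" "q \<in> \<Lambda> y"
  shows "\<exists>s\<in>\<Lambda> (x \<sqinter> y). greatest G s (Lower G {p, q})"
  using glued_blocks.glue_sup[OF dual, of x y p q] assms by (simp add: glue_dual)

lemma glue_lattice: "lattice G"
proof
  show "\<exists>s. least G s (Upper G {p, q})" "\<exists>s. greatest G s (Lower G {p, q})"
    if "p \<in> carrier G" "q \<in> carrier G" for p q
    using that glue_sup glue_inf by (meson carrierE)+
qed

sublocale G: gorder_lattice G
  by (simp add: gorder_lattice_iff glue_lattice)


lemma bjoin_eq:
  assumes x: "x \<in> carrier S" and p: "p \<in> \<Lambda> x" "q \<in> \<Lambda> x"
  shows "p \<squnion>\<^bsub>Blk x\<^esub> q = p \<squnion>\<^bsub>G\<^esub> q"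
proof (rule G.join_eqI[symmetric])
  fix u assume u: "p \<preceq> u" "q \<preceq> u"
  obtain w where w: "w \<in> carrier S" "x \<sqsubseteq> w" "u \<in> \<Lambda> w" using mem_above[OF x p(1) u(1)] by blast
  show "bjoin x p q \<preceq> u" by (rule bjoin_least[OF x w(1,2) p w(3) u])
qed (use bjoin[OF x p] mem_carrier[OF x] p in auto)

lemma bmeet_eq:
  assumes "x \<in> carrier S" "p \<in> \<Lambda> x" "q \<in> \<Lambda> x"
  shows "p \<sqinter>\<^bsub>Blk x\<^esub> q = p \<sqinter>\<^bsub>G\<^esub> q"
  using glued_blocks.bjoin_eq[OF dual, of x p q] assms by (simp add: glue_dual)

lemma join_mem:
  assumes "x \<in> carrier S" "y \<in> carrier S" "p \<in> \<Lambda> x" "q \<in> \<Lambda> y"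
  shows "p \<squnion>\<^bsub>G\<^esub> q \<in> \<Lambda> (x \<squnion> y)"
proof -
  obtain s where s: "s \<in> \<Lambda> (x \<squnion> y)" "least G s (Upper G {p, q})"
    using glue_sup[OF assms] by blast
  have "least G (p \<squnion>\<^bsub>G\<^esub> q) (Upper G {p, q})"
    unfolding join_def using assms mem_carrier by (intro G.sup_of_two_least) auto
  then show ?thesis using G.least_unique s by blast
qed

subsection \<open>The order of the skeleton\<close>

text \<open>By \<open>join_mem\<close> the join of the two bottoms already lies in the block of
  \<open>x \<squnion> y\<close>, so it cannot be below that block's bottom without being equal to
  it.\<close>

lemma zero_join:
  assumes "x \<in> carrier S" "y \<in> carrier S"
  shows "zero (x \<squnion> y) = zero x \<squnion>\<^bsub>G\<^esub> zero y"
proof -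
  note c = mem_carrier[OF _ zero_mem]
  have xy: "x \<squnion> y \<in> carrier S" using assms by simp
  have "zero (x \<squnion> y) \<preceq> zero x \<squnion>\<^bsub>G\<^esub> zero y"
    using zero_gle[OF xy] join_mem[OF assms zero_mem zero_mem] assms by blast
  moreover have "zero x \<squnion>\<^bsub>G\<^esub> zero y \<preceq> zero (x \<squnion> y)"
    using assms xy c zero_mono S.join_left S.join_right by (auto intro!: G.join_le)
  ultimately show ?thesis using gle_carrier by blast
qed

text \<open>An up-set that contains the bottom is the whole block, which contradicts
  properness.\<close>

lemma zero_notin_cover:
  assumes "covers S x y"
  shows "zero x \<notin> \<Lambda> y"
proof
  assume a: "zero x \<in> \<Lambda> y"
  have xy: "x \<in> carrier S" "y \<in> carrier S" "x \<sqsubseteq> y" using assms by (auto simp: S.covers_iff)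
  have "\<Lambda> x \<subseteq> \<Lambda> y"
    using mem_up[OF xy zero_mem[OF xy(1)] a] zero_gle[OF xy(1)] by blast
  then show False using cover[OF assms] by blast
qed

lemma one_notin_cover: "covers S x y \<Longrightarrow> one y \<notin> \<Lambda> x"
  using glued_blocks.zero_notin_cover[OF dual, of y x] by (simp add: covers_dual S_lattice)

text \<open>If \<open>zero x\<close> is below \<open>zero y\<close>, then \<open>y\<close> and
  \<open>x \<squnion> y\<close> have the same bottom. Were they different indices, convexity would
  put \<open>zero y\<close> into the block of a cover of \<open>y\<close>. The order of the skeleton
  can thus be read off inside the glued lattice, as dissection does.\<close>

lemma zero_le_iff:
  assumes "x \<in> carrier S" "y \<in> carrier S"
  shows "zero x \<preceq> zero y \<longleftrightarrow> x \<sqsubseteq> y"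
proof
  assume le: "zero x \<preceq> zero y"
  let ?t = "x \<squnion> y"
  have t: "?t \<in> carrier S" "x \<sqsubseteq> ?t" "y \<sqsubseteq> ?t" using assms S.join_left S.join_right by auto
  have eq: "zero ?t = zero y"
    using zero_join[OF assms] le mem_carrier zero_mem assms by (simp add: G.join_absorb1)
  have "y = ?t"
  proof (rule ccontr)
    assume "y \<noteq> ?t"
    then obtain z where z: "z \<in> carrier S" "covers S y z" "z \<sqsubseteq> ?t"
      using exists_upper_cover[OF S_lattice S_finite assms(2) t(1,3)] by blast
    then have "zero y \<in> \<Lambda> z"
      using mem_convex[OF assms(2) t(1) z(1), of "zero y"] eq zero_mem[OF t(1)] zero_mem[OF assms(2)]
      by (simp add: S.covers_iff)
    then show False using zero_notin_cover z by blast
  qed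
  then show "x \<sqsubseteq> y" using t by simp
qed (use zero_mono assms in blast)

text \<open>The bottom of the least block is the least element; conversely, any block that contains
  the least element has the least bottom, and \<open>zero_le_iff\<close> makes its index
  least.\<close>

lemma glue_minimum: "has_minimum S \<longleftrightarrow> has_minimum G"
proof
  assume "has_minimum S"
  then obtain m where m: "m \<in> carrier S" "\<And>x. x \<in> carrier S \<Longrightarrow> m \<sqsubseteq> x"
    by (auto simp: has_minimum_def least_def)
  have "zero m \<preceq> p" if "p \<in> carrier G" for p
  proof -
    obtain x where x: "x \<in> carrier S" "p \<in> \<Lambda> x" using \<open>p \<in> carrier G\<close> by (rule carrierE)
    then show ?thesis using zero_mono[OF m(1) x(1) m(2)[OF x(1)]] zero_gle[OF x] gle_trans by blast
  qed
  then have "least G (zero m) (carrier G)"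
    using mem_carrier[OF m(1) zero_mem[OF m(1)]] by (auto simp: least_def)
  then show "has_minimum G" by (auto simp: has_minimum_def)
next
  assume "has_minimum G"
  then obtain p where p: "p \<in> carrier G" "\<And>q. q \<in> carrier G \<Longrightarrow> p \<preceq> q"
    by (auto simp: has_minimum_def least_def)
  obtain x where x: "x \<in> carrier S" "p \<in> \<Lambda> x" using p(1) by (rule carrierE)
  have "zero x \<preceq> zero y" if "y \<in> carrier S" for y
    using zero_gle[OF x] p(2)[OF mem_carrier[OF that zero_mem[OF that]]] gle_trans by blast
  then have "least S x (carrier S)"
    using x zero_le_iff by (auto simp: least_def)
  then show "has_minimum S" by (auto simp: has_minimum_def)
qed

subsection \<open>Finiteness\<close>

text \<open>By \<open>mem_between\<close> an interval is covered by the finite blocks of a finite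
  interval of indices.\<close>

lemma glue_locally_finite: "locally_finite G"
  unfolding locally_finite_def
proof (intro ballI)
  fix p q assume "p \<in> carrier G" "q \<in> carrier G"
  show "finite \<lbrace>p..q\<rbrace>\<^bsub>G\<^esub>"
  proof (cases "p \<preceq> q")
    case True
    obtain x where x: "x \<in> carrier S" "p \<in> \<Lambda> x" using \<open>p \<in> carrier G\<close> by (rule carrierE)
    obtain w where w: "w \<in> carrier S" "x \<sqsubseteq> w" "q \<in> \<Lambda> w" using mem_above[OF x True] by blast
    have "\<lbrace>p..q\<rbrace>\<^bsub>G\<^esub> \<subseteq> (\<Union>z\<in>\<lbrace>x..w\<rbrace>. \<Lambda> z)"
    proof
      fix r assume "r \<in> \<lbrace>p..q\<rbrace>\<^bsub>G\<^esub>"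
      then have "p \<preceq> r" "r \<preceq> q" by (auto simp: at_least_at_most_def)
      from mem_between[OF x(1) w(1,2) x(2) w(3) this]
      show "r \<in> (\<Union>z\<in>\<lbrace>x..w\<rbrace>. \<Lambda> z)" by (auto simp: at_least_at_most_def)
    qed
    moreover have "finite (\<Union>z\<in>\<lbrace>x..w\<rbrace>. \<Lambda> z)"
      using S_finite x w block by (auto simp: locally_finite_def at_least_at_most_def)
    ultimately show ?thesis by (rule finite_subset)
  next
    case False
    then have "\<lbrace>p..q\<rbrace>\<^bsub>G\<^esub> = {}" using gle_trans by (auto simp: at_least_at_most_def)
    then show ?thesis by simp
  qed
qed

text \<open>The tree of covers whose blocks contain \<open>p\<close> branches finitely, and its
  depth is bounded: passing to a cover loses at least \<open>zero x\<close> from the finite set of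
  elements of the block below \<open>p\<close>.\<close>

lemma finite_support_above:
  assumes "x \<in> carrier S" "p \<in> \<Lambda> x"
  shows "finite {z \<in> carrier S. x \<sqsubseteq> z \<and> p \<in> \<Lambda> z}"
  using assms
proof (induction "card {q \<in> \<Lambda> x. q \<preceq> p}" arbitrary: x rule: less_induct)
  case less
  let ?Y = "{y. covers S x y \<and> p \<in> \<Lambda> y}"
  have "finite {z \<in> carrier S. y \<sqsubseteq> z \<and> p \<in> \<Lambda> z}" if y: "y \<in> ?Y" for y
  proof (rule less.hyps)
    have xy: "x \<in> carrier S" "y \<in> carrier S" "x \<sqsubseteq> y" "p \<in> \<Lambda> y"
      using y by (auto simp: S.covers_iff)
    show "y \<in> carrier S" "p \<in> \<Lambda> y" by (fact xy)+
    have "{q \<in> \<Lambda> y. q \<preceq> p} \<subseteq> {q \<in> \<Lambda> x. q \<preceq> p}"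
      using mem_down[OF xy(1-3) less.prems(2) xy(4)] by blast
    moreover have "zero x \<in> {q \<in> \<Lambda> x. q \<preceq> p}" "zero x \<notin> \<Lambda> y"
      using zero_mem zero_gle less.prems zero_notin_cover y by auto
    ultimately have "{q \<in> \<Lambda> y. q \<preceq> p} \<subset> {q \<in> \<Lambda> x. q \<preceq> p}" by blast
    then show "card {q \<in> \<Lambda> y. q \<preceq> p} < card {q \<in> \<Lambda> x. q \<preceq> p}"
      using block less.prems(1) by (intro psubset_card_mono) auto
  qed
  moreover have "finite ?Y"
    using skeleton less.prems(1) by (auto simp: lffc_lattice_def finite_covers_def)
  ultimately have "finite (insert x (\<Union>y\<in>?Y. {z \<in> carrier S. y \<sqsubseteq> z \<and> p \<in> \<Lambda> z}))"
    by blast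
  moreover have "{z \<in> carrier S. x \<sqsubseteq> z \<and> p \<in> \<Lambda> z} \<subseteq>
    insert x (\<Union>y\<in>?Y. {z \<in> carrier S. y \<sqsubseteq> z \<and> p \<in> \<Lambda> z})"
  proof
    fix z assume z: "z \<in> {z \<in> carrier S. x \<sqsubseteq> z \<and> p \<in> \<Lambda> z}"
    show "z \<in> insert x (\<Union>y\<in>?Y. {z \<in> carrier S. y \<sqsubseteq> z \<and> p \<in> \<Lambda> z})"
    proof (cases "x = z")
      case False
      then obtain y where y: "y \<in> carrier S" "covers S x y" "y \<sqsubseteq> z"
        using exists_upper_cover[OF S_lattice S_finite less.prems(1)] z by blast
      then have "p \<in> \<Lambda> y"
        using mem_convex[of x z y p] z less.prems by (auto simp: S.covers_iff)
      then show ?thesis using y z by blast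
    qed simp
  qed
  ultimately show ?case by (rule rev_finite_subset)
qed

lemma finite_support_below:
  "x \<in> carrier S \<Longrightarrow> p \<in> \<Lambda> x \<Longrightarrow> finite {z \<in> carrier S. z \<sqsubseteq> x \<and> p \<in> \<Lambda> z}"
  using glued_blocks.finite_support_above[OF dual, of x p] by simp

text \<open>Every index \<open>z\<close> of the support lies below \<open>x \<squnion> z\<close>,
  which is one of the finitely many indices above \<open>x\<close>.\<close>

lemma finite_support: "finite {z \<in> carrier S. p \<in> \<Lambda> z}"
proof (cases "p \<in> carrier G")
  case True
  then obtain x where x: "x \<in> carrier S" "p \<in> \<Lambda> x" by (rule carrierE)
  let ?T = "{t \<in> carrier S. x \<sqsubseteq> t \<and> p \<in> \<Lambda> t}"
  have "{z \<in> carrier S. p \<in> \<Lambda> z} \<subseteq> (\<Union>t\<in>?T. {z \<in> carrier S. z \<sqsubseteq> t \<and> p \<in> \<Lambda> z})"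
  proof
    fix z assume z: "z \<in> {z \<in> carrier S. p \<in> \<Lambda> z}"
    then have "x \<squnion> z \<in> ?T" "z \<sqsubseteq> x \<squnion> z"
      using x mem_join S.join_left S.join_right by auto
    then show "z \<in> (\<Union>t\<in>?T. {z \<in> carrier S. z \<sqsubseteq> t \<and> p \<in> \<Lambda> z})" using z by blast
  qed
  moreover have "finite (\<Union>t\<in>?T. {z \<in> carrier S. z \<sqsubseteq> t \<and> p \<in> \<Lambda> z})"
    using finite_support_above[OF x] finite_support_below by blast
  ultimately show ?thesis by (rule finite_subset)
next
  case False
  then have "{z \<in> carrier S. p \<in> \<Lambda> z} = {}" using mem_carrier by blast
  then show ?thesis by (simp only: finite.emptyI)
qed

text \<open>A path may contain trivial steps. The invariant is that an element of the path below
  \<open>q\<close> is still \<open>p\<close>, unless a block comparing \<open>p\<close> with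
  \<open>q\<close> has been met.\<close>

lemma cover_at:
  assumes "covers G p q"
  shows "\<exists>z. at z p q"
proof -
  have pq: "p \<preceq> q" "p \<noteq> q" using assms by (auto simp: G.covers_iff)
  then have "(\<lambda>p q. \<exists>x. at x p q)\<^sup>*\<^sup>* p q" by (simp add: gle_iff)
  then have "s \<preceq> q \<longrightarrow> s = p \<or> (\<exists>z. at z p q)" if "s = q" for s
    unfolding that
  proof (rule rtranclp_induct[where P = "\<lambda>s. s \<preceq> q \<longrightarrow> s = p \<or> (\<exists>z. at z p q)"])
    fix r s assume r: "\<exists>x. at x r s" "r \<preceq> q \<longrightarrow> r = p \<or> (\<exists>z. at z p q)"
    show "s \<preceq> q \<longrightarrow> s = p \<or> (\<exists>z. at z p q)"
    proof
      assume s: "s \<preceq> q"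
      obtain x where x: "at x r s" using r by blast
      then have "r \<preceq> q" using s at_gle gle_trans by blast
      then consider "r = p" | "\<exists>z. at z p q" using r by blast
      then show "s = p \<or> (\<exists>z. at z p q)"
      proof cases
        case 1
        then have "s = p \<or> s = q"
          using assms x s at_gle gle_carrier unfolding G.covers_iff by blast
        then show ?thesis using 1 x by blast
      qed blast
    qed
  qed simp
  from this[OF refl] show ?thesis using pq gle_refl[of q] gle_carrier[OF pq(1)] by simp
qed

lemma finite_upper_covers: "p \<in> carrier G \<Longrightarrow> finite {q. covers G p q}"
proof -
  assume p: "p \<in> carrier G"
  have "{q. covers G p q} \<subseteq> (\<Union>z\<in>{z \<in> carrier S. p \<in> \<Lambda> z}. \<Lambda> z)"
  proof
    fix q assume "q \<in> {q. covers G p q}"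
    then obtain z where "at z p q" using cover_at[of p q] by blast
    then show "q \<in> (\<Union>z\<in>{z \<in> carrier S. p \<in> \<Lambda> z}. \<Lambda> z)" using at_mem[of z p q] by blast
  qed
  moreover have "finite (\<Union>z\<in>{z \<in> carrier S. p \<in> \<Lambda> z}. \<Lambda> z)"
    using finite_support block by auto
  ultimately show ?thesis by (rule finite_subset)
qed

lemma finite_lower_covers: "p \<in> carrier G \<Longrightarrow> finite {q. covers G q p}"
  using glued_blocks.finite_upper_covers[OF dual, of p]
  by (simp add: glue_dual covers_dual glue_lattice)

subsection \<open>Modularity\<close>

lemma block_covers:
  assumes t: "t \<in> carrier S" "p \<in> \<Lambda> t" "q \<in> \<Lambda> t"
  shows "covers (Blk t) p q \<longleftrightarrow> covers G p q"
proof -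
  interpret B: gorder_lattice "Blk t" by (rule block_lattice[OF t(1)])
  have "(\<forall>z\<in>\<Lambda> t. p \<sqsubseteq>\<^bsub>Blk t\<^esub> z \<longrightarrow> z \<sqsubseteq>\<^bsub>Blk t\<^esub> q \<longrightarrow> z = p \<or> z = q) \<longleftrightarrow>
    (\<forall>z\<in>carrier G. p \<preceq> z \<longrightarrow> z \<preceq> q \<longrightarrow> z = p \<or> z = q)"
  proof
    assume a: "\<forall>z\<in>\<Lambda> t. p \<sqsubseteq>\<^bsub>Blk t\<^esub> z \<longrightarrow> z \<sqsubseteq>\<^bsub>Blk t\<^esub> q \<longrightarrow> z = p \<or> z = q"
    show "\<forall>z\<in>carrier G. p \<preceq> z \<longrightarrow> z \<preceq> q \<longrightarrow> z = p \<or> z = q"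
    proof (intro ballI impI)
      fix z assume z: "p \<preceq> z" "z \<preceq> q"
      then have "z \<in> \<Lambda> t" using mem_convex_glue[OF t] by simp
      then show "z = p \<or> z = q" using a z t at_iff[OF t(1)] by simp
    qed
  next
    assume a: "\<forall>z\<in>carrier G. p \<preceq> z \<longrightarrow> z \<preceq> q \<longrightarrow> z = p \<or> z = q"
    show "\<forall>z\<in>\<Lambda> t. p \<sqsubseteq>\<^bsub>Blk t\<^esub> z \<longrightarrow> z \<sqsubseteq>\<^bsub>Blk t\<^esub> q \<longrightarrow> z = p \<or> z = q"
      using a t mem_carrier[OF t(1)] at_iff[OF t(1)] by simp
  qed
  then show ?thesis
    unfolding B.covers_iff G.covers_iff
    using t mem_carrier[OF t(1)] at_iff[OF t(1)] by simp
qed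

lemma glue_covers_join:
  assumes ra: "covers G r a" and rb: "covers G r b" and ab: "a \<noteq> b"
  shows "covers G a (a \<squnion>\<^bsub>G\<^esub> b)"
proof -
  obtain x y where x: "at x r a" and y: "at y r b" using cover_at ra rb by blast
  define t where "t = x \<squnion> y"
  have a: "at t r a" using at_join[of y r x a] x y at_mem join_comm[of S x y] by (simp add: t_def)
  have b: "at t r b" using at_join[of x r y b] x y at_mem by (simp add: t_def)
  have t: "t \<in> carrier S" "r \<in> \<Lambda> t" "a \<in> \<Lambda> t" "b \<in> \<Lambda> t" using a b at_mem by blast+
  have "\<not> b \<preceq> a"
    using ra rb ab by (auto simp: G.covers_iff)
  then have "covers (Blk t) a (bjoin t a b)"
    using modular_covers_join[of "Blk t" r b a] block[OF t(1)] rb block_covers[OF t(1,2,4)]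
      t at_iff[OF t(1)] a by (auto simp: block_le_def)
  then show ?thesis
    using block_covers[OF t(1,3) bjoin(1)[OF t(1,3,4)]] bjoin_eq[OF t(1,3,4)] by simp
qed

lemma glue_covers_meet:
  "covers G a r \<Longrightarrow> covers G b r \<Longrightarrow> a \<noteq> b \<Longrightarrow> covers G (a \<sqinter>\<^bsub>G\<^esub> b) a"
  using glued_blocks.glue_covers_join[OF dual, of r a b]
  by (simp add: glue_dual covers_dual glue_lattice)

lemma glue_modular: "modular_lattice G"
  by (rule modular_latticeI_covers[OF glue_lattice glue_locally_finite])
    (fact glue_covers_join glue_covers_meet)+

theorem glue_modular_lffc: "modular_lffc_lattice G"
  using glue_modular glue_lattice glue_locally_finite finite_upper_covers finite_lower_covers
  by (simp add: modular_lffc_lattice_def lffc_lattice_def finite_covers_def)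

subsection \<open>The blocks of the glued lattice\<close>

lemma block_interval:
  assumes x: "x \<in> carrier S"
  shows "\<Lambda> x = \<lbrace>zero x..one x\<rbrace>\<^bsub>G\<^esub>"
proof (rule Set.set_eqI)
  fix p
  show "p \<in> \<Lambda> x \<longleftrightarrow> p \<in> \<lbrace>zero x..one x\<rbrace>\<^bsub>G\<^esub>"
    using mem_carrier[OF x, of p] zero_gle[OF x, of p] gle_one[OF x, of p]
      mem_convex_glue[OF x zero_mem[OF x] one_mem[OF x], of p]
    unfolding at_least_at_most_def by blast
qed

lemma block_complemented:
  assumes x: "x \<in> carrier S"
  shows "complemented_between G (zero x) (one x)"
  unfolding complemented_between_def block_interval[OF x, symmetric]
proof (intro conjI ballI)
  fix a assume a: "a \<in> \<Lambda> x"
  then obtain b where "b \<in> \<Lambda> x" "bjoin x a b = one x" "a \<sqinter>\<^bsub>Blk x\<^esub> b = zero x"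
    using block[OF x] unfolding complemented_lattice_def by blast
  then show "\<exists>b\<in>\<Lambda> x. a \<squnion>\<^bsub>G\<^esub> b = one x \<and> a \<sqinter>\<^bsub>G\<^esub> b = zero x"
    using bjoin_eq[OF x a] bmeet_eq[OF x a] by auto
qed (use x zero_mem one_mem mem_carrier zero_gle in auto)

text \<open>The block in which \<open>c\<close> is covered can be moved down to an index
  \<open>m\<close> below \<open>x\<close>. If \<open>m\<close> were smaller than \<open>x\<close>,
  convexity would put \<open>one x\<close> into the block of a lower cover of
  \<open>x\<close>.\<close>

lemma lower_cover_of_one:
  assumes x: "x \<in> carrier S" and c: "covers G c (one x)"
  shows "c \<in> \<Lambda> x"
proof -
  obtain w where w: "at w c (one x)" using cover_at[OF c] by blast
  define m where "m = x \<sqinter> w"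
  have m: "at m c (one x)" using at_meet[OF x one_mem[OF x] w] by (simp add: m_def)
  have mx: "m \<in> carrier S" "m \<sqsubseteq> x" using x at_mem[OF w] S.meet_left by (auto simp: m_def)
  have "x = m"
  proof (rule ccontr)
    assume "x \<noteq> m"
    then obtain y where y: "y \<in> carrier S" "covers S y x" "m \<sqsubseteq> y"
      using exists_lower_cover[OF S_lattice S_finite x mx] by blast
    then have "one x \<in> \<Lambda> y"
      using mem_convex[OF mx(1) x y(1)] at_mem[OF m] one_mem[OF x] by (auto simp: S.covers_iff)
    then show False using one_notin_cover y by blast
  qed
  then show ?thesis using m at_mem by blast
qed

lemma upper_cover_of_zero: "x \<in> carrier S \<Longrightarrow> covers G (zero x) c \<Longrightarrow> c \<in> \<Lambda> x"
  using glued_blocks.lower_cover_of_one[OF dual, of x c]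
  by (simp add: glue_dual covers_dual glue_lattice)

text \<open>The support is finite, nonempty and closed under joins.\<close>

lemma greatest_support:
  assumes "p \<in> carrier G"
  shows "\<exists>x\<in>carrier S. p \<in> \<Lambda> x \<and> (\<forall>z\<in>carrier S. p \<in> \<Lambda> z \<longrightarrow> z \<sqsubseteq> x)"
proof -
  obtain x where x: "x \<in> carrier S" "p \<in> \<Lambda> x" using assms by (rule carrierE)
  have "A \<subseteq> {z \<in> carrier S. p \<in> \<Lambda> z} \<Longrightarrow> \<exists>x\<in>carrier S. p \<in> \<Lambda> x \<and> (\<forall>z\<in>A. z \<sqsubseteq> x)"
    if "finite A" for A
    using that
  proof (induction A rule: finite_induct)
    case empty
    then show ?case using x by blast
  next
    case (insert y A)
    then obtain u where u: "u \<in> carrier S" "p \<in> \<Lambda> u" "\<forall>z\<in>A. z \<sqsubseteq> u" by blast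
    have y: "y \<in> carrier S" "p \<in> \<Lambda> y" using insert.prems by auto
    have "z \<sqsubseteq> y \<squnion> u" if "z \<in> insert y A" for z
      using that u y insert.prems S.join_left[of y u] S.join_right[of y u]
        S.le_trans[of z u "y \<squnion> u"] by auto
    then show ?case using u y mem_join by (intro bexI[of _ "y \<squnion> u"]) auto
  qed
  from this[OF finite_support subset_refl] show ?thesis by blast
qed

theorem lattice_blocks_glue: "lattice_blocks G = \<Lambda> ` carrier S"
proof -
  note compl = complemented_interval_between[OF glue_lattice]
  have sub: "complemented_interval G (\<Lambda> x)" if "x \<in> carrier S" for x
    using compl[of "\<Lambda> x"] block_interval[OF that] block_complemented[OF that] by blast
  have "\<Lambda> x \<in> lattice_blocks G" if x: "x \<in> carrier S" for x
  proof -
    have "B = \<Lambda> x" if B: "complemented_interval G B" "\<Lambda> x \<subseteq> B" for B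
    proof -
      obtain u v where uv: "complemented_between G u v" "B = \<lbrace>u..v\<rbrace>\<^bsub>G\<^esub>" using B compl by blast
      note zc = mem_carrier[OF x zero_mem[OF x]] and oc = mem_carrier[OF x one_mem[OF x]]
      have le: "u \<preceq> zero x" "one x \<preceq> v" "zero x \<preceq> one x"
        using B(2) uv(2) zero_mem[OF x] one_mem[OF x] zero_gle[OF x]
        by (auto simp: at_least_at_most_def)
      have uv': "u \<in> carrier G" "v \<in> carrier G" using uv by (auto simp: complemented_between_def)
      \<comment> \<open>A larger interval is excluded one end at a time. The covers of
        \<open>zero x\<close> all lie in \<open>\<Lambda> x\<close>, so \<open>v\<close> cannot
        exceed \<open>one x\<close>; then the lower covers of \<open>one x\<close> determine
        \<open>u\<close>.\<close>
      have "complemented_between G (zero x) v"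
        using complemented_between_sub[OF glue_modular uv(1) zc uv'(2) le(1)] le uv' gle_trans gle_refl
        by blast
      then have "v \<preceq> one x"
        using complemented_between_top_le[OF glue_lattice glue_locally_finite _ oc le(3)]
          upper_cover_of_zero[OF x] gle_one[OF x] by blast
      then have v: "v = one x" using le by (simp add: G.le_antisym uv' oc)
      then have "zero x \<preceq> u"
        using complemented_between_bot_ge[OF glue_lattice glue_locally_finite uv(1) zc]
          lower_cover_of_one[OF x] zero_gle[OF x] le by blast
      then have "u = zero x" using le by (simp add: G.le_antisym uv' zc)
      then show ?thesis using v uv block_interval[OF x] by simp
    qed
    then show ?thesis using sub[OF x] by (auto simp: lattice_blocks_def)
  qed
  moreover have "B \<in> \<Lambda> ` carrier S" if B: "B \<in> lattice_blocks G" for B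
  proof -
    obtain u v where uv: "complemented_between G u v" "B = \<lbrace>u..v\<rbrace>\<^bsub>G\<^esub>"
      using B compl by (auto simp: lattice_blocks_def)
    have uv': "u \<in> carrier G" "v \<in> carrier G" using uv by (auto simp: complemented_between_def)
    obtain x where x: "x \<in> carrier S" "u \<in> \<Lambda> x" "\<And>z. z \<in> carrier S \<Longrightarrow> u \<in> \<Lambda> z \<Longrightarrow> z \<sqsubseteq> x"
      using greatest_support[OF uv'(1)] by blast
    \<comment> \<open>Some block \<open>z\<close> compares \<open>u\<close> with \<open>t\<close>.
      As \<open>x\<close> is the greatest index whose block contains \<open>u\<close>, the
      comparison moves up from \<open>z\<close> to \<open>x\<close>.\<close>
    have "t \<preceq> one x" if t: "covers G u t" for t
    proof -
      obtain z where z: "at z u t" using cover_at[OF t] by blast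
      then have "at x u t" using at_up[OF z x(1)] x at_mem by blast
      then show ?thesis using at_mem gle_one by blast
    qed
    then have "v \<preceq> one x"
      using complemented_between_top_le[OF glue_lattice glue_locally_finite uv(1)]
        mem_carrier[OF x(1) one_mem[OF x(1)]] gle_one[OF x(1,2)] by blast
    then have "B \<subseteq> \<Lambda> x"
      unfolding uv block_interval[OF x(1)] at_least_at_most_def
      using gle_trans[OF zero_gle[OF x(1,2)]] gle_trans[OF _ \<open>v \<preceq> one x\<close>] by blast
    then have "\<Lambda> x = B" using B sub[OF x(1)] by (auto simp: lattice_blocks_def)
    then show ?thesis using x by blast
  qed
  ultimately show ?thesis by blast
qed

lemma mem_eq_iff: "x \<in> carrier S \<Longrightarrow> y \<in> carrier S \<Longrightarrow> \<Lambda> x = \<Lambda> y \<longleftrightarrow> x = y"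
proof
  assume x: "x \<in> carrier S" and y: "y \<in> carrier S" and eq: "\<Lambda> x = \<Lambda> y"
  have "zero x \<preceq> zero y" "zero y \<preceq> zero x"
    using zero_gle[OF x, of "zero y"] zero_gle[OF y, of "zero x"] zero_mem[OF x] zero_mem[OF y] eq
    by auto
  then show "x = y" using zero_le_iff x y S.le_antisym by blast
qed simp

end

section \<open>The sum of a modular connected system\<close>

text \<open>The copy of a block inside the quotient. For this family of copies \<open>glue\<close>
  yields exactly the sum.\<close>

definition mc_blk :: "('s, 'b) mc_data \<Rightarrow> 's \<Rightarrow> ('s \<times> 'b) set gorder" where
  "mc_blk C x = \<lparr>carrier = sum_block C x, eq = (=), le = sum_le_at C x\<rparr>"

context mc_system
begin

abbreviation "S \<equiv> skel C"
abbreviation "F \<equiv> fil C"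
abbreviation "I \<equiv> idl C"
abbreviation "L \<equiv> block C"
abbreviation conn' (\<open>\<phi>\<close>) where "conn' \<equiv> conn C"
abbreviation tol' (\<open>\<gamma>\<close>) where "tol' \<equiv> tol C"
abbreviation "R \<equiv> glue_rel C"

sublocale S: gorder_lattice S
  using MC1 by (simp add: lffc_lattice_def gorder_lattice_iff)

lemma L_lattice: "x \<in> carrier S \<Longrightarrow> gorder_lattice (L x)"
  using MC2 by (simp add: modular_lattice_def gorder_lattice_iff)

lemma tol_refl: "x \<in> carrier S \<Longrightarrow> \<gamma> x x"
  and tol_sym: "x \<in> carrier S \<Longrightarrow> y \<in> carrier S \<Longrightarrow> \<gamma> x y \<Longrightarrow> \<gamma> y x"
  and tol_join: "\<lbrakk>a \<in> carrier S; b \<in> carrier S; c \<in> carrier S; d \<in> carrier S; \<gamma> a b; \<gamma> c d\<rbrakk> \<Longrightarrow>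
    \<gamma> (a \<squnion>\<^bsub>S\<^esub> c) (b \<squnion>\<^bsub>S\<^esub> d)"
  and tol_meet: "\<lbrakk>a \<in> carrier S; b \<in> carrier S; c \<in> carrier S; d \<in> carrier S; \<gamma> a b; \<gamma> c d\<rbrakk> \<Longrightarrow>
    \<gamma> (a \<sqinter>\<^bsub>S\<^esub> c) (b \<sqinter>\<^bsub>S\<^esub> d)"
  using tolerance by (auto simp: tolerance_def)

text \<open>Joining the pair \<open>p\<close>, \<open>q\<close> with the reflexive pairs of
  \<open>u\<close> and \<open>v\<close> relates both to \<open>q\<close>; the meet of the two
  resulting pairs relates \<open>u\<close> to \<open>v\<close>.\<close>

lemma tol_convex:
  assumes c: "p \<in> carrier S" "q \<in> carrier S" "u \<in> carrier S" "v \<in> carrier S"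
    and le: "p \<sqsubseteq>\<^bsub>S\<^esub> u" "u \<sqsubseteq>\<^bsub>S\<^esub> q" "p \<sqsubseteq>\<^bsub>S\<^esub> v" "v \<sqsubseteq>\<^bsub>S\<^esub> q" and pq: "\<gamma> p q"
  shows "\<gamma> u v"
proof -
  have "\<gamma> (p \<squnion>\<^bsub>S\<^esub> u) (q \<squnion>\<^bsub>S\<^esub> u)" "\<gamma> (p \<squnion>\<^bsub>S\<^esub> v) (q \<squnion>\<^bsub>S\<^esub> v)"
    using c pq tol_refl by (auto intro: tol_join)
  then have "\<gamma> u q" "\<gamma> v q" using c le by (simp_all add: S.join_absorb1 S.join_absorb2)
  then have "\<gamma> (u \<sqinter>\<^bsub>S\<^esub> q) (q \<sqinter>\<^bsub>S\<^esub> v)" using c tol_sym tol_meet by blast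
  then show ?thesis using c le by (simp add: S.meet_absorb1 S.meet_absorb2)
qed

lemma tol_join_right:
  assumes "x \<in> carrier S" "y \<in> carrier S" "\<gamma> x y"
  shows "le_tol C x (x \<squnion>\<^bsub>S\<^esub> y)" "le_tol C y (x \<squnion>\<^bsub>S\<^esub> y)"
proof -
  have "\<gamma> (x \<squnion>\<^bsub>S\<^esub> x) (x \<squnion>\<^bsub>S\<^esub> y)" "\<gamma> (y \<squnion>\<^bsub>S\<^esub> y) (x \<squnion>\<^bsub>S\<^esub> y)"
    using assms tol_refl tol_sym by (auto intro!: tol_join)
  then show "le_tol C x (x \<squnion>\<^bsub>S\<^esub> y)" "le_tol C y (x \<squnion>\<^bsub>S\<^esub> y)"
    using assms S.join_left S.join_right by (auto simp: le_tol_def S.join_absorb1)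
qed

lemma tol_meet_left:
  assumes "x \<in> carrier S" "y \<in> carrier S" "\<gamma> x y"
  shows "le_tol C (x \<sqinter>\<^bsub>S\<^esub> y) x" "le_tol C (x \<sqinter>\<^bsub>S\<^esub> y) y"
proof -
  have "\<gamma> (x \<sqinter>\<^bsub>S\<^esub> y) (x \<sqinter>\<^bsub>S\<^esub> x)" "\<gamma> (x \<sqinter>\<^bsub>S\<^esub> y) (y \<sqinter>\<^bsub>S\<^esub> y)"
    using assms tol_refl tol_sym by (auto intro!: tol_meet)
  then show "le_tol C (x \<sqinter>\<^bsub>S\<^esub> y) x" "le_tol C (x \<sqinter>\<^bsub>S\<^esub> y) y"
    using assms S.meet_left S.meet_right by (auto simp: le_tol_def S.meet_absorb1)
qed

lemma tol_span:
  assumes "x \<in> carrier S" "y \<in> carrier S" "\<gamma> x y"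
  shows "\<gamma> (x \<sqinter>\<^bsub>S\<^esub> y) (x \<squnion>\<^bsub>S\<^esub> y)"
proof -
  have "\<gamma> (x \<sqinter>\<^bsub>S\<^esub> y) ((x \<squnion>\<^bsub>S\<^esub> y) \<sqinter>\<^bsub>S\<^esub> (x \<squnion>\<^bsub>S\<^esub> y))"
    using tol_join_right[OF assms] assms by (intro tol_meet) (auto simp: le_tol_def)
  then show ?thesis using assms by (simp add: S.meet_absorb1)
qed

subsection \<open>Connections\<close>

lemma le_tolD: "le_tol C x y \<Longrightarrow> x \<in> carrier S \<and> y \<in> carrier S \<and> x \<sqsubseteq>\<^bsub>S\<^esub> y \<and> \<gamma> x y"
  by (simp add: le_tol_def)

lemma fil_sub: "le_tol C x y \<Longrightarrow> a \<in> F x y \<Longrightarrow> a \<in> carrier (L x)"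
  using MC3[of x y] by (auto simp: lattice_filter_def)

lemma idl_sub: "le_tol C x y \<Longrightarrow> a \<in> I x y \<Longrightarrow> a \<in> carrier (L y)"
  using MC3[of x y] by (auto simp: lattice_ideal_def)

lemma fil_nonempty: "le_tol C x y \<Longrightarrow> F x y \<noteq> {}"
  using MC3 by (auto simp: lattice_filter_def)

lemma fil_up: "le_tol C x y \<Longrightarrow> a \<in> F x y \<Longrightarrow> b \<in> carrier (L x) \<Longrightarrow> a \<sqsubseteq>\<^bsub>L x\<^esub> b \<Longrightarrow> b \<in> F x y"
  using MC3 by (simp add: lattice_filter_def)

lemma idl_down: "le_tol C x y \<Longrightarrow> a \<in> I x y \<Longrightarrow> b \<in> carrier (L y) \<Longrightarrow> b \<sqsubseteq>\<^bsub>L y\<^esub> a \<Longrightarrow> b \<in> I x y"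
  using MC3 by (simp add: lattice_ideal_def)

lemma conn_idl: "a \<in> F x y \<Longrightarrow> \<phi> x y a \<in> I x y"
  by (simp add: idl_def)

lemma conn_L: "le_tol C x y \<Longrightarrow> a \<in> F x y \<Longrightarrow> \<phi> x y a \<in> carrier (L y)"
  using conn_idl idl_sub by blast

lemma conn_iso:
  "le_tol C x y \<Longrightarrow> lattice_iso ((L x)\<lparr>carrier := F x y\<rparr>) ((L y)\<lparr>carrier := I x y\<rparr>) (\<phi> x y)"
  using MC3 by blast

lemma conn_inj: "le_tol C x y \<Longrightarrow> a \<in> F x y \<Longrightarrow> b \<in> F x y \<Longrightarrow> \<phi> x y a = \<phi> x y b \<Longrightarrow> a = b"
  using lattice_iso_orderD(3)[OF conn_iso] by (auto simp: bij_betw_def dest: inj_onD)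

lemma conn_le: "le_tol C x y \<Longrightarrow> a \<in> F x y \<Longrightarrow> b \<in> F x y \<Longrightarrow>
    \<phi> x y a \<sqsubseteq>\<^bsub>L y\<^esub> \<phi> x y b \<longleftrightarrow> a \<sqsubseteq>\<^bsub>L x\<^esub> b"
  using lattice_iso_orderD(4)[OF conn_iso, of x y a b] by simp

lemma conn_refl: "x \<in> carrier S \<Longrightarrow> a \<in> carrier (L x) \<Longrightarrow> a \<in> F x x \<and> \<phi> x x a = a"
  using MC4 by simp

lemma conn_comp:
  assumes "le_tol C x y" "z \<in> carrier S" "x \<sqsubseteq>\<^bsub>S\<^esub> z" "z \<sqsubseteq>\<^bsub>S\<^esub> y"
  shows "le_tol C x z" "le_tol C z y"
    and "a \<in> F x y \<longleftrightarrow> a \<in> F x z \<and> \<phi> x z a \<in> F z y"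
    and "a \<in> F x y \<Longrightarrow> \<phi> x y a = \<phi> z y (\<phi> x z a)"
proof -
  note m = MC6[of x y z]
  show "a \<in> F x y \<longleftrightarrow> a \<in> F x z \<and> \<phi> x z a \<in> F z y" "a \<in> F x y \<Longrightarrow> \<phi> x y a = \<phi> z y (\<phi> x z a)"
    using m assms conn_idl by (auto simp: le_tol_def)
  show "le_tol C x z" "le_tol C z y"
    using tol_convex[of x y x z] tol_convex[of x y z y] assms by (auto simp: le_tol_def)
qed

text \<open>The point is moved only as far as \<open>u \<sqinter> w\<close>. There MC7 puts its
  image into the filter towards \<open>u \<squnion> w\<close>, and MC6 composes the two
  connections.\<close>

lemma fil_join:
  assumes u: "le_tol C y u" and w: "le_tol C y w" and b: "b \<in> F y u" "b \<in> F y w"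
  shows "le_tol C y (u \<squnion>\<^bsub>S\<^esub> w)" "b \<in> F y (u \<squnion>\<^bsub>S\<^esub> w)"
proof -
  note u' = le_tolD[OF u] and w' = le_tolD[OF w]
  let ?h = "u \<squnion>\<^bsub>S\<^esub> w" and ?m = "u \<sqinter>\<^bsub>S\<^esub> w"
  have c: "?h \<in> carrier S" "?m \<in> carrier S" using u' w' by auto
  have "\<gamma> (y \<squnion>\<^bsub>S\<^esub> y) ?h" using u' w' by (intro tol_join) auto
  moreover have yh: "y \<sqsubseteq>\<^bsub>S\<^esub> ?h" using u' w' S.join_left[of u w] S.le_trans[of y u ?h] c by simp
  ultimately show h: "le_tol C y ?h" using u' c by (simp add: le_tol_def S.join_absorb1)
  have uw: "\<gamma> u w"
    using tol_convex[of y ?h u w] u' w' h c S.join_left S.join_right by (auto simp: le_tol_def)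
  have m: "y \<sqsubseteq>\<^bsub>S\<^esub> ?m" "?m \<sqsubseteq>\<^bsub>S\<^esub> u" "?m \<sqsubseteq>\<^bsub>S\<^esub> w" "?m \<sqsubseteq>\<^bsub>S\<^esub> ?h"
    using u' w' c S.meet_left[of u w] S.meet_right[of u w] S.join_left[of u w]
      S.le_trans[of ?m u ?h] by (auto intro: S.meet_le)
  have "\<phi> y ?m b \<in> F ?m ?h"
    using MC7[of u w] u' w' uw conn_comp(3)[OF u c(2) m(1,2)] conn_comp(3)[OF w c(2) m(1,3)] b by blast
  moreover have "b \<in> F y ?m" using conn_comp(3)[OF u c(2) m(1,2)] b by blast
  ultimately show "b \<in> F y ?h" using conn_comp(3)[OF h c(2) m(1,4)] by blast
qed

text \<open>Connections point upwards, so the mirror image of \<open>fil_join\<close> is carried out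
  with preimages: those of \<open>b\<close> under the two connections have the same image at
  \<open>u \<squnion> w\<close> by injectivity, and MC7 pulls that image back to
  \<open>u \<sqinter> w\<close>.\<close>

lemma idl_meet:
  assumes u: "le_tol C u y" and w: "le_tol C w y" and b: "b \<in> I u y" "b \<in> I w y"
  shows "le_tol C (u \<sqinter>\<^bsub>S\<^esub> w) y" "b \<in> I (u \<sqinter>\<^bsub>S\<^esub> w) y"
proof -
  note u' = le_tolD[OF u] and w' = le_tolD[OF w]
  let ?h = "u \<sqinter>\<^bsub>S\<^esub> w" and ?m = "u \<squnion>\<^bsub>S\<^esub> w"
  have c: "?h \<in> carrier S" "?m \<in> carrier S" using u' w' by auto
  have "\<gamma> ?h (y \<sqinter>\<^bsub>S\<^esub> y)" using u' w' by (intro tol_meet) auto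
  moreover have yh: "?h \<sqsubseteq>\<^bsub>S\<^esub> y" using u' w' S.meet_left[of u w] S.le_trans[of ?h u y] c by simp
  ultimately show h: "le_tol C ?h y" using u' c by (simp add: le_tol_def S.meet_absorb1)
  have uw: "\<gamma> u w"
    using tol_convex[of ?h y u w] u' w' h c S.meet_left S.meet_right by (auto simp: le_tol_def)
  have m: "?m \<sqsubseteq>\<^bsub>S\<^esub> y" "u \<sqsubseteq>\<^bsub>S\<^esub> ?m" "w \<sqsubseteq>\<^bsub>S\<^esub> ?m" "?h \<sqsubseteq>\<^bsub>S\<^esub> ?m"
    using u' w' c S.meet_left[of u w] S.join_left[of u w] S.join_right[of u w]
      S.le_trans[of ?h u ?m] by (auto intro: S.join_le)
  obtain a1 where a1: "a1 \<in> F u y" "b = \<phi> u y a1" using b by (auto simp: idl_def)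
  obtain a2 where a2: "a2 \<in> F w y" "b = \<phi> w y a2" using b by (auto simp: idl_def)
  note cu = conn_comp[OF u c(2) m(2,1)] and cw = conn_comp[OF w c(2) m(3,1)]
  have e: "\<phi> u ?m a1 = \<phi> w ?m a2" "\<phi> u ?m a1 \<in> F ?m y" "b = \<phi> ?m y (\<phi> u ?m a1)"
    using conn_inj[OF cu(2)] cu(3,4) cw(3,4) a1 a2 by auto
  have "\<phi> u ?m a1 \<in> I u ?m \<inter> I w ?m"
    using conn_idl[of a1 u ?m] conn_idl[of a2 w ?m] cu(3) cw(3) a1 a2 e by auto
  then have "\<phi> u ?m a1 \<in> I ?h ?m" using MC7[of u w] u' w' uw by blast
  then obtain f where f: "f \<in> F ?h ?m" "\<phi> u ?m a1 = \<phi> ?h ?m f" by (auto simp: idl_def)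
  then have "f \<in> F ?h y" "b = \<phi> ?h y f"
    using conn_comp(3,4)[OF h c(2) m(4,1), of f] e by auto
  then show "b \<in> I ?h y" using conn_idl by blast
qed

subsection \<open>The gluing relation\<close>

lemma rel_iff: "((x, a), (y, b)) \<in> R \<longleftrightarrow> x \<in> carrier S \<and> a \<in> carrier (L x) \<and> y \<in> carrier S \<and>
    b \<in> carrier (L y) \<and> \<gamma> x y \<and> a \<in> F x (x \<squnion>\<^bsub>S\<^esub> y) \<and> b \<in> F y (x \<squnion>\<^bsub>S\<^esub> y) \<and>
    \<phi> x (x \<squnion>\<^bsub>S\<^esub> y) a = \<phi> y (x \<squnion>\<^bsub>S\<^esub> y) b"
  by (auto simp: glue_rel_def mc_points_def)

text \<open>The relation asks for agreement at \<open>x \<squnion> z\<close> itself. The connection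
  from there to \<open>h\<close> is injective, so agreement at any common upper index
  \<open>h\<close> suffices.\<close>

lemma rel_above:
  assumes x: "le_tol C x h" "a \<in> F x h" and z: "le_tol C z h" "c \<in> F z h"
    and eq: "\<phi> x h a = \<phi> z h c"
  shows "((x, a), (z, c)) \<in> R"
proof -
  note x' = le_tolD[OF x(1)] and z' = le_tolD[OF z(1)]
  let ?t = "x \<squnion>\<^bsub>S\<^esub> z"
  have "le_tol C (x \<sqinter>\<^bsub>S\<^esub> z) h"
    using x' z' tol_meet[of x h z h] S.le_trans[OF S.meet_left[of x z], of h]
    by (simp add: le_tol_def S.meet_absorb1)
  then have xz: "\<gamma> x z"
    using tol_convex[of "x \<sqinter>\<^bsub>S\<^esub> z" h x z] x' z' S.meet_left S.meet_right by (auto simp: le_tol_def)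
  have t: "?t \<in> carrier S" "x \<sqsubseteq>\<^bsub>S\<^esub> ?t" "z \<sqsubseteq>\<^bsub>S\<^esub> ?t" "?t \<sqsubseteq>\<^bsub>S\<^esub> h"
    using x' z' by (auto intro: S.join_left S.join_right S.join_le)
  note cx = conn_comp[OF x(1) t(1,2,4)] and cz = conn_comp[OF z(1) t(1,3,4)]
  have "\<phi> x ?t a = \<phi> z ?t c"
    by (rule conn_inj[OF cx(2)]) (use cx(3,4) cz(3,4) x z eq in auto)
  then show ?thesis
    using x' z' xz cx(3) cz(3) x z fil_sub by (auto simp: rel_iff)
qed

lemma rel_conn: "le_tol C x y \<Longrightarrow> a \<in> F x y \<Longrightarrow> ((x, a), (y, \<phi> x y a)) \<in> R"
  using rel_above[of x y a y "\<phi> x y a"] conn_refl[of y "\<phi> x y a"] conn_L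
  by (auto simp: le_tol_def tol_refl)

lemma rel_le:
  assumes "((x, a), (y, b)) \<in> R" "x \<sqsubseteq>\<^bsub>S\<^esub> y"
  shows "le_tol C x y" "a \<in> F x y" "\<phi> x y a = b"
  using assms conn_refl[of y b] by (auto simp: rel_iff S.join_absorb1 le_tol_def)

lemma rel_refl: "x \<in> carrier S \<Longrightarrow> a \<in> carrier (L x) \<Longrightarrow> ((x, a), (x, a)) \<in> R"
  using rel_conn[of x x a] conn_refl[of x a] by (simp add: le_tol_def tol_refl)

lemma rel_sym: "((x, a), (y, b)) \<in> R \<Longrightarrow> ((y, b), (x, a)) \<in> R"
  unfolding rel_iff using tol_sym join_comm[of S x y] by auto

text \<open>The common image at the join lies in both ideals, so MC7 provides a preimage at the
  meet. Injectivity of the upper connections shows that it is mapped to \<open>a\<close> and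
  \<open>b\<close>.\<close>

lemma rel_lower:
  assumes "((x, a), (y, b)) \<in> R"
  shows "\<exists>d. d \<in> F (x \<sqinter>\<^bsub>S\<^esub> y) x \<and> d \<in> F (x \<sqinter>\<^bsub>S\<^esub> y) y \<and> \<phi> (x \<sqinter>\<^bsub>S\<^esub> y) x d = a \<and> \<phi> (x \<sqinter>\<^bsub>S\<^esub> y) y d = b"
proof -
  let ?m = "x \<sqinter>\<^bsub>S\<^esub> y" and ?j = "x \<squnion>\<^bsub>S\<^esub> y"
  have r: "x \<in> carrier S" "y \<in> carrier S" "\<gamma> x y" "a \<in> F x ?j" "b \<in> F y ?j" "\<phi> x ?j a = \<phi> y ?j b"
    using assms by (auto simp: rel_iff)
  note j = tol_join_right[OF r(1-3)] and m = tol_meet_left[OF r(1-3)]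
  have "\<phi> x ?j a \<in> I x ?j \<inter> I y ?j" using r(4-6) conn_idl by force
  then have "\<phi> x ?j a \<in> I ?m ?j" using MC7[OF r(1-3)] by blast
  then obtain d where d: "d \<in> F ?m ?j" "\<phi> x ?j a = \<phi> ?m ?j d" by (auto simp: idl_def)
  have mj: "le_tol C ?m ?j"
    using tol_span[OF r(1-3)] r le_tolD[OF j(1)] le_tolD[OF m(1)] S.le_trans[of ?m x ?j]
    by (simp add: le_tol_def)
  have x: "x \<sqsubseteq>\<^bsub>S\<^esub> ?j" "?m \<sqsubseteq>\<^bsub>S\<^esub> x" and y: "y \<sqsubseteq>\<^bsub>S\<^esub> ?j" "?m \<sqsubseteq>\<^bsub>S\<^esub> y"
    using le_tolD j m by blast+
  note cx = conn_comp[OF mj r(1) x(2,1)] and cy = conn_comp[OF mj r(2) y(2,1)]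
  have "\<phi> ?m x d = a" by (rule conn_inj[OF j(1)]) (use cx(3,4) d r in auto)
  moreover have "\<phi> ?m y d = b" by (rule conn_inj[OF j(2)]) (use cy(3,4) d r in auto)
  ultimately show ?thesis using cx(3) cy(3) d by blast
qed

text \<open>All three points are compared at \<open>?h\<close>, the join of the indices. The middle
  point reaches it by \<open>fil_join\<close> and comes from the meet \<open>?l\<close> by
  \<open>idl_meet\<close>; once \<open>?l\<close> and \<open>?h\<close> are known to be related,
  convexity of the tolerance lets \<open>a\<close> and \<open>c\<close> travel to \<open>?h\<close>
  too.\<close>

lemma rel_trans:
  assumes ab: "((x, a), (y, b)) \<in> R" and bc: "((y, b), (z, c)) \<in> R"
  shows "((x, a), (z, c)) \<in> R"
proof -
  let ?u = "x \<squnion>\<^bsub>S\<^esub> y" and ?w = "y \<squnion>\<^bsub>S\<^esub> z" and ?d = "x \<sqinter>\<^bsub>S\<^esub> y" and ?e = "y \<sqinter>\<^bsub>S\<^esub> z"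
  let ?h = "?u \<squnion>\<^bsub>S\<^esub> ?w" and ?l = "?d \<sqinter>\<^bsub>S\<^esub> ?e"
  have r: "x \<in> carrier S" "y \<in> carrier S" "z \<in> carrier S" "\<gamma> x y" "\<gamma> y z"
    "a \<in> F x ?u" "b \<in> F y ?u" "\<phi> x ?u a = \<phi> y ?u b"
    "b \<in> F y ?w" "c \<in> F z ?w" "\<phi> y ?w b = \<phi> z ?w c"
    using ab bc by (auto simp: rel_iff)
  note u = tol_join_right[OF r(1,2,4)] and w = tol_join_right[OF r(2,3,5)]
  note d = tol_meet_left[OF r(1,2,4)] and e = tol_meet_left[OF r(2,3,5)]
  have h: "le_tol C y ?h" "b \<in> F y ?h" using fil_join[OF u(2) w(1) r(7,9)] by auto
  have "b \<in> I ?d y" "b \<in> I ?e y"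
    using rel_lower[OF ab] rel_lower[OF bc] unfolding idl_def by (metis imageI)+
  then have l: "le_tol C ?l y" "b \<in> I ?l y" using idl_meet[OF d(2) e(1)] by auto
  \<comment> \<open>MC5 takes the place of transitivity: \<open>b\<close> lies both in the ideal
    from \<open>?l\<close> and in the filter towards \<open>?h\<close>.\<close>
  then have lh: "\<gamma> ?l ?h" using MC5[OF l(1) h(1)] h by blast
  have hc: "?h \<in> carrier S" "?l \<in> carrier S" "?u \<in> carrier S" "?w \<in> carrier S" "?d \<in> carrier S" "?e \<in> carrier S"
    using r by auto
  have uh: "?u \<sqsubseteq>\<^bsub>S\<^esub> ?h" "?w \<sqsubseteq>\<^bsub>S\<^esub> ?h" "?l \<sqsubseteq>\<^bsub>S\<^esub> ?d" "?l \<sqsubseteq>\<^bsub>S\<^esub> ?e"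
    using hc S.join_left S.join_right S.meet_left S.meet_right by auto
  have xh: "x \<sqsubseteq>\<^bsub>S\<^esub> ?h" "z \<sqsubseteq>\<^bsub>S\<^esub> ?h" "?l \<sqsubseteq>\<^bsub>S\<^esub> x" "?l \<sqsubseteq>\<^bsub>S\<^esub> z"
    using le_tolD[OF u(1)] le_tolD[OF w(2)] le_tolD[OF d(1)] le_tolD[OF e(2)] uh hc
      S.le_trans[of x ?u ?h] S.le_trans[of z ?w ?h] S.le_trans[of ?l ?d x] S.le_trans[of ?l ?e z]
    by blast+
  have lhS: "?l \<sqsubseteq>\<^bsub>S\<^esub> ?h" using xh r hc S.le_trans[of ?l x ?h] by blast
  have X: "le_tol C x ?h" and Z: "le_tol C z ?h"
    using tol_convex[OF hc(2,1) r(1) hc(1) xh(3,1) lhS _ lh] tol_convex[OF hc(2,1) r(3) hc(1) xh(4,2) lhS _ lh]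
      r hc xh by (auto simp: le_tol_def)
  note yu = conn_comp[OF h(1) hc(3) _ uh(1)] and yw = conn_comp[OF h(1) hc(4) _ uh(2)]
  have le: "y \<sqsubseteq>\<^bsub>S\<^esub> ?u" "y \<sqsubseteq>\<^bsub>S\<^esub> ?w" "x \<sqsubseteq>\<^bsub>S\<^esub> ?u" "z \<sqsubseteq>\<^bsub>S\<^esub> ?w"
    using le_tolD u w by blast+
  have ha: "a \<in> F x ?h" "\<phi> x ?h a = \<phi> y ?h b"
    using conn_comp(3,4)[OF X hc(3) le(3) uh(1), of a] yu(3,4)[OF le(1), of b] r(6,8) h(2) by auto
  have hcc: "c \<in> F z ?h" "\<phi> z ?h c = \<phi> y ?h b"
    using conn_comp(3,4)[OF Z hc(4) le(4) uh(2), of c] yw(3,4)[OF le(2), of b] r(10,11) h(2) by auto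
  show ?thesis by (rule rel_above[OF X ha(1) Z hcc(1)]) (simp add: ha hcc)
qed

lemma rel_equiv: "equiv (mc_points C) R"
proof (rule equivI)
  show "R \<subseteq> mc_points C \<times> mc_points C" by (auto simp: glue_rel_def)
  show "refl_on (mc_points C) R" using rel_refl by (auto simp: refl_on_def mc_points_def)
  show "sym R" using rel_sym by (auto simp: sym_def)
  show "trans R" unfolding trans_def using rel_trans by fast
qed

section \<open>The copies of the blocks inside the sum\<close>

lemma point_iff: "(x, a) \<in> mc_points C \<longleftrightarrow> x \<in> carrier S \<and> a \<in> carrier (L x)"
  by (simp add: mc_points_def)

lemma proj_eq_iff:
  assumes "x \<in> carrier S" "a \<in> carrier (L x)" "y \<in> carrier S" "b \<in> carrier (L y)"
  shows "proj C x a = proj C y b \<longleftrightarrow> ((x, a), (y, b)) \<in> R"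
  unfolding proj_def using eq_equiv_class_iff[OF rel_equiv] assms by (simp add: point_iff)

lemma proj_inj: "x \<in> carrier S \<Longrightarrow> inj_on (proj C x) (carrier (L x))"
  using rel_le(3) conn_refl by (intro inj_onI) (metis S.le_refl proj_eq_iff)

lemma proj_conn:
  assumes "le_tol C x y" "a \<in> F x y"
  shows "proj C y (\<phi> x y a) = proj C x a"
  using rel_sym[OF rel_conn[OF assms]] proj_eq_iff fil_sub[OF assms] conn_L[OF assms] le_tolD[OF assms(1)]
  by simp

text \<open>Filters become overlaps of copies, and unrelated comparable indices have disjoint
  copies. With its companion for ideals this translates statements about connections into statements
  about membership.\<close>

lemma proj_mem_upper:
  assumes "x \<in> carrier S" "y \<in> carrier S" "x \<sqsubseteq>\<^bsub>S\<^esub> y" "a \<in> carrier (L x)"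
  shows "proj C x a \<in> sum_block C y \<longleftrightarrow> \<gamma> x y \<and> a \<in> F x y"
proof
  assume "proj C x a \<in> sum_block C y"
  then obtain b where "b \<in> carrier (L y)" "proj C x a = proj C y b" by (auto simp: sum_block_def)
  then have "((x, a), (y, b)) \<in> R" using proj_eq_iff assms by simp
  then show "\<gamma> x y \<and> a \<in> F x y" using rel_le[OF _ assms(3)] by (auto simp: le_tol_def)
next
  assume "\<gamma> x y \<and> a \<in> F x y"
  then have "le_tol C x y" "a \<in> F x y" using assms by (auto simp: le_tol_def)
  then show "proj C x a \<in> sum_block C y"
    using proj_conn conn_L by (metis sum_block_def imageI)
qed

lemma proj_mem_lower:
  assumes "x \<in> carrier S" "y \<in> carrier S" "x \<sqsubseteq>\<^bsub>S\<^esub> y" "b \<in> carrier (L y)"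
  shows "proj C y b \<in> sum_block C x \<longleftrightarrow> \<gamma> x y \<and> b \<in> I x y"
proof
  assume "proj C y b \<in> sum_block C x"
  then obtain a where a: "a \<in> carrier (L x)" "proj C x a = proj C y b" by (auto simp: sum_block_def)
  then have "((x, a), (y, b)) \<in> R" using proj_eq_iff assms by simp
  then show "\<gamma> x y \<and> b \<in> I x y" using rel_le[OF _ assms(3), of a b] by (auto simp: le_tol_def idl_def)
next
  assume "\<gamma> x y \<and> b \<in> I x y"
  then obtain a where "le_tol C x y" "a \<in> F x y" "b = \<phi> x y a"
    using assms by (auto simp: le_tol_def idl_def)
  then show "proj C y b \<in> sum_block C x"
    using proj_conn fil_sub by (metis sum_block_def imageI)
qed

lemma sum_le_at_proj:
  assumes "x \<in> carrier S" "a \<in> carrier (L x)" "b \<in> carrier (L x)"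
  shows "sum_le_at C x (proj C x a) (proj C x b) \<longleftrightarrow> a \<sqsubseteq>\<^bsub>L x\<^esub> b"
  using assms proj_inj by (simp add: sum_le_at_def sum_block_def)

lemma proj_iso:
  assumes "x \<in> carrier S"
  shows "lattice_iso (L x) (mc_blk C x) (proj C x)"
proof (rule lattice_iso_orderI)
  show "lattice (L x)" using L_lattice[OF assms] by (simp add: gorder_lattice_iff)
  show "bij_betw (proj C x) (carrier (L x)) (carrier (mc_blk C x))"
    using proj_inj[OF assms] by (simp add: bij_betw_def mc_blk_def sum_block_def)
qed (use assms sum_le_at_proj in \<open>auto simp: mc_blk_def\<close>)

lemma sum_blockE:
  assumes "p \<in> sum_block C x"
  obtains a where "a \<in> carrier (L x)" "p = proj C x a"
  using assms by (auto simp: sum_block_def)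

text \<open>\<open>mem_join\<close> comes from the definition of the gluing relation,
  \<open>mem_meet\<close> from \<open>rel_lower\<close>, convexity from MC6, \<open>le_up\<close>
  and \<open>le_down\<close> from MC3, and the condition on covers from MC8.\<close>

lemma sum_glued_blocks: "glued_blocks S (mc_blk C)"
proof
  show "lffc_lattice S" by (rule MC1)
  show "finite (carrier (mc_blk C x)) \<and> modular_lattice (mc_blk C x) \<and> complemented_lattice (mc_blk C x)"
    if x: "x \<in> carrier S" for x
    using MC2[OF x] modular_lattice_iso[OF proj_iso[OF x]] complemented_lattice_iso[OF proj_iso[OF x]]
    by (simp add: mc_blk_def sum_block_def)
next
  fix x y p assume xy: "x \<in> carrier S" "y \<in> carrier S" "p \<in> carrier (mc_blk C x)" "p \<in> carrier (mc_blk C y)"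
  then obtain a b where ab: "a \<in> carrier (L x)" "p = proj C x a" "b \<in> carrier (L y)" "p = proj C y b"
    by (auto simp: mc_blk_def elim!: sum_blockE)
  then have r: "((x, a), (y, b)) \<in> R" using proj_eq_iff[of x a y b] xy by metis
  then have t: "\<gamma> x y" "a \<in> F x (x \<squnion>\<^bsub>S\<^esub> y)" by (auto simp: rel_iff)
  show "p \<in> carrier (mc_blk C (x \<squnion>\<^bsub>S\<^esub> y))"
    using proj_mem_upper[of x "x \<squnion>\<^bsub>S\<^esub> y" a] ab t xy tol_join_right[OF xy(1,2) t(1)]
    by (simp add: mc_blk_def le_tol_def)
  have "a \<in> I (x \<sqinter>\<^bsub>S\<^esub> y) x" using rel_lower[OF r] conn_idl by blast
  then show "p \<in> carrier (mc_blk C (x \<sqinter>\<^bsub>S\<^esub> y))"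
    using proj_mem_lower[of "x \<sqinter>\<^bsub>S\<^esub> y" x a] ab t xy tol_meet_left[OF xy(1,2) t(1)]
    by (simp add: mc_blk_def le_tol_def)
next
  fix x y z p assume xyz: "x \<in> carrier S" "y \<in> carrier S" "z \<in> carrier S" "x \<sqsubseteq>\<^bsub>S\<^esub> z" "z \<sqsubseteq>\<^bsub>S\<^esub> y"
    and p: "p \<in> carrier (mc_blk C x)" "p \<in> carrier (mc_blk C y)"
  obtain a where a: "a \<in> carrier (L x)" "p = proj C x a" using p by (auto simp: mc_blk_def elim!: sum_blockE)
  have xy: "x \<sqsubseteq>\<^bsub>S\<^esub> y" using xyz S.le_trans by blast
  then have "le_tol C x y" "a \<in> F x y"
    using proj_mem_upper[OF xyz(1,2) xy a(1)] p a xyz by (auto simp: mc_blk_def le_tol_def)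
  then have "a \<in> F x z" "le_tol C x z" 
    using conn_comp(1)[OF _ xyz(3-5)] conn_comp(3)[OF _ xyz(3-5), of a] by blast+
  then show "p \<in> carrier (mc_blk C z)"
    using proj_mem_upper[OF xyz(1,3,4) a(1)] a by (simp add: mc_blk_def le_tol_def)
next
  fix x y p q assume xy: "x \<in> carrier S" "y \<in> carrier S" "x \<sqsubseteq>\<^bsub>S\<^esub> y"
    and p: "p \<in> carrier (mc_blk C x)" "p \<in> carrier (mc_blk C y)"
    and q: "q \<in> carrier (mc_blk C x)" "p \<sqsubseteq>\<^bsub>mc_blk C x\<^esub> q"
  obtain a b where ab: "a \<in> carrier (L x)" "p = proj C x a" "b \<in> carrier (L x)" "q = proj C x b"
    using p q by (auto simp: mc_blk_def elim!: sum_blockE)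
  have a: "le_tol C x y" "a \<in> F x y"
    using proj_mem_upper[OF xy ab(1)] p ab xy by (auto simp: mc_blk_def le_tol_def)
  have le: "a \<sqsubseteq>\<^bsub>L x\<^esub> b" using q ab sum_le_at_proj xy by (simp add: mc_blk_def)
  then have b: "b \<in> F x y" using fil_up a ab by blast
  have "q \<in> sum_block C y" using proj_mem_upper[OF xy ab(3)] a b ab by (simp add: le_tol_def)
  moreover have "sum_le_at C y p q"
    using sum_le_at_proj[OF xy(2) conn_L[OF a] conn_L[OF a(1) b]] conn_le[OF a b] le
      proj_conn[OF a] proj_conn[OF a(1) b] ab by simp
  ultimately show "q \<in> carrier (mc_blk C y) \<and> p \<sqsubseteq>\<^bsub>mc_blk C y\<^esub> q" by (simp add: mc_blk_def)
next
  fix x y p q assume xy: "x \<in> carrier S" "y \<in> carrier S" "x \<sqsubseteq>\<^bsub>S\<^esub> y"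
    and p: "p \<in> carrier (mc_blk C x)" "p \<in> carrier (mc_blk C y)"
    and q: "q \<in> carrier (mc_blk C y)" "q \<sqsubseteq>\<^bsub>mc_blk C y\<^esub> p"
  obtain a b where ab: "a \<in> carrier (L y)" "p = proj C y a" "b \<in> carrier (L y)" "q = proj C y b"
    using p q by (auto simp: mc_blk_def elim!: sum_blockE)
  have a: "le_tol C x y" "a \<in> I x y"
    using proj_mem_lower[OF xy ab(1)] p ab xy by (auto simp: mc_blk_def le_tol_def)
  have le: "b \<sqsubseteq>\<^bsub>L y\<^esub> a" using q ab sum_le_at_proj xy by (simp add: mc_blk_def)
  then have b: "b \<in> I x y" using idl_down a ab by blast
  obtain a' b' where ab': "a' \<in> F x y" "a = \<phi> x y a'" "b' \<in> F x y" "b = \<phi> x y b'"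
    using a b by (auto simp: idl_def)
  have "q \<in> sum_block C x" using proj_mem_lower[OF xy ab(3)] a b ab by (simp add: le_tol_def)
  moreover have "sum_le_at C x q p"
    using sum_le_at_proj[OF xy(1) fil_sub[OF a(1) ab'(3)] fil_sub[OF a(1) ab'(1)]]
      conn_le[OF a(1) ab'(3,1)] le proj_conn[OF a(1) ab'(1)] proj_conn[OF a(1) ab'(3)] ab ab' by simp
  ultimately show "q \<in> carrier (mc_blk C x) \<and> q \<sqsubseteq>\<^bsub>mc_blk C x\<^esub> p" by (simp add: mc_blk_def)
next
  fix x y assume c: "covers S x y"
  then have xy: "le_tol C x y" using MC8_1[OF c] by (simp add: S.covers_iff le_tol_def)
  note xy' = le_tolD[OF xy]
  obtain a where a: "a \<in> F x y" using fil_nonempty[OF xy] by blast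
  then have "proj C x a \<in> sum_block C x \<inter> sum_block C y"
    using proj_mem_upper[of x y a] xy' fil_sub[OF xy a] by (simp add: sum_block_def)
  moreover have "\<not> sum_block C x \<subseteq> sum_block C y"
  proof
    assume s: "sum_block C x \<subseteq> sum_block C y"
    have "b \<in> F x y" if b: "b \<in> carrier (L x)" for b
      using s proj_mem_upper[of x y b] xy' b by (auto simp: sum_block_def)
    then show False using MC8_2[OF c] fil_sub[OF xy] by blast
  qed
  moreover have "\<not> sum_block C y \<subseteq> sum_block C x"
  proof
    assume s: "sum_block C y \<subseteq> sum_block C x"
    have "b \<in> I x y" if b: "b \<in> carrier (L y)" for b
      using s proj_mem_lower[of x y b] xy' b by (auto simp: sum_block_def)
    then show False using MC8_2[OF c] idl_sub[OF xy] by blast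
  qed
  ultimately show "carrier (mc_blk C x) \<inter> carrier (mc_blk C y) \<noteq> {} \<and>
    \<not> carrier (mc_blk C x) \<subseteq> carrier (mc_blk C y) \<and> \<not> carrier (mc_blk C y) \<subseteq> carrier (mc_blk C x)"
    by (auto simp: mc_blk_def)
qed

sublocale B: glued_blocks S "mc_blk C"
  by (rule sum_glued_blocks)

lemma at_eq: "block_le S (mc_blk C) x p q \<longleftrightarrow> x \<in> carrier S \<and> sum_le_at C x p q"
  by (auto simp: block_le_def mc_blk_def sum_le_at_def)

lemma mc_sum_carrier: "mc_points C // R = carrier (glue S (mc_blk C))"
  by (auto simp: glue_def mc_blk_def quotient_def mc_points_def sum_block_def proj_def)

text \<open>A chain with increasing indices is in particular a path. Conversely, a path is sorted
  from the left, raising the block of each appended step.\<close>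

lemma sum_le_eq:
  "sum_le C p q \<longleftrightarrow> p \<sqsubseteq>\<^bsub>glue S (mc_blk C)\<^esub> q"
proof
  assume "sum_le C p q"
  then obtain n r x where r: "r 0 = p" "r n = q" "\<forall>i\<in>{0..n::nat}. r i \<in> mc_points C // R"
    "\<forall>i\<in>{1..n}. x i \<in> carrier S \<and> sum_le_at C (x i) (r (i - 1)) (r i)"
    by (auto simp: sum_le_def)
  have "r 0 \<sqsubseteq>\<^bsub>B.G\<^esub> r i" if "i \<le> n" for i
    using that
  proof (induction i)
    case 0
    then show ?case using r(3) mc_sum_carrier B.gle_refl by simp
  next
    case (Suc i)
    then have "block_le S (mc_blk C) (x (Suc i)) (r i) (r (Suc i))"
      using r(4)[rule_format, of "Suc i"] by (simp add: at_eq)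
    then show ?case using Suc B.at_gle B.gle_trans by (meson Suc_leD)
  qed
  then show "p \<sqsubseteq>\<^bsub>B.G\<^esub> q" using r by auto
next
  assume "p \<sqsubseteq>\<^bsub>B.G\<^esub> q"
  then have p: "p \<in> carrier B.G" and path: "(\<lambda>p q. \<exists>x. block_le S (mc_blk C) x p q)\<^sup>*\<^sup>* p q"
    by (auto simp: B.gle_iff)
  from path show "sum_le C p q"
  proof (induction rule: rtranclp_induct)
    case base
    show ?case unfolding sum_le_def
      by (rule exI[of _ 0], rule exI[of _ "\<lambda>_. p"]) (use p mc_sum_carrier in auto)
  next
    case (step b c)
    then obtain n r x where r: "r 0 = p" "r n = b" "\<forall>i\<in>{0..n::nat}. r i \<in> mc_points C // R"
      "\<forall>i\<in>{1..n}. x i \<in> carrier S \<and> sum_le_at C (x i) (r (i - 1)) (r i)"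
      "\<forall>i\<in>{1..<n}. x i \<sqsubseteq>\<^bsub>S\<^esub> x (i + 1)"
      by (auto simp: sum_le_def)
    obtain v where v: "block_le S (mc_blk C) v b c" using step.hyps by blast
    \<comment> \<open>The new step is moved up to \<open>x n \<squnion> v\<close>, which lies above
      the last index; for \<open>n = 0\<close> there is no last index and \<open>v\<close> itself
      serves.\<close>
    obtain w where w: "block_le S (mc_blk C) w b c" "n \<ge> 1 \<Longrightarrow> x n \<sqsubseteq>\<^bsub>S\<^esub> w"
    proof (cases "n \<ge> 1")
      case True
      then have xn: "x n \<in> carrier S" "b \<in> carrier (mc_blk C (x n))"
        using r(2) r(4)[rule_format, of n] by (auto simp: sum_le_at_def mc_blk_def)
      then show ?thesis
        using that[OF B.at_join[OF xn v]] S.join_left[OF xn(1)] B.at_mem[OF v] by blast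
    qed (use that v in simp)
    have c: "c \<in> mc_points C // R" using B.at_mem[OF v] B.mem_carrier mc_sum_carrier by blast
    let ?r = "r(Suc n := c)" and ?x = "x(Suc n := w)"
    have "\<forall>i\<in>{0..Suc n}. ?r i \<in> mc_points C // R" using r c by auto
    moreover have "\<forall>i\<in>{1..Suc n}. ?x i \<in> carrier S \<and> sum_le_at C (?x i) (?r (i - 1)) (?r i)"
      using r w by (auto simp: at_eq)
    moreover have "\<forall>i\<in>{1..<Suc n}. ?x i \<sqsubseteq>\<^bsub>S\<^esub> ?x (i + 1)"
      using r w(2) by (auto simp: less_Suc_eq)
    ultimately show ?case unfolding sum_le_def
      by (intro exI[of _ "Suc n"] exI[of _ ?r] exI[of _ ?x]) (use r in simp)
  qed
qed

lemma mc_sum_glue: "mc_sum C = glue S (mc_blk C)"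
proof -
  have "sum_le C = le (glue S (mc_blk C))" by (intro ext) (rule sum_le_eq)
  moreover have "eq (glue S (mc_blk C)) = (=)" by (simp add: glue_def)
  ultimately show ?thesis unfolding mc_sum_def using mc_sum_carrier by simp
qed

theorem mc_sum_modular_lffc: "modular_lffc_lattice (mc_sum C)"
  by (simp add: mc_sum_glue B.glue_modular_lffc)

lemma mc_sum_minimum: "has_minimum S \<longleftrightarrow> has_minimum (mc_sum C)"
  by (simp add: mc_sum_glue B.glue_minimum)

subsection \<open>Dissecting the sum\<close>

text \<open>Related indices are both related to their join, so both copies contain the bottom of the
  copy at the join.\<close>

lemma tol_iff_blocks_meet:
  assumes xy: "x \<in> carrier S" "y \<in> carrier S"
  shows "\<gamma> x y \<longleftrightarrow> sum_block C x \<inter> sum_block C y \<noteq> {}"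
proof
  assume t: "\<gamma> x y"
  let ?j = "x \<squnion>\<^bsub>S\<^esub> y"
  note j = tol_join_right[OF xy t]
  have "B.zero ?j \<in> sum_block C z" if z: "le_tol C z ?j" for z
  proof -
    obtain a where a: "a \<in> F z ?j" using fil_nonempty[OF z] by blast
    have "proj C z a \<in> sum_block C z" "proj C z a \<in> sum_block C ?j"
      using proj_mem_upper[of z ?j a] le_tolD[OF z] a fil_sub[OF z a] by (auto simp: sum_block_def)
    then show ?thesis
      using B.zero_mem_lower[of z ?j "proj C z a"] le_tolD[OF z] by (simp add: mc_blk_def)
  qed
  then show "sum_block C x \<inter> sum_block C y \<noteq> {}" using j by blast
next
  assume "sum_block C x \<inter> sum_block C y \<noteq> {}"
  then obtain a b where "a \<in> carrier (L x)" "b \<in> carrier (L y)" "proj C x a = proj C y b"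
    by (auto simp: sum_block_def)
  then show "\<gamma> x y" using proj_eq_iff xy by (auto simp: rel_iff)
qed

text \<open>By \<open>lattice_blocks_glue\<close> the blocks of the sum are the copies
  \<open>sum_block C x\<close>. Under \<open>proj\<close> a connection becomes an identity map,
  because a point and its image have the same class.\<close>

lemma mc_iso_dissection_sum:
  "mc_iso C (dissection (mc_sum C)) (sum_block C) (proj C)"
proof -
  let ?D = "dissection (mc_sum C)"
  have car: "carrier (mc_blk C x) = sum_block C x" for x by (simp add: mc_blk_def)
  have bot: "\<bottom>\<^bsub>B.G\<lparr>carrier := sum_block C x\<rparr>\<^esub> = B.zero x" if x: "x \<in> carrier S" for x
    using B.G.interval_lattice(4)[of "B.zero x" "B.one x"] B.block_interval[OF x] car
      B.block_complemented[OF x] by (simp add: complemented_between_def)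
  have sk: "lattice_iso S (skel ?D) (sum_block C)"
  proof (rule lattice_iso_orderI)
    show "lattice S" by (rule B.S_lattice)
    show "bij_betw (sum_block C) (carrier S) (carrier (skel ?D))"
      using B.lattice_blocks_glue B.mem_eq_iff
      by (auto simp: dissection_def mc_sum_glue bij_betw_def inj_on_def car)
    show "sum_block C x \<sqsubseteq>\<^bsub>skel ?D\<^esub> sum_block C y \<longleftrightarrow> x \<sqsubseteq>\<^bsub>S\<^esub> y"
      if "x \<in> carrier S" "y \<in> carrier S" for x y
      using that bot B.zero_le_iff by (simp add: dissection_def mc_sum_glue)
  qed (simp add: dissection_def)
  have blk: "lattice_iso (L x) (block ?D (sum_block C x)) (proj C x)" if x: "x \<in> carrier S" for x
  proof (rule lattice_iso_orderI)
    show "lattice (L x)" using L_lattice[OF x] by (simp add: gorder_lattice_iff)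
    show "bij_betw (proj C x) (carrier (L x)) (carrier (block ?D (sum_block C x)))"
      using proj_inj[OF x] by (simp add: bij_betw_def dissection_def sum_block_def)
    show "eq (block ?D (sum_block C x)) = (=)" by (simp add: dissection_def mc_sum_def)
    show "proj C x a \<sqsubseteq>\<^bsub>block ?D (sum_block C x)\<^esub> proj C x b \<longleftrightarrow> a \<sqsubseteq>\<^bsub>L x\<^esub> b"
      if ab: "a \<in> carrier (L x)" "b \<in> carrier (L x)" for a b
      using B.at_iff[OF x, of "proj C x a" "proj C x b"] sum_le_at_proj[OF x ab] ab
      by (simp add: dissection_def mc_sum_glue mc_blk_def sum_block_def)
  qed
  have fil: "sum_block C x \<inter> sum_block C y = proj C x ` F x y" if xy: "le_tol C x y" for x y
  proof (rule Set.set_eqI)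
    fix p
    have "proj C x a \<in> sum_block C y \<longleftrightarrow> a \<in> F x y" if "a \<in> carrier (L x)" for a
      using proj_mem_upper[of x y a] le_tolD[OF xy] that by blast
    then show "p \<in> sum_block C x \<inter> sum_block C y \<longleftrightarrow> p \<in> proj C x ` F x y"
      using fil_sub[OF xy] unfolding sum_block_def[of C x] by blast
  qed
  have idl: "sum_block C x \<inter> sum_block C y = proj C y ` I x y" if xy: "le_tol C x y" for x y
  proof (rule Set.set_eqI)
    fix p
    have "proj C y a \<in> sum_block C x \<longleftrightarrow> a \<in> I x y" if "a \<in> carrier (L y)" for a
      using proj_mem_lower[of x y a] le_tolD[OF xy] that by blast
    then show "p \<in> sum_block C x \<inter> sum_block C y \<longleftrightarrow> p \<in> proj C y ` I x y"
      using idl_sub[OF xy] unfolding sum_block_def[of C y] by blast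
  qed
  have "idl ?D B B' = B \<inter> B'" "fil ?D B B' = B \<inter> B'" "conn ?D B B' a = a" "tol ?D B B' \<longleftrightarrow> B \<inter> B' \<noteq> {}"
    for B B' a by (auto simp: dissection_def idl_def)
  then show ?thesis
    unfolding mc_iso_def using sk blk tol_iff_blocks_meet fil idl proj_conn by simp
qed

end

section \<open>The dissection of a modular lattice\<close>

text \<open>Inserting \<open>x\<close> yields the value \<open>x\<close> at the greatest element,
  which has no upper covers, and leaves the join of the covers unchanged elsewhere.\<close>

definition star :: "'a gorder \<Rightarrow> 'a \<Rightarrow> 'a" where
  "star L x = \<Squnion>\<^bsub>L\<^esub>(insert x {y. covers L x y})"

abbreviation costar :: "'a gorder \<Rightarrow> 'a \<Rightarrow> 'a" where
  "costar L \<equiv> star (inv_gorder L)"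

text \<open>This is the form in which the dual of the dual appears after simplification.\<close>

lemma gorder_collapse: "\<lparr>carrier = carrier L, eq = eq L, le = le L\<rparr> = (L :: 'a gorder)"
  by simp

locale modular_lffc =
  fixes L :: "'a gorder" (structure)
  assumes modular_lffc: "modular_lffc_lattice L"
begin

lemma L_lattice: "lattice L" and L_finite: "locally_finite L" and L_modular: "modular_lattice L"
  using modular_lffc by (auto simp: modular_lffc_lattice_def lffc_lattice_def)

sublocale gorder_lattice L
  by (simp add: gorder_lattice_iff L_lattice)

lemma dual: "modular_lffc (inv_gorder L)"
  using modular_lffc modular_lattice_dual lffc_lattice_dual
  by unfold_locales (auto simp: modular_lffc_lattice_def)

section \<open>The Galois connection of \<open>star\<close> and \<open>costar\<close>\<close>

lemma
  assumes x: "x \<in> carrier L"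
  shows star_closed: "star L x \<in> carrier L"
    and le_star: "x \<sqsubseteq> star L x"
    and cover_le_star: "covers L x y \<Longrightarrow> y \<sqsubseteq> star L x"
    and star_least: "u \<in> carrier L \<Longrightarrow> x \<sqsubseteq> u \<Longrightarrow> (\<And>y. covers L x y \<Longrightarrow> y \<sqsubseteq> u) \<Longrightarrow> star L x \<sqsubseteq> u"
proof -
  let ?A = "insert x {y. covers L x y}"
  have sub: "?A \<subseteq> carrier L" using x by (auto simp: covers_iff)
  have "finite ?A"
    using modular_lffc x by (auto simp: modular_lffc_lattice_def lffc_lattice_def finite_covers_def)
  then have lub: "least L (star L x) (Upper L ?A)"
    unfolding star_def using sub by (intro finite_sup_least) auto
  show "star L x \<in> carrier L" using lub by (rule least_closed)
  show "x \<sqsubseteq> star L x" "covers L x y \<Longrightarrow> y \<sqsubseteq> star L x"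
    using least_Upper_above[OF lub _ sub] by auto
  show "u \<in> carrier L \<Longrightarrow> x \<sqsubseteq> u \<Longrightarrow> (\<And>y. covers L x y \<Longrightarrow> y \<sqsubseteq> u) \<Longrightarrow> star L x \<sqsubseteq> u"
    using least_le[OF lub, of u] by (auto simp: Upper_def)
qed

text \<open>Modularity enters here: a cover \<open>y\<close> of \<open>x\<close> that is not below
  \<open>x'\<close> produces the cover \<open>x' \<squnion> y\<close> of \<open>x'\<close>.\<close>

lemma star_mono:
  assumes x: "x \<in> carrier L" "x' \<in> carrier L" "x \<sqsubseteq> x'"
  shows "star L x \<sqsubseteq> star L x'"
proof (rule star_least[OF x(1) star_closed[OF x(2)]])
  show "x \<sqsubseteq> star L x'" using le_trans[OF x(3) le_star[OF x(2)]] x star_closed by simp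
  show "y \<sqsubseteq> star L x'" if y: "covers L x y" for y
  proof (cases "y \<sqsubseteq> x'")
    case True
    then show ?thesis using le_trans[OF True le_star[OF x(2)]] x y star_closed by (simp add: covers_iff)
  next
    case False
    have "covers L x' (x' \<squnion> y)" by (rule modular_covers_join[OF L_modular y x(2,3) False])
    then have "x' \<squnion> y \<sqsubseteq> star L x'" by (rule cover_le_star[OF x(2)])
    then show ?thesis
      using le_trans[OF join_right[of x' y], of "star L x'"] x y star_closed by (simp add: covers_iff)
  qed
qed

text \<open>A partial complement \<open>c\<close>, with \<open>a \<sqinter> c = x\<close>, starts at
  \<open>x\<close> and is enlarged by atoms. While \<open>a \<squnion> c\<close> is not the top,
  some atom \<open>t\<close> is not below it, and \<open>c \<squnion> t\<close> still meets
  \<open>a\<close> in \<open>x\<close>.\<close>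

lemma star_complemented:
  assumes x: "x \<in> carrier L"
  shows "complemented_between L x (star L x)"
  unfolding complemented_between_def
proof (intro conjI ballI)
  let ?s = "star L x"
  fix a assume "a \<in> \<lbrace>x..?s\<rbrace>"
  then have a: "a \<in> carrier L" "x \<sqsubseteq> a" "a \<sqsubseteq> ?s" by (auto simp: at_least_at_most_def)
  have s: "?s \<in> carrier L" "x \<sqsubseteq> ?s" using star_closed le_star x by auto
  have mod: "c \<squnion> (b \<sqinter> d) = (c \<squnion> b) \<sqinter> d" if "c \<in> carrier L" "b \<in> carrier L" "d \<in> carrier L" "c \<sqsubseteq> d" for b c d
    using L_modular that by (simp add: modular_lattice_def)
  have "x \<sqsubseteq> c \<longrightarrow> a \<sqinter> c = x \<longrightarrow> (\<exists>b\<in>\<lbrace>x..?s\<rbrace>. a \<squnion> b = ?s \<and> a \<sqinter> b = x)"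
    if "c \<in> carrier L" "c \<sqsubseteq> ?s" for c
    using L_lattice L_finite that(1) s(1) that(2)
  proof (induction c rule: interval_induct)
    case (step c)
    show ?case
    proof (intro impI)
      assume c: "x \<sqsubseteq> c" "a \<sqinter> c = x"
      note cL = step.hyps
      show "\<exists>b\<in>\<lbrace>x..?s\<rbrace>. a \<squnion> b = ?s \<and> a \<sqinter> b = x"
      proof (cases "?s \<sqsubseteq> a \<squnion> c")
        case True
        then have "a \<squnion> c = ?s" using a s cL by (intro le_antisym) (auto intro: join_le)
        then show ?thesis using c cL by (intro bexI[of _ c]) (auto simp: at_least_at_most_def)
      next
        case False
        have "x \<sqsubseteq> a \<squnion> c" using le_trans[OF a(2) join_left] a cL x by simp
        then obtain t where t: "covers L x t" "\<not> t \<sqsubseteq> a \<squnion> c"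
          using star_least[OF x, of "a \<squnion> c"] False a cL by auto
        have tL: "t \<in> carrier L" "x \<sqsubseteq> t" using t by (auto simp: covers_iff)
        have ts: "t \<sqsubseteq> ?s" using cover_le_star[OF x t(1)] .
        have "t \<sqinter> (a \<squnion> c) = x \<or> t \<sqinter> (a \<squnion> c) = t"
        proof -
          have "x \<sqsubseteq> t \<sqinter> (a \<squnion> c)" using tL a cL x \<open>x \<sqsubseteq> a \<squnion> c\<close> by (intro meet_le) auto
          then show ?thesis using t(1) tL a cL meet_left[of t "a \<squnion> c"] by (auto simp: covers_iff)
        qed
        moreover have "t \<sqinter> (a \<squnion> c) \<noteq> t" using t(2) meet_right[of t "a \<squnion> c"] tL a cL by auto
        ultimately have m: "t \<sqinter> (a \<squnion> c) = x" by blast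
        \<comment> \<open>Since \<open>t\<close> meets \<open>a \<squnion> c\<close> only in
          \<open>x\<close>, the modular law shows that adding \<open>t\<close> to \<open>c\<close>
          gains nothing below \<open>a \<squnion> c\<close>, in particular nothing below
          \<open>a\<close>.\<close>
        have e: "(c \<squnion> t) \<sqinter> (a \<squnion> c) = c"
          using mod[of c t "a \<squnion> c"] m c cL tL a x join_right[of a c] by (simp add: join_absorb2)
        have ct: "c \<squnion> t \<in> carrier L" "c \<sqsubseteq> c \<squnion> t" "t \<sqsubseteq> c \<squnion> t" "c \<squnion> t \<sqsubseteq> ?s"
          using cL tL ts s by (auto intro: join_left join_right join_le)
        have xct: "x \<sqsubseteq> c \<squnion> t" using le_trans[OF c(1) ct(2)] x cL ct by simp
        have "a \<sqinter> (c \<squnion> t) = x"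
        proof (rule meet_eqI)
          fix u assume u: "u \<in> carrier L" "u \<sqsubseteq> a" "u \<sqsubseteq> c \<squnion> t"
          have "u \<sqsubseteq> a \<squnion> c" using le_trans[OF u(2) join_left] u a cL by simp
          then have "u \<sqsubseteq> c" using meet_le[of u "c \<squnion> t" "a \<squnion> c"] u ct a cL e by simp
          then show "u \<sqsubseteq> x" using meet_le[of u a c] u a cL c by simp
        qed (use a ct xct x in auto)
        moreover have "c \<noteq> c \<squnion> t"
          using t(2) ct tL le_trans[OF ct(3), of "a \<squnion> c"] join_right[of a c] a cL by auto
        ultimately show ?thesis using step.IH[OF ct(1,2) _ ct(4)] xct by blast
      qed
    qed
  qed
  then show "\<exists>b\<in>\<lbrace>x..?s\<rbrace>. a \<squnion> b = ?s \<and> a \<sqinter> b = x"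
    using x s meet_absorb2[OF a(2)] a by blast
qed (use x star_closed le_star in auto)

lemma complemented_between_iff:
  "complemented_between L x y \<longleftrightarrow> x \<in> carrier L \<and> y \<in> carrier L \<and> x \<sqsubseteq> y \<and> y \<sqsubseteq> star L x"
proof
  assume c: "complemented_between L x y"
  then have xy: "x \<in> carrier L" "y \<in> carrier L" "x \<sqsubseteq> y" by (auto simp: complemented_between_def)
  have "y \<sqsubseteq> star L x"
    by (rule complemented_between_top_le[OF L_lattice L_finite c star_closed[OF xy(1)] le_star[OF xy(1)]])
      (rule cover_le_star[OF xy(1)])
  then show "x \<in> carrier L \<and> y \<in> carrier L \<and> x \<sqsubseteq> y \<and> y \<sqsubseteq> star L x" using xy by blast
next
  assume xy: "x \<in> carrier L \<and> y \<in> carrier L \<and> x \<sqsubseteq> y \<and> y \<sqsubseteq> star L x"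
  then show "complemented_between L x y"
    by (intro complemented_between_sub[OF L_modular star_complemented[of x]]) auto
qed

text \<open>With \<open>complemented_between_iff\<close> this shows, for \<open>x\<close> below
  \<open>y\<close>, that \<open>y\<close> is below \<open>star L x\<close> exactly if
  \<open>costar L y\<close> is below \<open>x\<close>; the Galois identities follow.\<close>

lemma complemented_between_iff':
  "complemented_between L x y \<longleftrightarrow> x \<in> carrier L \<and> y \<in> carrier L \<and> x \<sqsubseteq> y \<and> costar L y \<sqsubseteq> x"
  using modular_lffc.complemented_between_iff[OF dual, of y x]
  by (auto simp: complemented_between_dual)

lemma costar_closed: "x \<in> carrier L \<Longrightarrow> costar L x \<in> carrier L"
  and costar_le: "x \<in> carrier L \<Longrightarrow> costar L x \<sqsubseteq> x"
  and costar_mono: "x \<in> carrier L \<Longrightarrow> y \<in> carrier L \<Longrightarrow> x \<sqsubseteq> y \<Longrightarrow> costar L x \<sqsubseteq> costar L y"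
  using modular_lffc.star_closed[OF dual] modular_lffc.le_star[OF dual]
    modular_lffc.star_mono[OF dual] by auto

lemma costar_star_le: "x \<in> carrier L \<Longrightarrow> costar L (star L x) \<sqsubseteq> x"
  using complemented_between_iff' star_complemented by blast

lemma le_star_costar: "x \<in> carrier L \<Longrightarrow> x \<sqsubseteq> star L (costar L x)"
  using modular_lffc.costar_star_le[OF dual, of x] by (simp add: gorder_collapse)

lemma star_costar_star:
  assumes "x \<in> carrier L"
  shows "star L (costar L (star L x)) = star L x"
  using assms star_closed costar_closed costar_star_le[of x] le_star_costar[of "star L x"]
    star_mono[of "costar L (star L x)" x] by (intro le_antisym) auto

lemma costar_star_costar: "x \<in> carrier L \<Longrightarrow> costar L (star L (costar L x)) = costar L x"
  using modular_lffc.star_costar_star[OF dual, of x] by (simp add: gorder_collapse)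

section \<open>Blocks as closed pairs of the Galois connection\<close>

abbreviation "Blocks \<equiv> lattice_blocks L"
abbreviation lo where "lo B \<equiv> \<bottom>\<^bsub>L\<lparr>carrier := B\<rparr>\<^esub>"
abbreviation hi where "hi B \<equiv> \<top>\<^bsub>L\<lparr>carrier := B\<rparr>\<^esub>"

text \<open>For a larger complemented interval from \<open>u\<close> to \<open>v\<close>,
  monotonicity gives that \<open>v\<close> is below \<open>star L u\<close>, hence below
  \<open>star L x\<close>; applying \<open>costar\<close> to the upper ends gives that
  \<open>x\<close> is below \<open>u\<close>.\<close>

lemma closed_block:
  assumes x: "x \<in> carrier L" and closed: "costar L (star L x) = x"
  defines "B \<equiv> \<lbrace>x..star L x\<rbrace>"
  shows "B \<in> Blocks" "lo B = x" "hi B = star L x"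
proof -
  let ?s = "star L x"
  have s: "?s \<in> carrier L" "x \<sqsubseteq> ?s" using star_closed le_star x by auto
  show "lo B = x" "hi B = ?s" using interval_lattice(4,5)[OF x s] by (simp_all add: B_def)
  note compl = complemented_interval_between[OF L_lattice]
  have "B' = B" if B': "complemented_interval L B'" "B \<subseteq> B'" for B'
  proof -
    obtain u v where uv: "complemented_between L u v" "B' = \<lbrace>u..v\<rbrace>" using B' compl by blast
    note c = uv(1)[unfolded complemented_between_iff] and c' = uv(1)[unfolded complemented_between_iff']
    have le: "u \<sqsubseteq> x" "?s \<sqsubseteq> v" using B'(2) uv interval_subset_iff[OF x s(1) _ _ s(2)] c by (auto simp: B_def)
    have "v \<sqsubseteq> ?s" using le_trans[of v "star L u" ?s] star_mono[of u x] c x s le star_closed by simp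
    moreover have "x \<sqsubseteq> u"
      using le_trans[of x "costar L v" u] costar_mono[of ?s v] closed c c' x s le costar_closed by simp
    ultimately have "u = x" "v = ?s" using le c x s by (auto intro: le_antisym)
    then show ?thesis using uv by (simp add: B_def)
  qed
  moreover have "complemented_interval L B"
    using compl star_complemented[OF x] by (auto simp: B_def)
  ultimately show "B \<in> Blocks" by (auto simp: lattice_blocks_def)
qed

text \<open>The intervals from \<open>x\<close> to \<open>star L x\<close> and from
  \<open>costar L y\<close> to \<open>y\<close> are complemented and contain the block, so
  maximality makes both equal to it.\<close>

lemma block_bounds:
  assumes B: "B \<in> Blocks"
  shows "lo B \<in> carrier L" "hi B \<in> carrier L" "lo B \<sqsubseteq> hi B" "B = \<lbrace>lo B..hi B\<rbrace>"
    "hi B = star L (lo B)" "lo B = costar L (hi B)"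
proof -
  note compl = complemented_interval_between[OF L_lattice]
  obtain x y where xy: "complemented_between L x y" "B = \<lbrace>x..y\<rbrace>"
    using B compl by (auto simp: lattice_blocks_def)
  note c = xy(1)[unfolded complemented_between_iff] and c' = xy(1)[unfolded complemented_between_iff']
  have eq: "lo B = x" "hi B = y" using interval_lattice(4,5)[of x y] c xy by auto
  show "lo B \<in> carrier L" "hi B \<in> carrier L" "lo B \<sqsubseteq> hi B" "B = \<lbrace>lo B..hi B\<rbrace>"
    using eq c xy by auto
  have max: "\<lbrace>u..v\<rbrace> = \<lbrace>x..y\<rbrace>" if "complemented_between L u v" "u \<sqsubseteq> x" "y \<sqsubseteq> v" for u v
  proof -
    have "u \<in> carrier L" "v \<in> carrier L" using that by (auto simp: complemented_between_def)
    then have "B \<subseteq> \<lbrace>u..v\<rbrace>" using interval_subset_iff[of x y u v] that c xy by simp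
    moreover have "complemented_interval L \<lbrace>u..v\<rbrace>" using compl that(1) by blast
    ultimately have "\<lbrace>u..v\<rbrace> = B" using B unfolding lattice_blocks_def by blast
    then show ?thesis using xy(2) by simp
  qed
  have "\<lbrace>x..star L x\<rbrace> = \<lbrace>x..y\<rbrace>"
    using max[OF star_complemented[of x]] c by auto
  then show "hi B = star L (lo B)"
    using interval_eq_iff[of x "star L x" x y] c star_closed le_star eq by auto
  have "\<lbrace>costar L y..y\<rbrace> = \<lbrace>x..y\<rbrace>"
    using max[of "costar L y" y] modular_lffc.star_complemented[OF dual, of y] c c'
    by (auto simp: complemented_between_dual)
  then show "lo B = costar L (hi B)"
    using interval_eq_iff[of "costar L y" y x y] c costar_closed costar_le eq by auto
qed

lemma mem_block_iff: "B \<in> Blocks \<Longrightarrow> a \<in> B \<longleftrightarrow> a \<in> carrier L \<and> lo B \<sqsubseteq> a \<and> a \<sqsubseteq> hi B"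
  using block_bounds(4)[of B] by (auto simp: at_least_at_most_def)

lemma block_eqI: "B \<in> Blocks \<Longrightarrow> B' \<in> Blocks \<Longrightarrow> lo B = lo B' \<Longrightarrow> B = B'"
  using block_bounds(4,5)[of B] block_bounds(4,5)[of B'] by metis

lemma hi_le_iff: "B \<in> Blocks \<Longrightarrow> B' \<in> Blocks \<Longrightarrow> hi B \<sqsubseteq> hi B' \<longleftrightarrow> lo B \<sqsubseteq> lo B'"
  using block_bounds[of B] block_bounds[of B'] star_mono[of "lo B" "lo B'"]
    costar_mono[of "hi B" "hi B'"] by metis

text \<open>Passing to \<open>costar L (star L x)\<close> makes \<open>x\<close> closed without
  changing \<open>star L x\<close>. The block found contains \<open>x\<close> together with all its
  upper covers.\<close>

lemma block_around:
  assumes x: "x \<in> carrier L"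
  obtains B where "B \<in> Blocks" "lo B = costar L (star L x)" "hi B = star L x" "x \<in> B"
proof -
  let ?y = "costar L (star L x)"
  have y: "?y \<in> carrier L" "costar L (star L ?y) = ?y" "star L ?y = star L x"
    using star_costar_star costar_star_costar star_closed costar_closed x by auto
  note b = closed_block[OF y(1,2)]
  have "x \<in> \<lbrace>?y..star L ?y\<rbrace>"
    using x costar_star_le[OF x] le_star[OF x] y(3) by (simp add: at_least_at_most_def)
  then show thesis using that[OF b(1)] b y(3) by simp
qed

section \<open>The skeleton of the dissection\<close>

abbreviation D where "D \<equiv> dissection L"
abbreviation S where "S \<equiv> skel D"

lemma S_simps: "carrier S = Blocks" "eq S = (=)" "le S B C \<longleftrightarrow> lo B \<sqsubseteq> lo C"
  by (simp_all add: dissection_def)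

lemma S_partial_order: "partial_order S"
proof
  show "B .=\<^bsub>S\<^esub> C" if "B \<sqsubseteq>\<^bsub>S\<^esub> C" "C \<sqsubseteq>\<^bsub>S\<^esub> B" "B \<in> carrier S" "C \<in> carrier S" for B C
    using that block_eqI[of B C] le_antisym[of "lo B" "lo C"] block_bounds(1) by (simp add: S_simps)
  show "B \<sqsubseteq>\<^bsub>S\<^esub> C" if "B \<sqsubseteq>\<^bsub>S\<^esub> E" "E \<sqsubseteq>\<^bsub>S\<^esub> C" "B \<in> carrier S" "E \<in> carrier S" "C \<in> carrier S" for B C E
    using that block_bounds(1) le_trans[of "lo B" "lo E" "lo C"] by (simp add: S_simps)
qed (use block_bounds(1) in \<open>auto simp: S_simps\<close>)

text \<open>The map taking \<open>x\<close> to \<open>costar L (star L x)\<close> is monotone and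
  decreasing, and the bottoms of blocks are its fixed points; these are closed under joins.\<close>

lemma S_sup:
  assumes B: "B \<in> Blocks" and C: "C \<in> Blocks"
  shows "\<exists>J\<in>Blocks. lo J = lo B \<squnion> lo C \<and> least S J (Upper S {B, C})"
proof -
  note b = block_bounds(1-3)[OF B] and c = block_bounds(1-3)[OF C]
  let ?j = "lo B \<squnion> lo C"
  have j: "?j \<in> carrier L" "lo B \<sqsubseteq> ?j" "lo C \<sqsubseteq> ?j" using b c by (auto intro: join_left join_right)
  have "lo B \<sqsubseteq> costar L (star L ?j)" "lo C \<sqsubseteq> costar L (star L ?j)"
    using block_bounds(5,6)[OF B] block_bounds(5,6)[OF C] b c j
      costar_mono[OF star_closed star_closed star_mono] by metis+
  then have "?j \<sqsubseteq> costar L (star L ?j)" using b c j costar_closed star_closed by (simp add: join_le)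
  then have "costar L (star L ?j) = ?j"
    using costar_star_le[OF j(1)] j costar_closed star_closed by (simp add: le_antisym)
  note J = closed_block[OF j(1) this]
  have "least S \<lbrace>?j..star L ?j\<rbrace> (Upper S {B, C})"
  proof (rule least_UpperI)
    show "E \<sqsubseteq>\<^bsub>S\<^esub> \<lbrace>?j..star L ?j\<rbrace>" if "E \<in> {B, C}" for E
      using that j J(2) by (auto simp: S_simps)
    show "\<lbrace>?j..star L ?j\<rbrace> \<sqsubseteq>\<^bsub>S\<^esub> E" if "E \<in> Upper S {B, C}" for E
    proof -
      have "E \<in> Blocks" "lo B \<sqsubseteq> lo E" "lo C \<sqsubseteq> lo E" using that B C by (auto simp: S_simps Upper_def)
      then show ?thesis using b(1) c(1) block_bounds(1) J(2) by (simp add: S_simps join_le)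
    qed
  qed (use B C J(1) in \<open>auto simp: S_simps\<close>)
  then show ?thesis using J by blast
qed

text \<open>Tops of blocks are closed under meets, for the mirrored reason. \<open>hi_le_iff\<close>
  translates back to the order by bottoms.\<close>

lemma S_inf:
  assumes B: "B \<in> Blocks" and C: "C \<in> Blocks"
  shows "\<exists>M\<in>Blocks. hi M = hi B \<sqinter> hi C \<and> greatest S M (Lower S {B, C})"
proof -
  note b = block_bounds(1-3)[OF B] and c = block_bounds(1-3)[OF C]
  let ?m = "hi B \<sqinter> hi C"
  have m: "?m \<in> carrier L" "?m \<sqsubseteq> hi B" "?m \<sqsubseteq> hi C" using b c by (auto intro: meet_left meet_right)
  have "star L (costar L ?m) \<sqsubseteq> hi B" "star L (costar L ?m) \<sqsubseteq> hi C"
    using block_bounds(5,6)[OF B] block_bounds(5,6)[OF C] b c m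
      star_mono[OF costar_closed costar_closed costar_mono] by metis+
  then have "star L (costar L ?m) \<sqsubseteq> ?m" using b c m costar_closed star_closed by (simp add: meet_le)
  then have eq: "star L (costar L ?m) = ?m"
    using le_star_costar[OF m(1)] m costar_closed star_closed by (simp add: le_antisym)
  have "costar L (star L (costar L ?m)) = costar L ?m" using eq by simp
  note M = closed_block[OF costar_closed[OF m(1)] this, unfolded eq]
  let ?M = "\<lbrace>costar L ?m..?m\<rbrace>"
  have "greatest S ?M (Lower S {B, C})"
  proof (rule greatest_LowerI)
    show "?M \<sqsubseteq>\<^bsub>S\<^esub> E" if "E \<in> {B, C}" for E
      using that B C M m hi_le_iff[of ?M E] by (auto simp: S_simps)
    show "E \<sqsubseteq>\<^bsub>S\<^esub> ?M" if "E \<in> Lower S {B, C}" for E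
    proof -
      have E: "E \<in> Blocks" "lo E \<sqsubseteq> lo B" "lo E \<sqsubseteq> lo C" using that B C by (auto simp: S_simps Lower_def)
      then have "hi E \<sqsubseteq> ?m" using hi_le_iff B C b c block_bounds(2)[OF E(1)] by (simp add: meet_le)
      then show ?thesis using hi_le_iff[OF E(1) M(1)] M(3) by (simp add: S_simps)
    qed
  qed (use B C M in \<open>auto simp: S_simps\<close>)
  then show ?thesis using M by blast
qed

lemma S_lattice: "lattice S"
proof -
  interpret S: partial_order S by (rule S_partial_order)
  show ?thesis
    by unfold_locales (use S_sup S_inf in \<open>simp add: S_simps(1), blast\<close>)+
qed

lemma S_join:
  assumes B: "B \<in> Blocks" and C: "C \<in> Blocks"
  shows "B \<squnion>\<^bsub>S\<^esub> C \<in> Blocks" "lo (B \<squnion>\<^bsub>S\<^esub> C) = lo B \<squnion> lo C"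
proof -
  interpret S: lattice S by (rule S_lattice)
  have "least S (B \<squnion>\<^bsub>S\<^esub> C) (Upper S {B, C})"
    unfolding join_def using B C by (intro S.sup_of_two_least) (auto simp: S_simps)
  then show "B \<squnion>\<^bsub>S\<^esub> C \<in> Blocks" "lo (B \<squnion>\<^bsub>S\<^esub> C) = lo B \<squnion> lo C"
    using S_sup[OF B C] S.least_unique by blast+
qed

lemma S_meet:
  assumes B: "B \<in> Blocks" and C: "C \<in> Blocks"
  shows "B \<sqinter>\<^bsub>S\<^esub> C \<in> Blocks" "hi (B \<sqinter>\<^bsub>S\<^esub> C) = hi B \<sqinter> hi C"
proof -
  interpret S: lattice S by (rule S_lattice)
  have "greatest S (B \<sqinter>\<^bsub>S\<^esub> C) (Lower S {B, C})"
    unfolding meet_def using B C by (intro S.inf_of_two_greatest) (auto simp: S_simps)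
  then show "B \<sqinter>\<^bsub>S\<^esub> C \<in> Blocks" "hi (B \<sqinter>\<^bsub>S\<^esub> C) = hi B \<sqinter> hi C"
    using S_inf[OF B C] S.greatest_unique by blast+
qed

lemma S_covers_iff:
  "covers S B C \<longleftrightarrow> B \<in> Blocks \<and> C \<in> Blocks \<and> lo B \<sqsubseteq> lo C \<and> B \<noteq> C \<and>
     (\<forall>E\<in>Blocks. lo B \<sqsubseteq> lo E \<longrightarrow> lo E \<sqsubseteq> lo C \<longrightarrow> E = B \<or> E = C)"
  using gorder_lattice.covers_iff[of S B C] S_lattice by (simp add: gorder_lattice_iff S_simps)

text \<open>If \<open>C\<close> covers \<open>B\<close> and \<open>lo C\<close> were not in \<open>B\<close>, one would find a block strictly between
  them around a cover of \<open>hi B \<sqinter> lo C\<close> or around this element itself.\<close>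

lemma cover_overlap:
  assumes cov: "covers S B C"
  shows "lo C \<sqsubseteq> hi B"
proof (rule ccontr)
  assume n: "\<not> lo C \<sqsubseteq> hi B"
  have B: "B \<in> Blocks" and C: "C \<in> Blocks" and le: "lo B \<sqsubseteq> lo C" and ne: "B \<noteq> C"
    and btw: "\<And>E. E \<in> Blocks \<Longrightarrow> lo B \<sqsubseteq> lo E \<Longrightarrow> lo E \<sqsubseteq> lo C \<Longrightarrow> E = B \<or> E = C"
    using cov by (auto simp: S_covers_iff)
  note b = block_bounds(1-3)[OF B] and c = block_bounds(1-3)[OF C]
  let ?m = "hi B \<sqinter> lo C"
  have m: "?m \<in> carrier L" "?m \<sqsubseteq> hi B" "?m \<sqsubseteq> lo C" "lo B \<sqsubseteq> ?m"
    using b c le by (auto intro: meet_left meet_right meet_le)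
  have mne: "?m \<noteq> lo C" using m n by auto
  then obtain t where t: "t \<in> carrier L" "covers L ?m t" "t \<sqsubseteq> lo C"
    using exists_upper_cover[OF L_lattice L_finite m(1) c(1) m(3)] by blast
  have mt: "?m \<sqsubseteq> t" "?m \<noteq> t" using t(2) by (auto simp: covers_iff)
  \<comment> \<open>The block around an element between \<open>lo B\<close> and \<open>lo C\<close>
    lies between \<open>B\<close> and \<open>C\<close> in the skeleton.\<close>
  have between: "E = B \<or> E = C"
    if "E \<in> Blocks" "lo E = costar L (star L x)" "hi E = star L x" "x \<in> carrier L" "lo B \<sqsubseteq> x" "x \<sqsubseteq> lo C" for E x
  proof (rule btw[OF that(1)])
    have "hi B \<sqsubseteq> hi E" using star_mono[OF b(1) that(4,5)] block_bounds(5)[OF B] that(3) by simp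
    then show "lo B \<sqsubseteq> lo E" using hi_le_iff[OF B that(1)] by simp
    show "lo E \<sqsubseteq> lo C"
      using le_trans[OF costar_star_le[OF that(4)] that(6)] that costar_closed star_closed c by simp
  qed
  \<comment> \<open>As \<open>t\<close> is not in \<open>B\<close>, its block is \<open>C\<close>.
    The bottom of that block is below \<open>t\<close>, so \<open>t = lo C\<close>.\<close>
  obtain E where E: "E \<in> Blocks" "lo E = costar L (star L t)" "hi E = star L t" "t \<in> E"
    using block_around[OF t(1)] by blast
  have "lo B \<sqsubseteq> t" using le_trans[OF m(4) mt(1)] b m t by simp
  then have "E = B \<or> E = C" using between[OF E(1-3) t(1) _ t(3)] by blast
  moreover have "E \<noteq> B"
  proof
    assume "E = B"
    then have "t \<sqsubseteq> hi B" using E(4) mem_block_iff[OF B] by blast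
    then have "t \<sqsubseteq> ?m" using t b c by (simp add: meet_le)
    then show False using mt t m le_antisym by blast
  qed
  ultimately have "lo C \<sqsubseteq> t" using E costar_star_le[OF t(1)] by simp
  then have tC: "t = lo C" using t c by (simp add: le_antisym)
  \<comment> \<open>As \<open>?m\<close> is strictly below \<open>lo C\<close>, its block is
    \<open>B\<close>. So \<open>hi B\<close> is \<open>star L ?m\<close> and lies above the cover
    \<open>t = lo C\<close>, a contradiction.\<close>
  obtain E' where E': "E' \<in> Blocks" "lo E' = costar L (star L ?m)" "hi E' = star L ?m" "?m \<in> E'"
    using block_around[OF m(1)] by blast
  have "E' = B \<or> E' = C" using between[OF E'(1-3) m(1,4,3)] .
  moreover have "E' \<noteq> C"
    using E'(2) costar_star_le[OF m(1)] le_antisym[OF m(3) _ m(1) c(1)] mne by auto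
  ultimately have "hi B = star L ?m" using E' by simp
  then show False using cover_le_star[OF m(1) t(2)] tC n by simp
qed

text \<open>A block is determined by its bottom and also by its top. By
  \<open>cover_overlap\<close>, upper covers of \<open>B\<close> have their bottoms in
  \<open>B\<close>, and lower covers of \<open>C\<close> have their tops in
  \<open>C\<close>.\<close>

lemma S_lffc: "lffc_lattice S"
proof -
  have inj: "inj_on lo Blocks" using block_eqI by (rule inj_onI)
  have inj': "inj_on hi Blocks" using block_eqI hi_le_iff block_bounds(1)
    by (intro inj_onI) (metis block_bounds(6))
  have fin: "finite \<lbrace>x..y\<rbrace>" if "x \<in> carrier L" "y \<in> carrier L" for x y
    using L_finite that by (simp add: locally_finite_def)
  have "finite \<lbrace>B..C\<rbrace>\<^bsub>S\<^esub>" if "B \<in> Blocks" "C \<in> Blocks" for B C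
  proof (rule finite_imageD)
    show "finite (lo ` \<lbrace>B..C\<rbrace>\<^bsub>S\<^esub>)"
      by (rule finite_subset[OF _ fin[of "lo B" "lo C"]])
        (use that block_bounds(1) in \<open>auto simp: at_least_at_most_def S_simps\<close>)
    show "inj_on lo \<lbrace>B..C\<rbrace>\<^bsub>S\<^esub>"
      using inj by (rule inj_on_subset) (auto simp: at_least_at_most_def S_simps)
  qed
  moreover have "finite {C. covers S B C}" if "B \<in> Blocks" for B
  proof (rule finite_imageD)
    show "finite (lo ` {C. covers S B C})"
      by (rule finite_subset[OF _ fin[of "lo B" "hi B"]])
        (use block_bounds(1,2) that cover_overlap[of B] in
          \<open>auto simp: at_least_at_most_def dest: S_covers_iff[THEN iffD1]\<close>)
    show "inj_on lo {C. covers S B C}"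
      using inj by (rule inj_on_subset) (auto simp: S_covers_iff)
  qed
  moreover have "finite {B. covers S B C}" if "C \<in> Blocks" for C
  proof (rule finite_imageD)
    show "finite (hi ` {B. covers S B C})"
      by (rule finite_subset[OF _ fin[of "lo C" "hi C"]])
        (use block_bounds(1,2) that cover_overlap hi_le_iff in
          \<open>auto simp: at_least_at_most_def dest: S_covers_iff[THEN iffD1]\<close>)
    show "inj_on hi {B. covers S B C}"
      using inj' by (rule inj_on_subset) (auto simp: S_covers_iff)
  qed
  ultimately show ?thesis
    using S_lattice by (auto simp: lffc_lattice_def locally_finite_def finite_covers_def S_simps(1))
qed

section \<open>Overlaps of blocks and the axioms of a modular connected system\<close>

lemma overlap_iff:
  assumes B: "B \<in> Blocks" and C: "C \<in> Blocks" and le: "lo B \<sqsubseteq> lo C"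
  shows "a \<in> B \<inter> C \<longleftrightarrow> a \<in> carrier L \<and> lo C \<sqsubseteq> a \<and> a \<sqsubseteq> hi B"
  using mem_block_iff[OF B] mem_block_iff[OF C] hi_le_iff[OF B C] le
    block_bounds(1,2)[OF B] block_bounds(1,2)[OF C] le_trans[of "lo B" "lo C" a] le_trans[of a "hi B" "hi C"]
  by auto

text \<open>The lower bound is the formula for the bottom of a join, the upper bound is monotonicity
  of tops. Applied to common elements of two pairs of blocks, this makes overlapping compatible with
  joins.\<close>

lemma mem_join_block:
  assumes B: "B \<in> Blocks" and C: "C \<in> Blocks" and a: "a \<in> B" "b \<in> C"
  shows "a \<squnion> b \<in> B \<squnion>\<^bsub>S\<^esub> C"
proof -
  note j = S_join[OF B C] and b = block_bounds(1-3)[OF B] and c = block_bounds(1-3)[OF C]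
  note jb = block_bounds(1-3)[OF j(1)]
  have a': "a \<in> carrier L" "lo B \<sqsubseteq> a" "a \<sqsubseteq> hi B" "b \<in> carrier L" "lo C \<sqsubseteq> b" "b \<sqsubseteq> hi C"
    using a mem_block_iff B C by auto
  have "lo B \<sqsubseteq> lo (B \<squnion>\<^bsub>S\<^esub> C)" "lo C \<sqsubseteq> lo (B \<squnion>\<^bsub>S\<^esub> C)"
    using j(2) b c by (auto intro: join_left join_right)
  then have h: "hi B \<sqsubseteq> hi (B \<squnion>\<^bsub>S\<^esub> C)" "hi C \<sqsubseteq> hi (B \<squnion>\<^bsub>S\<^esub> C)"
    using hi_le_iff j B C by auto
  have "lo (B \<squnion>\<^bsub>S\<^esub> C) \<sqsubseteq> a \<squnion> b"
    unfolding j(2) using a' b c le_trans[OF a'(2) join_left[of a b]] le_trans[OF a'(5) join_right[of a b]]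
    by (simp add: join_le)
  moreover have "a \<squnion> b \<sqsubseteq> hi (B \<squnion>\<^bsub>S\<^esub> C)"
    using a' b c jb le_trans[OF a'(3) h(1)] le_trans[OF a'(6) h(2)] by (simp add: join_le)
  ultimately show ?thesis using mem_block_iff[OF j(1)] a' by simp
qed

lemma mem_meet_block:
  assumes B: "B \<in> Blocks" and C: "C \<in> Blocks" and a: "a \<in> B" "b \<in> C"
  shows "a \<sqinter> b \<in> B \<sqinter>\<^bsub>S\<^esub> C"
proof -
  note j = S_meet[OF B C] and b = block_bounds(1-3)[OF B] and c = block_bounds(1-3)[OF C]
  note jb = block_bounds(1-3)[OF j(1)]
  have a': "a \<in> carrier L" "lo B \<sqsubseteq> a" "a \<sqsubseteq> hi B" "b \<in> carrier L" "lo C \<sqsubseteq> b" "b \<sqsubseteq> hi C"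
    using a mem_block_iff B C by auto
  have "hi (B \<sqinter>\<^bsub>S\<^esub> C) \<sqsubseteq> hi B" "hi (B \<sqinter>\<^bsub>S\<^esub> C) \<sqsubseteq> hi C"
    using j(2) b c by (auto intro: meet_left meet_right)
  then have h: "lo (B \<sqinter>\<^bsub>S\<^esub> C) \<sqsubseteq> lo B" "lo (B \<sqinter>\<^bsub>S\<^esub> C) \<sqsubseteq> lo C"
    using hi_le_iff[OF j(1) B] hi_le_iff[OF j(1) C] by auto
  have "a \<sqinter> b \<sqsubseteq> hi (B \<sqinter>\<^bsub>S\<^esub> C)"
    unfolding j(2) using a' b c le_trans[OF meet_left[of a b] a'(3)] le_trans[OF meet_right[of a b] a'(6)]
    by (simp add: meet_le)
  moreover have "lo (B \<sqinter>\<^bsub>S\<^esub> C) \<sqsubseteq> a \<sqinter> b"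
    using a' b c jb le_trans[OF h(1) a'(2)] le_trans[OF h(2) a'(5)] by (simp add: meet_le)
  ultimately show ?thesis using mem_block_iff[OF j(1)] a' by simp
qed

lemma mem_join_meet_block:
  assumes B: "B \<in> Blocks" and C: "C \<in> Blocks" and a: "a \<in> B" "a \<in> C"
  shows "a \<in> B \<squnion>\<^bsub>S\<^esub> C" "a \<in> B \<sqinter>\<^bsub>S\<^esub> C"
proof -
  have "a \<in> carrier L" using a mem_block_iff[OF B] by blast
  then show "a \<in> B \<squnion>\<^bsub>S\<^esub> C" "a \<in> B \<sqinter>\<^bsub>S\<^esub> C"
    using mem_join_block[OF B C a] mem_meet_block[OF B C a]
      join_absorb1[of a a] meet_absorb1[of a a] by simp_all
qed

lemma block_sublattice:
  assumes B: "B \<in> Blocks"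
  shows "lattice (L\<lparr>carrier := B\<rparr>)" "modular_lattice (L\<lparr>carrier := B\<rparr>)" "finite B"
    "complemented_lattice (L\<lparr>carrier := B\<rparr>)"
    "a \<in> B \<Longrightarrow> b \<in> B \<Longrightarrow> a \<squnion>\<^bsub>L\<lparr>carrier := B\<rparr>\<^esub> b = a \<squnion> b \<and> a \<squnion> b \<in> B"
    "a \<in> B \<Longrightarrow> b \<in> B \<Longrightarrow> a \<sqinter>\<^bsub>L\<lparr>carrier := B\<rparr>\<^esub> b = a \<sqinter> b \<and> a \<sqinter> b \<in> B"
proof -
  note b = block_bounds[OF B]
  note int = interval_lattice[OF b(1-3), folded b(4)]
  interpret bounded_lattice "L\<lparr>carrier := B\<rparr>" by (rule int(1))
  show lat: "lattice (L\<lparr>carrier := B\<rparr>)" by unfold_locales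
  show j: "a \<squnion>\<^bsub>L\<lparr>carrier := B\<rparr>\<^esub> b = a \<squnion>\<^bsub>L\<^esub> b \<and> a \<squnion>\<^bsub>L\<^esub> b \<in> B" if "a \<in> B" "b \<in> B" for a b
    using int(2)[OF that] join_closed[of a b] that by simp
  show m: "a \<sqinter>\<^bsub>L\<lparr>carrier := B\<rparr>\<^esub> b = a \<sqinter>\<^bsub>L\<^esub> b \<and> a \<sqinter>\<^bsub>L\<^esub> b \<in> B" if "a \<in> B" "b \<in> B" for a b
    using int(3)[OF that] meet_closed[of a b] that by simp
  show "modular_lattice (L\<lparr>carrier := B\<rparr>)"
    using L_modular lat j m mem_block_iff[OF B] by (simp add: modular_lattice_def)
  show "finite B" using L_finite b by (metis locally_finite_def)
  show "complemented_lattice (L\<lparr>carrier := B\<rparr>)"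
    using B by (simp add: lattice_blocks_def complemented_interval_def)
qed

lemma D_simps:
  "tol D B C \<longleftrightarrow> B \<inter> C \<noteq> {}" "block D B = L\<lparr>carrier := B\<rparr>" "fil D B C = B \<inter> C"
  "idl D B C = B \<inter> C" "conn D B C a = a"
  "le_tol D B C \<longleftrightarrow> B \<in> Blocks \<and> C \<in> Blocks \<and> lo B \<sqsubseteq> lo C \<and> B \<inter> C \<noteq> {}"
  unfolding idl_def le_tol_def by (simp_all add: dissection_def)

theorem dissection_mc_system: "mc_system D"
proof
  show "lffc_lattice S" by (rule S_lffc)
  show "tolerance S (tol D)"
    unfolding tolerance_def D_simps S_simps(1)
  proof (intro conjI ballI impI)
    fix B assume "B \<in> Blocks"
    then show "B \<inter> B \<noteq> {}" using mem_block_iff[of B "lo B"] block_bounds(1-3)[of B] by auto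
  next
    fix A B C E assume b: "A \<in> Blocks" "B \<in> Blocks" "C \<in> Blocks" "E \<in> Blocks"
      and "A \<inter> B \<noteq> {} \<and> C \<inter> E \<noteq> {}"
    then obtain p q where pq: "p \<in> A" "p \<in> B" "q \<in> C" "q \<in> E" by blast
    show "(A \<squnion>\<^bsub>S\<^esub> C) \<inter> (B \<squnion>\<^bsub>S\<^esub> E) \<noteq> {}"
      using mem_join_block[OF b(1,3) pq(1,3)] mem_join_block[OF b(2,4) pq(2,4)] by blast
    show "(A \<sqinter>\<^bsub>S\<^esub> C) \<inter> (B \<sqinter>\<^bsub>S\<^esub> E) \<noteq> {}"
      using mem_meet_block[OF b(1,3) pq(1,3)] mem_meet_block[OF b(2,4) pq(2,4)] by blast
  qed blast
next
  fix B assume "B \<in> carrier S"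
  then have B: "B \<in> Blocks" by (simp add: S_simps)
  show "finite (carrier (block D B)) \<and> modular_lattice (block D B) \<and> complemented_lattice (block D B)"
    using block_sublattice[OF B] by (simp add: D_simps)
  show "fil D B B = carrier (block D B) \<and> idl D B B = carrier (block D B) \<and>
      (\<forall>a\<in>carrier (block D B). conn D B B a = a)"
    by (simp add: D_simps)
next
  fix B C assume "le_tol D B C"
  then have B: "B \<in> Blocks" and C: "C \<in> Blocks" and le: "lo B \<sqsubseteq> lo C" and ne: "B \<inter> C \<noteq> {}"
    by (auto simp: D_simps)
  note b = block_bounds(1-3)[OF B] and c = block_bounds(1-3)[OF C] and ov = overlap_iff[OF B C le]
  have up: "y \<in> B \<inter> C" if "x \<in> B \<inter> C" "y \<in> B" "x \<sqsubseteq> y" for x y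
    using that ov mem_block_iff[OF B] c le_trans[of "lo C" x y] by blast
  have "lattice_filter (L\<lparr>carrier := B\<rparr>) (B \<inter> C)"
    unfolding lattice_filter_def using ne up block_sublattice(6)[OF B] block_sublattice(6)[OF C]
    by auto
  moreover have down: "y \<in> B \<inter> C" if "x \<in> B \<inter> C" "y \<in> C" "y \<sqsubseteq> x" for x y
    using that ov mem_block_iff[OF C] b le_trans[of y x "hi B"] by blast
  have "lattice_ideal (L\<lparr>carrier := C\<rparr>) (B \<inter> C)"
    unfolding lattice_ideal_def using ne down block_sublattice(5)[OF B] block_sublattice(5)[OF C]
    by auto
  moreover have "lattice_iso (L\<lparr>carrier := B \<inter> C\<rparr>) (L\<lparr>carrier := B \<inter> C\<rparr>) (\<lambda>a. a)"
  proof (rule lattice_iso_orderI)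
    have "B \<inter> C = \<lbrace>lo C..hi B\<rbrace>" using ov by (auto simp: at_least_at_most_def)
    moreover have "lo C \<sqsubseteq> hi B" using ne ov c b le_trans[of "lo C" _ "hi B"] by blast
    ultimately have "bounded_lattice (L\<lparr>carrier := B \<inter> C\<rparr>)" using interval_lattice(1) c b by simp
    then show "lattice (L\<lparr>carrier := B \<inter> C\<rparr>)" by (rule bounded_lattice.axioms)
  qed (simp_all add: eq_is_equal bij_betw_def)
  ultimately show "lattice_filter (block D B) (fil D B C) \<and> lattice_ideal (block D C) (idl D B C) \<and>
      lattice_iso ((block D B)\<lparr>carrier := fil D B C\<rparr>) ((block D C)\<lparr>carrier := idl D B C\<rparr>) (conn D B C)"
    by (simp add: D_simps(1-4) D_simps(5)[abs_def])
next
  fix B C E assume "le_tol D B C" "le_tol D C E" "idl D B C \<inter> fil D C E \<noteq> {}"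
  then show "tol D B E" by (auto simp: D_simps)
next
  fix B C E assume a: "B \<in> carrier S" "C \<in> carrier S" "E \<in> carrier S" "B \<sqsubseteq>\<^bsub>S\<^esub> E" "E \<sqsubseteq>\<^bsub>S\<^esub> C"
  then have b: "B \<in> Blocks" "C \<in> Blocks" "E \<in> Blocks" and le: "lo B \<sqsubseteq> lo E" "lo E \<sqsubseteq> lo C"
    by (auto simp: S_simps)
  have "p \<in> E" if "p \<in> B \<inter> C" for p
    using that mem_block_iff[of _ p] b block_bounds(1,2) hi_le_iff[OF b(1,3)] le
      le_trans[of "lo E" "lo C" p] le_trans[of p "hi B" "hi E"] by auto
  then show "fil D B C = {a \<in> fil D B E. conn D B E a \<in> idl D B E \<inter> fil D E C} \<and>
      idl D B C = conn D E C ` (idl D B E \<inter> fil D E C) \<and>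
      (\<forall>a\<in>fil D B C. conn D B C a = conn D E C (conn D B E a))"
    by (auto simp: D_simps)
next
  fix B C assume "B \<in> carrier S" "C \<in> carrier S"
  then have "B \<in> Blocks" "C \<in> Blocks" by (auto simp: S_simps)
  then show "idl D B (B \<squnion>\<^bsub>S\<^esub> C) \<inter> idl D C (B \<squnion>\<^bsub>S\<^esub> C) \<subseteq> idl D (B \<sqinter>\<^bsub>S\<^esub> C) (B \<squnion>\<^bsub>S\<^esub> C) \<and>
      fil D (B \<sqinter>\<^bsub>S\<^esub> C) B \<inter> fil D (B \<sqinter>\<^bsub>S\<^esub> C) C \<subseteq> fil D (B \<sqinter>\<^bsub>S\<^esub> C) (B \<squnion>\<^bsub>S\<^esub> C)"
    using mem_join_meet_block by (auto simp: D_simps)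
next
  fix B C assume cov: "covers S B C"
  then have b: "B \<in> Blocks" "C \<in> Blocks" "lo B \<sqsubseteq> lo C" "B \<noteq> C" by (auto simp: S_covers_iff)
  have "lo C \<in> B \<inter> C"
    using overlap_iff[OF b(1-3), of "lo C"] cover_overlap[OF cov] block_bounds(1-3)[OF b(2)] by simp
  then show "tol D B C" by (auto simp: D_simps)
  \<comment> \<open>Distinct maximal intervals are incomparable under inclusion.\<close>
  have "\<not> B \<subseteq> C" "\<not> C \<subseteq> B" using b by (auto simp: lattice_blocks_def)
  then show "fil D B C \<noteq> carrier (block D B) \<and> idl D B C \<noteq> carrier (block D C)"
    by (auto simp: D_simps)
qed

subsection \<open>Gluing the dissection\<close>

text \<open>Connections of the dissection are identities, so gluing identifies precisely the copies
  of one element; this is the resulting class.\<close>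

definition block_class :: "'a \<Rightarrow> ('a set \<times> 'a) set" where
  "block_class a = {(B, a) | B. B \<in> Blocks \<and> a \<in> B}"

lemma block_class_inj:
  assumes "a \<in> carrier L" "block_class a = block_class b"
  shows "a = b"
proof -
  obtain B where "B \<in> Blocks" "a \<in> B" using block_around[OF assms(1)] by blast
  then have "(B, a) \<in> block_class a" by (auto simp: block_class_def)
  then show ?thesis using assms(2) by (auto simp: block_class_def)
qed

interpretation M: mc_system D by (rule dissection_mc_system)

lemma proj_block_class:
  assumes "B \<in> Blocks" "a \<in> B"
  shows "proj D B a = block_class a"
proof -
  have "((B, a), (C, b)) \<in> glue_rel D \<longleftrightarrow> C \<in> Blocks \<and> b = a \<and> a \<in> C" for C b
    using M.rel_iff[of B a C b] mem_join_meet_block(1)[OF assms(1) _ assms(2)] assms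
    by (auto simp: D_simps S_simps)
  then show ?thesis by (auto simp: proj_def block_class_def)
qed

text \<open>A step inside a block is a comparison in \<open>L\<close>. Conversely, a comparison in
  \<open>L\<close> is climbed along covers, and each cover lies in the block around its lower
  end.\<close>

theorem lattice_iso_sum_dissection: "lattice_iso L (mc_sum D) block_class"
proof (rule lattice_iso_orderI)
  let ?G = "glue S (mc_blk D)"
  have blk: "carrier (mc_blk D B) = block_class ` B" if "B \<in> Blocks" for B
    using proj_block_class[OF that] by (auto simp: mc_blk_def sum_block_def D_simps)
  have at: "block_le S (mc_blk D) B (block_class a) (block_class b) \<longleftrightarrow> a \<sqsubseteq> b"
    if "B \<in> Blocks" "a \<in> B" "b \<in> B" for B a b
    using M.sum_le_at_proj[of B a b] proj_block_class that by (simp add: M.at_eq S_simps D_simps)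
  show "lattice L" by (rule L_lattice)
  show "eq (mc_sum D) = (=)" by (simp add: mc_sum_def)
  have "carrier ?G = block_class ` carrier L"
  proof -
    have "carrier ?G = (\<Union>B\<in>Blocks. block_class ` B)"
      using blk by (simp add: M.B.glue_carrier S_simps)
    also have "\<dots> = block_class ` (\<Union>B\<in>Blocks. B)" by blast
    also have "(\<Union>B\<in>Blocks. B) = carrier L"
      using block_around mem_block_iff by blast
    finally show ?thesis .
  qed
  then show "bij_betw block_class (carrier L) (carrier (mc_sum D))"
    unfolding M.mc_sum_glue bij_betw_def using block_class_inj by (auto intro: inj_onI)
  fix a b assume ab: "a \<in> carrier L" "b \<in> carrier L"
  have "a \<sqsubseteq> b" if le: "block_class a \<sqsubseteq>\<^bsub>?G\<^esub> block_class b"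
  proof -
    have "(\<lambda>p q. \<exists>x. block_le S (mc_blk D) x p q)\<^sup>*\<^sup>* (block_class a) (block_class b)"
      using le by (simp add: M.B.gle_iff)
    \<comment> \<open>The path runs through classes, so the induction keeps a representative above
      \<open>a\<close>.\<close>
    then have "\<exists>c\<in>carrier L. block_class b = block_class c \<and> a \<sqsubseteq> c"
    proof (induction rule: rtranclp_induct)
      case base
      then show ?case using ab by auto
    next
      case (step p q)
      then obtain c B where c: "c \<in> carrier L" "p = block_class c" "a \<sqsubseteq> c"
        and B: "block_le S (mc_blk D) B p q" by blast
      have BB: "B \<in> Blocks" using B by (simp add: block_le_def S_simps)
      obtain c' d where cd: "c' \<in> B" "p = block_class c'" "d \<in> B" "q = block_class d"
        using B blk[OF BB] by (auto simp: block_le_def)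
      have "c' = c" using block_class_inj c cd by metis
      then have "c \<sqsubseteq> d" "d \<in> carrier L" using at[OF BB, of c d] B cd mem_block_iff[OF BB] by auto
      then show ?case using le_trans[of a c d] ab c cd by blast
    qed
    then show ?thesis using block_class_inj ab by metis
  qed
  moreover have "block_class a \<sqsubseteq>\<^bsub>?G\<^esub> block_class b" if le: "a \<sqsubseteq> b"
    using L_lattice L_finite ab le
  proof (induction a rule: interval_induct)
    case (step a)
    obtain B where B: "B \<in> Blocks" "lo B = costar L (star L a)" "hi B = star L a" "a \<in> B"
      using block_around[OF step.hyps(1)] by blast
    show ?case
    proof (cases "a = b")
      case True
      then show ?thesis using M.B.at_gle at[OF B(1,4,4)] step.hyps by blast
    next
      case False
      then obtain t where t: "t \<in> carrier L" "covers L a t" "t \<sqsubseteq> b"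
        using exists_upper_cover[OF L_lattice L_finite step.hyps(1) ab(2) step.hyps(2)] by blast
      have at': "a \<sqsubseteq> t" "a \<noteq> t" using t by (auto simp: covers_iff)
      have "lo B \<sqsubseteq> t"
        using le_trans[of "lo B" a t] at' B mem_block_iff[OF B(1)] block_bounds(1)[OF B(1)] t step.hyps by simp
      then have "t \<in> B" using mem_block_iff[OF B(1)] t cover_le_star[OF step.hyps(1) t(2)] B(3) by simp
      then have "block_class a \<sqsubseteq>\<^bsub>?G\<^esub> block_class t" using M.B.at_gle at[OF B(1,4)] at' by blast
      then show ?thesis using step.IH[OF t(1) at' t(3)] M.B.gle_trans by blast
    qed
  qed
  ultimately show "block_class a \<sqsubseteq>\<^bsub>mc_sum D\<^esub> block_class b \<longleftrightarrow> a \<sqsubseteq> b"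
    unfolding M.mc_sum_glue by blast
qed

end

section \<open>Functoriality\<close>

lemma le_tol_iso:
  assumes "mc_iso C C' f g" "le_tol C x y"
  shows "le_tol C' (f x) (f y)"
  using assms lattice_iso_orderD(3,4)[of "skel C" "skel C'" f]
  by (auto simp: mc_iso_def le_tol_def bij_betw_apply)

lemma mc_iso_comp:
  assumes f: "mc_iso C C' f g" and f': "mc_iso C' C'' f' g'"
  shows "mc_iso C C'' (f' \<circ> f) (\<lambda>x. g' (f x) \<circ> g x)"
proof -
  have S: "lattice_iso (skel C) (skel C') f" "lattice_iso (skel C') (skel C'') f'"
    using f f' by (auto simp: mc_iso_def)
  have im: "f x \<in> carrier (skel C')" if "x \<in> carrier (skel C)" for x
    using lattice_iso_orderD(3)[OF S(1)] that by (rule bij_betw_apply)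
  have "fil C'' (f' (f x)) (f' (f y)) = (g' (f x) \<circ> g x) ` fil C x y \<and>
        idl C'' (f' (f x)) (f' (f y)) = (g' (f y) \<circ> g y) ` idl C x y \<and>
        (\<forall>a\<in>fil C x y. g' (f y) (g y (conn C x y a)) = conn C'' (f' (f x)) (f' (f y)) (g' (f x) (g x a)))"
    if xy: "le_tol C x y" for x y
  proof -
    have 1: "fil C' (f x) (f y) = g x ` fil C x y" "idl C' (f x) (f y) = g y ` idl C x y"
      "\<forall>a\<in>fil C x y. g y (conn C x y a) = conn C' (f x) (f y) (g x a)"
      using f xy by (auto simp: mc_iso_def)
    have 2: "fil C'' (f' (f x)) (f' (f y)) = g' (f x) ` fil C' (f x) (f y)"
      "idl C'' (f' (f x)) (f' (f y)) = g' (f y) ` idl C' (f x) (f y)"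
      "\<forall>a\<in>fil C' (f x) (f y). g' (f y) (conn C' (f x) (f y) a) = conn C'' (f' (f x)) (f' (f y)) (g' (f x) a)"
      using f' le_tol_iso[OF f xy] by (auto simp: mc_iso_def)
    show ?thesis using 1 2 by (simp add: image_comp)
  qed
  moreover have "lattice_iso (block C x) (block C'' (f' (f x))) (g' (f x) \<circ> g x)"
    if "x \<in> carrier (skel C)" for x
    using f f' im[OF that] that by (intro lattice_iso_comp) (auto simp: mc_iso_def)
  moreover have "tol C x y \<longleftrightarrow> tol C'' (f' (f x)) (f' (f y))"
    if "x \<in> carrier (skel C)" "y \<in> carrier (skel C)" for x y
    using f f' im that by (simp add: mc_iso_def)
  ultimately show ?thesis
    unfolding mc_iso_def using lattice_iso_comp[OF S] by simp
qed

text \<open>The system axioms of \<open>C\<close> keep filters and ideals inside the carriers of the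
  blocks, where \<open>inv_into\<close> inverts the block maps.\<close>

lemma mc_iso_inverse:
  assumes C: "mc_system C" and f: "mc_iso C C' f g"
  defines "f' \<equiv> inv_into (carrier (skel C)) f"
  shows "mc_iso C' C f' (\<lambda>x. inv_into (carrier (block C (f' x))) (g (f' x)))"
proof -
  interpret mc_system C by (rule C)
  let ?g = "\<lambda>x. inv_into (carrier (block C (f' x))) (g (f' x))"
  have iso: "lattice_iso (skel C) (skel C') f" using f by (simp add: mc_iso_def)
  note fi = lattice_iso_orderD(3)[OF iso]
  have f': "f' x \<in> carrier (skel C)" "f (f' x) = x" if "x \<in> carrier (skel C')" for x
    using that fi by (auto simp: f'_def bij_betw_def inv_into_into f_inv_into_f)
  have gi: "lattice_iso (block C x) (block C' (f x)) (g x)" if "x \<in> carrier (skel C)" for x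
    using f that by (simp add: mc_iso_def)
  have ginv: "inv_into (carrier (block C x)) (g x) (g x a) = a"
    if "x \<in> carrier (skel C)" "a \<in> carrier (block C x)" for x a
    using lattice_iso_orderD(3)[OF gi[OF that(1)]] that(2) by (rule bij_betw_inv_into_left)
  have "lattice_iso (skel C') (skel C) f'" unfolding f'_def by (rule lattice_iso_inv_into[OF iso])
  moreover have "lattice_iso (block C' x) (block C (f' x)) (?g x)" if "x \<in> carrier (skel C')" for x
    using lattice_iso_inv_into[OF gi[OF f'(1)[OF that]]] f'(2)[OF that] by simp
  moreover have tol: "tol C' x y \<longleftrightarrow> tol C (f' x) (f' y)"
    if "x \<in> carrier (skel C')" "y \<in> carrier (skel C')" for x y
    using f f'(1)[OF that(1)] f'(1)[OF that(2)] f'(2)[OF that(1)] f'(2)[OF that(2)]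
    by (auto simp: mc_iso_def)
  moreover have "fil C (f' x) (f' y) = ?g x ` fil C' x y \<and> idl C (f' x) (f' y) = ?g y ` idl C' x y \<and>
      (\<forall>a\<in>fil C' x y. ?g y (conn C' x y a) = conn C (f' x) (f' y) (?g x a))"
    if xy: "le_tol C' x y" for x y
  proof -
    have c: "x \<in> carrier (skel C')" "y \<in> carrier (skel C')" "x \<sqsubseteq>\<^bsub>skel C'\<^esub> y" "tol C' x y"
      using xy by (auto simp: le_tol_def)
    note x = f'[OF c(1)] and y = f'[OF c(2)]
    have le: "le_tol C (f' x) (f' y)"
      using lattice_iso_orderD(4)[OF iso x(1) y(1)] c x y tol[OF c(1,2)] by (simp add: le_tol_def)
    have e: "fil C' x y = g (f' x) ` fil C (f' x) (f' y)" "idl C' x y = g (f' y) ` idl C (f' x) (f' y)"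
      "\<And>a. a \<in> fil C (f' x) (f' y) \<Longrightarrow> g (f' y) (conn C (f' x) (f' y) a) = conn C' x y (g (f' x) a)"
    proof -
      have "fil C' (f (f' x)) (f (f' y)) = g (f' x) ` fil C (f' x) (f' y)"
        "idl C' (f (f' x)) (f (f' y)) = g (f' y) ` idl C (f' x) (f' y)"
        "\<forall>a\<in>fil C (f' x) (f' y).
          g (f' y) (conn C (f' x) (f' y) a) = conn C' (f (f' x)) (f (f' y)) (g (f' x) a)"
        using f le unfolding mc_iso_def by blast+
      then show "fil C' x y = g (f' x) ` fil C (f' x) (f' y)" "idl C' x y = g (f' y) ` idl C (f' x) (f' y)"
        "\<And>a. a \<in> fil C (f' x) (f' y) \<Longrightarrow> g (f' y) (conn C (f' x) (f' y) a) = conn C' x y (g (f' x) a)"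
        by (simp_all only: x y)
    qed
    have 1: "?g x (g (f' x) a) = a" if "a \<in> fil C (f' x) (f' y)" for a
      using ginv[OF x(1)] fil_sub[OF le that] by simp
    have 2: "?g y (g (f' y) a) = a" if "a \<in> idl C (f' x) (f' y)" for a
      using ginv[OF y(1)] idl_sub[OF le that] by simp
    have "fil C (f' x) (f' y) = ?g x ` fil C' x y" using 1 by (force simp: e(1))
    moreover have "idl C (f' x) (f' y) = ?g y ` idl C' x y" using 2 by (force simp: e(2))
    moreover have "?g y (conn C' x y a) = conn C (f' x) (f' y) (?g x a)" if a: "a \<in> fil C' x y" for a
    proof -
      obtain b where b: "b \<in> fil C (f' x) (f' y)" "a = g (f' x) b" using a by (auto simp: e(1))
      then show ?thesis using e(3)[OF b(1), symmetric] 1[OF b(1)] 2[OF conn_idl[OF b(1)]] by simp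
    qed
    ultimately show ?thesis by blast
  qed
  ultimately show ?thesis unfolding mc_iso_def by blast
qed

lemma mc_isomorphic_sym: "mc_system C \<Longrightarrow> C \<cong>\<^sub>M C' \<Longrightarrow> C' \<cong>\<^sub>M C"
  unfolding mc_isomorphic_def using mc_iso_inverse by blast

lemma mc_isomorphic_trans: "C \<cong>\<^sub>M C' \<Longrightarrow> C' \<cong>\<^sub>M C'' \<Longrightarrow> C \<cong>\<^sub>M C''"
  unfolding mc_isomorphic_def using mc_iso_comp by blast

text \<open>The map on points preserves and reflects the gluing relation, so it maps classes onto
  classes, and block steps correspond to block steps.\<close>

lemma sum_isomorphic:
  assumes C: "mc_system C" and C': "mc_system C'" and iso: "mc_iso C C' f g"
  shows "lattice_iso (mc_sum C) (mc_sum C') (\<lambda>p. (\<lambda>(x, a). (f x, g x a)) ` p)"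
proof (rule lattice_iso_orderI)
  interpret C: mc_system C by (rule C)
  interpret C': mc_system C' by (rule C')
  let ?h = "\<lambda>(x, a). (f x, g x a)" and ?S = "skel C" and ?S' = "skel C'"
  let ?G = "glue ?S (mc_blk C)" and ?G' = "glue ?S' (mc_blk C')"
  have fS: "lattice_iso ?S ?S' f" using iso by (simp add: mc_iso_def)
  note f = lattice_iso_orderD(3)[OF fS]
  have fj: "f (x \<squnion>\<^bsub>?S\<^esub> y) = f x \<squnion>\<^bsub>?S'\<^esub> f y" if "x \<in> carrier ?S" "y \<in> carrier ?S" for x y
    using fS that by (simp add: lattice_iso_def join_pres_def)
  have fc: "f x \<in> carrier ?S'" if "x \<in> carrier ?S" for x using f that by (rule bij_betw_apply)
  have gi: "lattice_iso (block C x) (block C' (f x)) (g x)" if "x \<in> carrier ?S" for x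
    using iso that by (simp add: mc_iso_def)
  note g = lattice_iso_orderD(3,4)[OF gi]
  have gc: "g x a \<in> carrier (block C' (f x))" if "x \<in> carrier ?S" "a \<in> carrier (block C x)" for x a
    using g(1)[OF that(1)] that(2) by (rule bij_betw_apply)
  have ginj: "g x a = g x b \<longleftrightarrow> a = b"
    if "x \<in> carrier ?S" "a \<in> carrier (block C x)" "b \<in> carrier (block C x)" for x a b
    using g(1)[OF that(1)] that by (auto simp: bij_betw_def inj_on_eq_iff)
  have tol: "tol C x y \<longleftrightarrow> tol C' (f x) (f y)" if "x \<in> carrier ?S" "y \<in> carrier ?S" for x y
    using iso that by (simp add: mc_iso_def)
  have conn: "fil C' (f x) (f y) = g x ` fil C x y"
    "a \<in> fil C x y \<Longrightarrow> g y (conn C x y a) = conn C' (f x) (f y) (g x a)" if "le_tol C x y" for x y a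
    using iso that by (auto simp: mc_iso_def)
  have rel: "((f x, g x a), (f y, g y b)) \<in> glue_rel C' \<longleftrightarrow> ((x, a), (y, b)) \<in> glue_rel C"
    if xa: "x \<in> carrier ?S" "a \<in> carrier (block C x)" and yb: "y \<in> carrier ?S" "b \<in> carrier (block C y)"
    for x a y b
  proof (cases "tol C x y")
    case True
    let ?j = "x \<squnion>\<^bsub>?S\<^esub> y"
    note j = C.tol_join_right[OF xa(1) yb(1) True]
    have fil: "g z c \<in> fil C' (f z) (f ?j) \<longleftrightarrow> c \<in> fil C z ?j"
      if "le_tol C z ?j" "c \<in> carrier (block C z)" for z c
      using conn(1)[OF that(1)] ginj[of z] C.fil_sub[OF that(1)] C.le_tolD[OF that(1)] that(2) by auto
    have "conn C' (f x) (f ?j) (g x a) = conn C' (f y) (f ?j) (g y b) \<longleftrightarrow> conn C x ?j a = conn C y ?j b"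
      if "a \<in> fil C x ?j" "b \<in> fil C y ?j"
      using conn(2)[OF j(1) that(1)] conn(2)[OF j(2) that(2)] C.conn_L[OF j(1) that(1)]
        C.conn_L[OF j(2) that(2)] ginj[of ?j] C.le_tolD[OF j(1)] by metis
    then show ?thesis
      using True tol[OF xa(1) yb(1)] fil[OF j(1) xa(2)] fil[OF j(2) yb(2)] xa yb fc gc
      by (auto simp: C.rel_iff C'.rel_iff fj[symmetric])
  next
    case False
    then show ?thesis using tol[OF xa(1) yb(1)] by (simp add: C.rel_iff C'.rel_iff)
  qed
  have pt: "\<exists>x a. x \<in> carrier ?S \<and> a \<in> carrier (block C x) \<and> x' = f x \<and> a' = g x a"
    if "x' \<in> carrier ?S'" "a' \<in> carrier (block C' x')" for x' a'
  proof -
    have "x' \<in> f ` carrier ?S" using that(1) bij_betw_imp_surj_on[OF f] by simp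
    then obtain x where x: "x \<in> carrier ?S" "x' = f x" by blast
    then have "a' \<in> g x ` carrier (block C x)"
      using that(2) bij_betw_imp_surj_on[OF g(1)[OF x(1)]] by simp
    then show ?thesis using x by blast
  qed
  have proj: "?h ` proj C x a = proj C' (f x) (g x a)"
    if xa: "x \<in> carrier ?S" "a \<in> carrier (block C x)" for x a
  proof
    show "?h ` proj C x a \<subseteq> proj C' (f x) (g x a)"
      unfolding proj_def using rel[OF xa] by (auto simp: C.rel_iff)
    show "proj C' (f x) (g x a) \<subseteq> ?h ` proj C x a"
    proof
      fix q assume q: "q \<in> proj C' (f x) (g x a)"
      obtain y' b' where "q = (y', b')" by (cases q)
      then have yb: "q = (y', b')" "((f x, g x a), (y', b')) \<in> glue_rel C'"
        using q by (auto simp: proj_def)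
      then obtain y b where y: "y \<in> carrier ?S" "b \<in> carrier (block C y)" "y' = f y" "b' = g y b"
        using pt[of y' b'] by (auto simp: C'.rel_iff)
      then have "(y, b) \<in> proj C x a" using rel[OF xa y(1,2)] yb by (simp add: proj_def)
      then show "q \<in> ?h ` proj C x a" using y yb by force
    qed
  qed
  have car: "carrier ?G = {proj C x a | x a. x \<in> carrier ?S \<and> a \<in> carrier (block C x)}"
    by (auto simp: glue_def mc_blk_def sum_block_def)
  have car': "carrier ?G' = {proj C' x a | x a. x \<in> carrier ?S' \<and> a \<in> carrier (block C' x)}"
    by (auto simp: glue_def mc_blk_def sum_block_def)
  have inj: "p = q" if pq: "p \<in> carrier ?G" "q \<in> carrier ?G" "?h ` p = ?h ` q" for p q
  proof -
    obtain x a y b where xy: "x \<in> carrier ?S" "a \<in> carrier (block C x)" "p = proj C x a"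
      "y \<in> carrier ?S" "b \<in> carrier (block C y)" "q = proj C y b"
      using pq(1,2) unfolding car by blast
    then have "proj C' (f x) (g x a) = proj C' (f y) (g y b)" using proj pq(3) by simp
    then have "((x, a), (y, b)) \<in> glue_rel C"
      using C'.proj_eq_iff[of "f x" "g x a" "f y" "g y b"] rel xy fc gc by simp
    then show ?thesis using C.proj_eq_iff xy by simp
  qed
  show "lattice (mc_sum C)" unfolding C.mc_sum_glue by (rule C.B.glue_lattice)
  show "eq (mc_sum C') = (=)" by (simp add: mc_sum_def)
  show "bij_betw (\<lambda>p. ?h ` p) (carrier (mc_sum C)) (carrier (mc_sum C'))"
    unfolding C.mc_sum_glue C'.mc_sum_glue bij_betw_def
  proof
    show "inj_on (\<lambda>p. ?h ` p) (carrier ?G)" using inj by (rule inj_onI)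
    show "(\<lambda>p. ?h ` p) ` carrier ?G = carrier ?G'"
    proof
      show "(\<lambda>p. ?h ` p) ` carrier ?G \<subseteq> carrier ?G'"
        unfolding car car' using proj fc gc by auto blast
      show "carrier ?G' \<subseteq> (\<lambda>p. ?h ` p) ` carrier ?G"
      proof
        fix q assume "q \<in> carrier ?G'"
        then obtain x' a' where xa': "x' \<in> carrier ?S'" "a' \<in> carrier (block C' x')" "q = proj C' x' a'"
          unfolding car' by blast
        then obtain x a where xa: "x \<in> carrier ?S" "a \<in> carrier (block C x)" "x' = f x" "a' = g x a"
          using pt by blast
        show "q \<in> (\<lambda>p. ?h ` p) ` carrier ?G"
          using proj[OF xa(1,2)] xa xa' unfolding car by (intro image_eqI[of _ _ "proj C x a"]) auto
      qed
    qed
  qed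
  have at: "block_le ?S' (mc_blk C') (f x) (proj C' (f x) (g x a)) (proj C' (f x) (g x b)) \<longleftrightarrow>
      block_le ?S (mc_blk C) x (proj C x a) (proj C x b)"
    if "x \<in> carrier ?S" "a \<in> carrier (block C x)" "b \<in> carrier (block C x)" for x a b
    using C.sum_le_at_proj[OF that] C'.sum_le_at_proj[OF fc gc gc] g(2) that fc
    by (simp add: C.at_eq C'.at_eq)
  have atE: "\<exists>a b. x \<in> carrier ?S \<and> a \<in> carrier (block C x) \<and> b \<in> carrier (block C x) \<and>
      p = proj C x a \<and> q = proj C x b" if "block_le ?S (mc_blk C) x p q" for x p q
    using that by (auto simp: block_le_def mc_blk_def sum_block_def)
  have atE': "\<exists>x a b. x' = f x \<and> x \<in> carrier ?S \<and> a \<in> carrier (block C x) \<and> b \<in> carrier (block C x) \<and>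
      p = proj C' x' (g x a) \<and> q = proj C' x' (g x b)" if "block_le ?S' (mc_blk C') x' p q" for x' p q
  proof -
    obtain a' b' where x': "x' \<in> carrier ?S'" and ab': "a' \<in> carrier (block C' x')"
      "b' \<in> carrier (block C' x')" "p = proj C' x' a'" "q = proj C' x' b'"
      using \<open>block_le _ _ _ _ _\<close> by (auto simp: block_le_def mc_blk_def sum_block_def)
    obtain x where x: "x \<in> carrier ?S" "x' = f x"
      using x' bij_betw_imp_surj_on[OF f] by blast
    then have "a' \<in> g x ` carrier (block C x)" "b' \<in> g x ` carrier (block C x)"
      using ab' bij_betw_imp_surj_on[OF g(1)[OF x(1)]] by auto
    then show ?thesis using x ab' by blast
  qed
  fix p q assume "p \<in> carrier (mc_sum C)" "q \<in> carrier (mc_sum C)"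
  then have pq: "p \<in> carrier ?G" "q \<in> carrier ?G" by (simp_all add: C.mc_sum_glue)
  have "?h ` p \<sqsubseteq>\<^bsub>?G'\<^esub> ?h ` q" if "p \<sqsubseteq>\<^bsub>?G\<^esub> q"
  proof -
    have "(\<lambda>p q. \<exists>x. block_le ?S (mc_blk C) x p q)\<^sup>*\<^sup>* p q" using that by (simp add: C.B.gle_iff)
    then show ?thesis
    proof (induction rule: rtranclp_induct)
      case base
      obtain x a where "x \<in> carrier ?S" "a \<in> carrier (block C x)" "p = proj C x a"
        using pq(1) unfolding car by blast
      then have "?h ` p \<in> carrier ?G'"
        unfolding car' using proj[of x a] fc[of x] gc[of x a] by simp blast
      then show ?case by (rule C'.B.gle_refl)
    next
      case (step r s)
      then obtain x where x: "block_le ?S (mc_blk C) x r s" by blast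
      then obtain a b where ab: "x \<in> carrier ?S" "a \<in> carrier (block C x)" "b \<in> carrier (block C x)"
        "r = proj C x a" "s = proj C x b" using atE by blast
      then have "block_le ?S' (mc_blk C') (f x) (?h ` r) (?h ` s)"
        using x at[OF ab(1-3)] proj[OF ab(1,2)] proj[OF ab(1,3)] by simp
      then have "?h ` r \<sqsubseteq>\<^bsub>?G'\<^esub> ?h ` s" by (rule C'.B.at_gle)
      then show ?case using step.IH C'.B.gle_trans by blast
    qed
  qed
  moreover have "p \<sqsubseteq>\<^bsub>?G\<^esub> q" if "?h ` p \<sqsubseteq>\<^bsub>?G'\<^esub> ?h ` q"
  proof -
    have "(\<lambda>p q. \<exists>x. block_le ?S' (mc_blk C') x p q)\<^sup>*\<^sup>* (?h ` p) (?h ` q)"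
      using that by (simp add: C'.B.gle_iff)
    \<comment> \<open>The path is pulled back step by step; \<open>inj\<close> identifies the end of
      the lifted path with the start of the next lifted step.\<close>
    then have "\<exists>s. ?h ` q = ?h ` s \<and> p \<sqsubseteq>\<^bsub>?G\<^esub> s"
    proof (induction rule: rtranclp_induct)
      case base
      then show ?case using C.B.gle_refl[OF pq(1)] by blast
    next
      case (step r' s')
      then obtain r x' where r: "r' = ?h ` r" "p \<sqsubseteq>\<^bsub>?G\<^esub> r" and x': "block_le ?S' (mc_blk C') x' r' s'"
        by blast
      obtain x a b where ab: "x' = f x" "x \<in> carrier ?S" "a \<in> carrier (block C x)" "b \<in> carrier (block C x)"
        "r' = proj C' x' (g x a)" "s' = proj C' x' (g x b)" using atE'[OF x'] by blast
      have "proj C x a \<in> carrier ?G" using ab unfolding car by blast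
      then have "r = proj C x a"
        using inj[of r "proj C x a"] r ab proj[OF ab(2,3)] C.B.gle_carrier by simp
      then have "r \<sqsubseteq>\<^bsub>?G\<^esub> proj C x b" using at[OF ab(2-4)] x' ab C.B.at_gle by simp
      then have "p \<sqsubseteq>\<^bsub>?G\<^esub> proj C x b" using r C.B.gle_trans by blast
      then show ?case using proj[OF ab(2,4)] ab by metis
    qed
    then obtain s where s: "?h ` q = ?h ` s" "p \<sqsubseteq>\<^bsub>?G\<^esub> s" by blast
    then show ?thesis using inj[OF pq(2) _ s(1)] C.B.gle_carrier[OF s(2)] by simp
  qed
  ultimately show "?h ` p \<sqsubseteq>\<^bsub>mc_sum C'\<^esub> ?h ` q \<longleftrightarrow> p \<sqsubseteq>\<^bsub>mc_sum C\<^esub> q"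
    unfolding C.mc_sum_glue C'.mc_sum_glue by blast
qed

section \<open>Transport of blocks along lattice isomorphisms\<close>

lemma lattice_iso_interval:
  assumes f: "lattice_iso L M f" and xy: "x \<in> carrier L" "y \<in> carrier L"
  shows "f ` \<lbrace>x..y\<rbrace>\<^bsub>L\<^esub> = \<lbrace>f x..f y\<rbrace>\<^bsub>M\<^esub>"
  using lattice_iso_orderD(4)[OF f] xy bij_betw_imp_surj_on[OF lattice_iso_orderD(3)[OF f], symmetric]
  by (auto simp: at_least_at_most_def)

lemma lattice_iso_complemented_between:
  assumes f: "lattice_iso L M f" and c: "complemented_between L x y"
  shows "complemented_between M (f x) (f y)"
proof -
  have xy: "x \<in> carrier L" "y \<in> carrier L" "x \<sqsubseteq>\<^bsub>L\<^esub> y" using c by (auto simp: complemented_between_def)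
  note d = lattice_iso_orderD[OF f]
  have hom: "f (a \<squnion>\<^bsub>L\<^esub> b) = f a \<squnion>\<^bsub>M\<^esub> f b" "f (a \<sqinter>\<^bsub>L\<^esub> b) = f a \<sqinter>\<^bsub>M\<^esub> f b"
    if "a \<in> carrier L" "b \<in> carrier L" for a b
    using f that by (auto simp: lattice_iso_def join_pres_def meet_pres_def)
  have sub: "a \<in> carrier L" if "a \<in> \<lbrace>x..y\<rbrace>\<^bsub>L\<^esub>" for a using that by (simp add: at_least_at_most_def)
  have "\<exists>b\<in>\<lbrace>f x..f y\<rbrace>\<^bsub>M\<^esub>. a \<squnion>\<^bsub>M\<^esub> b = f y \<and> a \<sqinter>\<^bsub>M\<^esub> b = f x"
    if a: "a \<in> \<lbrace>f x..f y\<rbrace>\<^bsub>M\<^esub>" for a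
  proof -
    obtain a' where a': "a' \<in> \<lbrace>x..y\<rbrace>\<^bsub>L\<^esub>" "a = f a'"
      using a lattice_iso_interval[OF f xy(1,2)] by blast
    then obtain b where b: "b \<in> \<lbrace>x..y\<rbrace>\<^bsub>L\<^esub>" "a' \<squnion>\<^bsub>L\<^esub> b = y" "a' \<sqinter>\<^bsub>L\<^esub> b = x"
      using c by (auto simp: complemented_between_def)
    have "f b \<in> \<lbrace>f x..f y\<rbrace>\<^bsub>M\<^esub>" using lattice_iso_interval[OF f xy(1,2)] b(1) by blast
    moreover have "a \<squnion>\<^bsub>M\<^esub> f b = f y" "a \<sqinter>\<^bsub>M\<^esub> f b = f x"
      using hom[OF sub[OF a'(1)] sub[OF b(1)]] a' b by auto
    ultimately show ?thesis by blast
  qed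
  then show ?thesis
    unfolding complemented_between_def using d(4) xy bij_betw_apply[OF d(3)] by blast
qed

lemma complemented_interval_iso:
  assumes f: "lattice_iso L M f" and B: "complemented_interval L B"
  shows "complemented_interval M (f ` B)"
  using B lattice_iso_complemented_between[OF f] lattice_iso_interval[OF f]
  unfolding complemented_interval_between[OF lattice_iso_orderD(1)[OF f]]
    complemented_interval_between[OF lattice_iso_orderD(2)[OF f]]
  by (metis complemented_between_def)

lemma complemented_interval_subset: "complemented_interval L B \<Longrightarrow> B \<subseteq> carrier L"
  by (auto simp: complemented_interval_def at_least_at_most_def)

text \<open>A complemented interval containing the image is pulled back by the inverse isomorphism
  to one containing \<open>B\<close>, so maximality of \<open>B\<close> decides.\<close>

lemma lattice_blocks_iso:
  assumes f: "lattice_iso L M f" and B: "B \<in> lattice_blocks L"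
  shows "f ` B \<in> lattice_blocks M"
proof -
  let ?g = "inv_into (carrier L) f"
  note g = lattice_iso_inv_into[OF f] and bij = lattice_iso_orderD(3)[OF f]
  have Bc: "complemented_interval L B" using B by (simp add: lattice_blocks_def)
  have gf: "?g ` f ` A = A" if "A \<subseteq> carrier L" for A
    using that bij by (simp add: bij_betw_def inv_into_image_cancel)
  have fg: "f ` ?g ` A = A" if "A \<subseteq> carrier M" for A
    using that bij by (simp add: bij_betw_def image_inv_into_cancel)
  have "B' = f ` B" if B': "complemented_interval M B'" "f ` B \<subseteq> B'" for B'
  proof -
    have "B \<subseteq> ?g ` B'" using image_mono[OF B'(2), of ?g] gf[OF complemented_interval_subset[OF Bc]] by simp
    then have "?g ` B' = B"
      using B complemented_interval_iso[OF g B'(1)] by (simp add: lattice_blocks_def)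
    then show ?thesis using fg[OF complemented_interval_subset[OF B'(1)]] by simp
  qed
  then show ?thesis
    using complemented_interval_iso[OF f Bc] by (auto simp: lattice_blocks_def)
qed

lemma dissection_isomorphic:
  assumes L: "modular_lffc_lattice L" and L': "modular_lffc_lattice L'" and iso: "lattice_iso L L' f"
  shows "mc_iso (dissection L) (dissection L') ((`) f) (\<lambda>_. f)"
proof -
  interpret L: modular_lffc L by (rule modular_lffc.intro[OF L])
  interpret L': modular_lffc L' by (rule modular_lffc.intro[OF L'])
  let ?g = "inv_into (carrier L) f"
  note g = lattice_iso_inv_into[OF iso] and f = lattice_iso_orderD(3,4)[OF iso]
  have inj: "inj_on f (carrier L)" using f(1) by (simp add: bij_betw_def)
  have sub: "B \<subseteq> carrier L" if "B \<in> L.Blocks" for B using L.mem_block_iff[OF that] by blast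
  have sub': "B \<subseteq> carrier L'" if "B \<in> L'.Blocks" for B using L'.mem_block_iff[OF that] by blast
  have lo: "L'.lo (f ` B) = f (L.lo B)" if B: "B \<in> L.Blocks" for B
  proof -
    note b = L.block_bounds(1-3)[OF B]
    have "f ` B = \<lbrace>f (L.lo B)..f (L.hi B)\<rbrace>\<^bsub>L'\<^esub>"
      using lattice_iso_interval[OF iso b(1,2)] L.block_bounds(4)[OF B] by simp
    moreover have "f (L.lo B) \<in> carrier L'" "f (L.hi B) \<in> carrier L'" "f (L.lo B) \<sqsubseteq>\<^bsub>L'\<^esub> f (L.hi B)"
      using b f bij_betw_apply[OF f(1)] by auto
    ultimately show ?thesis using L'.interval_lattice(4)[of "f (L.lo B)" "f (L.hi B)"] by simp
  qed
  have S: "lattice_iso L.S L'.S ((`) f)"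
  proof (rule lattice_iso_orderI)
    show "bij_betw ((`) f) (carrier L.S) (carrier L'.S)"
      unfolding L.S_simps L'.S_simps bij_betw_def
    proof
      show "inj_on ((`) f) L.Blocks"
        using inj sub by (intro inj_onI) (simp add: inj_on_image_eq_iff)
      have "B' \<in> (`) f ` L.Blocks" if "B' \<in> L'.Blocks" for B'
        using lattice_blocks_iso[OF g that] sub'[OF that] f(1)
        by (intro image_eqI[of _ _ "?g ` B'"]) (simp_all add: bij_betw_def image_inv_into_cancel)
      then show "(`) f ` L.Blocks = L'.Blocks" using lattice_blocks_iso[OF iso] by blast
    qed
    show "f ` B \<sqsubseteq>\<^bsub>L'.S\<^esub> f ` C \<longleftrightarrow> B \<sqsubseteq>\<^bsub>L.S\<^esub> C" if "B \<in> carrier L.S" "C \<in> carrier L.S" for B C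
      using that lo f(2) L.block_bounds(1) by (simp add: L.S_simps L'.S_simps)
  qed (use L.S_lattice L'.S_simps in auto)
  have blk: "lattice_iso (L\<lparr>carrier := B\<rparr>) (L'\<lparr>carrier := f ` B\<rparr>) f" if B: "B \<in> L.Blocks" for B
  proof (rule lattice_iso_orderI)
    show "lattice (L\<lparr>carrier := B\<rparr>)" by (rule L.block_sublattice(1)[OF B])
    show "bij_betw f (carrier (L\<lparr>carrier := B\<rparr>)) (carrier (L'\<lparr>carrier := f ` B\<rparr>))"
      using inj_on_subset[OF inj sub[OF B]] by (simp add: bij_betw_def)
    show "f a \<sqsubseteq>\<^bsub>L'\<lparr>carrier := f ` B\<rparr>\<^esub> f b \<longleftrightarrow> a \<sqsubseteq>\<^bsub>L\<lparr>carrier := B\<rparr>\<^esub> b"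
      if "a \<in> carrier (L\<lparr>carrier := B\<rparr>)" "b \<in> carrier (L\<lparr>carrier := B\<rparr>)" for a b
      using f(2)[of a b] sub[OF B] that by auto
  qed (simp add: L'.eq_is_equal)
  have int: "f ` B \<inter> f ` C = f ` (B \<inter> C)" if "B \<in> L.Blocks" "C \<in> L.Blocks" for B C
    using inj_on_image_Int[OF inj] sub that by blast
  show ?thesis
    unfolding mc_iso_def using S blk int by (simp add: L.D_simps L'.D_simps L.S_simps(1))
qed

text \<open>The backward direction passes through dissections: each system is isomorphic to the
  dissection of its sum, and isomorphic sums have isomorphic dissections.\<close>

lemma sum_isomorphic_iff:
  fixes C :: "('s, 'b) mc_data" and C' :: "('t, 'c) mc_data"
  assumes C: "mc_system C" and C': "mc_system C'"
  shows "C \<cong>\<^sub>M C' \<longleftrightarrow> mc_sum C \<cong>\<^sub>L mc_sum C'"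
proof
  assume "C \<cong>\<^sub>M C'"
  then show "mc_sum C \<cong>\<^sub>L mc_sum C'"
    using sum_isomorphic[OF C C'] by (auto simp: mc_isomorphic_def lattice_isomorphic_def)
next
  assume "mc_sum C \<cong>\<^sub>L mc_sum C'"
  then have "dissection (mc_sum C) \<cong>\<^sub>M dissection (mc_sum C')"
    using dissection_isomorphic[OF mc_system.mc_sum_modular_lffc[OF C] mc_system.mc_sum_modular_lffc[OF C']]
    by (auto simp: mc_isomorphic_def lattice_isomorphic_def)
  moreover have "C \<cong>\<^sub>M dissection (mc_sum C)" "C' \<cong>\<^sub>M dissection (mc_sum C')"
    using mc_system.mc_iso_dissection_sum[OF C] mc_system.mc_iso_dissection_sum[OF C']
    unfolding mc_isomorphic_def by blast+
  moreover have "dissection (mc_sum C') \<cong>\<^sub>M C'"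
    by (rule mc_isomorphic_sym[OF C']) fact
  ultimately show "C \<cong>\<^sub>M C'"
    by (intro mc_isomorphic_trans[of C "dissection (mc_sum C)" C']
        mc_isomorphic_trans[of "dissection (mc_sum C)" "dissection (mc_sum C')" C'])
qed

lemma isomorphic_sum_dissection: "modular_lffc_lattice L \<Longrightarrow> mc_sum (dissection L) \<cong>\<^sub>L L"
  using modular_lffc.lattice_iso_sum_dissection[OF modular_lffc.intro] lattice_isomorphic_sym
  unfolding lattice_isomorphic_def by blast

text \<open>The backward direction passes through the sums of the dissections, which are isomorphic
  to the original lattices.\<close>

lemma dissection_isomorphic_iff:
  fixes L :: "'a gorder" and L' :: "'d gorder"
  assumes L: "modular_lffc_lattice L" and L': "modular_lffc_lattice L'"
  shows "L \<cong>\<^sub>L L' \<longleftrightarrow> dissection L \<cong>\<^sub>M dissection L'"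
proof
  assume "L \<cong>\<^sub>L L'"
  then show "dissection L \<cong>\<^sub>M dissection L'"
    using dissection_isomorphic[OF L L'] by (auto simp: mc_isomorphic_def lattice_isomorphic_def)
next
  assume "dissection L \<cong>\<^sub>M dissection L'"
  then have "mc_sum (dissection L) \<cong>\<^sub>L mc_sum (dissection L')"
    using sum_isomorphic_iff[OF modular_lffc.dissection_mc_system[OF modular_lffc.intro[OF L]]
        modular_lffc.dissection_mc_system[OF modular_lffc.intro[OF L']]] by simp
  then show "L \<cong>\<^sub>L L'"
    using lattice_isomorphic_trans[OF lattice_isomorphic_trans[OF
          lattice_isomorphic_sym[OF isomorphic_sum_dissection[OF L]]] isomorphic_sum_dissection[OF L']]
    by simp
qed

lemma isomorphic_dissection_sum: "mc_system C \<Longrightarrow> dissection (mc_sum C) \<cong>\<^sub>M C"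
  using mc_system.mc_iso_dissection_sum mc_isomorphic_sym unfolding mc_isomorphic_def by blast

text \<open>The statement for systems is applied to the dissection, and the minimum is carried over
  to \<open>L\<close> by the isomorphism with the sum.\<close>

lemma dissection_minimum:
  assumes "modular_lffc_lattice L"
  shows "has_minimum (skel (dissection L)) \<longleftrightarrow> has_minimum L"
  using mc_system.mc_sum_minimum[OF modular_lffc.dissection_mc_system[OF modular_lffc.intro[OF assms]]]
    has_minimum_isomorphic[OF isomorphic_sum_dissection[OF assms]] by simp

text \<open>The two equivalences make both maps well defined and injective on isomorphism classes;
  the round trips make them surjective and inverse to each other.\<close>

theorem theorem8p1:
  shows
    "(\<forall>C :: ('s, 'b) mc_data. mc_system C \<longrightarrow> modular_lffc_lattice (mc_sum C)) \<and>
     (\<forall>L :: 'a gorder. modular_lffc_lattice L \<longrightarrow> mc_system (dissection L)) \<and>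
     (\<forall>(C :: ('s, 'b) mc_data) (C' :: ('t, 'c) mc_data). mc_system C \<and> mc_system C' \<longrightarrow>
        (C \<cong>\<^sub>M C' \<longleftrightarrow> mc_sum C \<cong>\<^sub>L mc_sum C')) \<and>
     (\<forall>(L :: 'a gorder) (L' :: 'd gorder). modular_lffc_lattice L \<and> modular_lffc_lattice L' \<longrightarrow>
        (L \<cong>\<^sub>L L' \<longleftrightarrow> dissection L \<cong>\<^sub>M dissection L')) \<and>
     (\<forall>C :: ('s, 'b) mc_data. mc_system C \<longrightarrow> dissection (mc_sum C) \<cong>\<^sub>M C) \<and>
     (\<forall>L :: 'a gorder. modular_lffc_lattice L \<longrightarrow> mc_sum (dissection L) \<cong>\<^sub>L L) \<and>
     (\<forall>L :: 'a gorder. modular_lffc_lattice L \<longrightarrow>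
        (\<exists>C :: ('a set, 'a) mc_data. mc_system C \<and> mc_sum C \<cong>\<^sub>L L)) \<and>
     (\<forall>C :: ('s, 'b) mc_data. mc_system C \<longrightarrow>
        (\<exists>L :: ('s \<times> 'b) set gorder. modular_lffc_lattice L \<and> dissection L \<cong>\<^sub>M C)) \<and>
     (\<forall>C :: ('s, 'b) mc_data. mc_system C \<longrightarrow>
        (has_minimum (skel C) \<longleftrightarrow> has_minimum (mc_sum C))) \<and>
     (\<forall>L :: 'a gorder. modular_lffc_lattice L \<longrightarrow>
        (has_minimum (skel (dissection L)) \<longleftrightarrow> has_minimum L))"
proof (intro conjI allI impI)
  fix C :: "('s, 'b) mc_data"
  assume C: "mc_system C"
  show "modular_lffc_lattice (mc_sum C)" by (rule mc_system.mc_sum_modular_lffc[OF C])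
  show "dissection (mc_sum C) \<cong>\<^sub>M C" by (rule isomorphic_dissection_sum[OF C])
  then show "\<exists>L :: ('s \<times> 'b) set gorder. modular_lffc_lattice L \<and> dissection L \<cong>\<^sub>M C"
    using mc_system.mc_sum_modular_lffc[OF C] by blast
  show "has_minimum (skel C) \<longleftrightarrow> has_minimum (mc_sum C)" by (rule mc_system.mc_sum_minimum[OF C])
next
  fix L :: "'a gorder"
  assume L: "modular_lffc_lattice L"
  show "mc_system (dissection L)"
    by (rule modular_lffc.dissection_mc_system[OF modular_lffc.intro[OF L]])
  show "mc_sum (dissection L) \<cong>\<^sub>L L" by (rule isomorphic_sum_dissection[OF L])
  with \<open>mc_system (dissection L)\<close>
  show "\<exists>C :: ('a set, 'a) mc_data. mc_system C \<and> mc_sum C \<cong>\<^sub>L L" by blast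
  show "has_minimum (skel (dissection L)) \<longleftrightarrow> has_minimum L" by (rule dissection_minimum[OF L])
qed (use sum_isomorphic_iff dissection_isomorphic_iff in blast)+

end
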